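(* Let $p\ge 2$ be a prime, let $X=X(p)$ be the finite set of variables and $I=I(p)\subset M(X)$ the monomial ideal defined in the context, and let $G_I$ be the group of all automorphisms of the monoid $M(X)$ that preserve $I$. Let $\Bbbk'$ be any algebraic field extension of $\Bbbk=\mathbb F_p$, let $R'=\Bbbk'[X]$ with its standard $\mathbb Z$-grading, and let $\mathfrak m$ be the ideal generated by the variables. Then there do not exist data consisting of - an action of $G_I$ as field automorphisms of $\Bbbk'$ over $\Bbbk$; - a chain complex $\mathfrak M = (0\leftarrow M_0\leftarrow \dots\leftarrow M_{n-1}\xleftarrow{\mu_n}M_n\leftarrow\cdots)$ of finite free $R'$-modules, acyclic in positive degrees (i.e. $H_i(\mathfrak M)=0$ for $i\ge 1$), with $\mu_n(M_n)\subseteq \mathfrak m M_{n-1}$ for each $n\ge 1$; and - a group homomorphism $\mathfrak M\colon G_I\to \mathrm{Aut}_{\Bbbk}(\mathfrak M)$, $\sigma\mapsto\mathfrak M(\sigma)$, to the group of automorphisms of $\mathfrak M$ as a chain complex of $\Bbbk$-vector spaces; such that both of the following hold: (1) there exist $R'$-module isomorphisms $\epsilon\colon H_0(\mathfrak M)\to IR'$ and $\theta_n\colon M_n\to\bigoplus_{d\in\mathbb Z}R'(-d)^{\beta_{n,d}}$ for all $n\ge 0$, such that for $n\ge 1$ each map $\theta_{n-1}\mu_n\theta_n^{-1}$ is a morphism of $\mathbb Z$-graded $R'$-modules, and, with respect to the corresponding induced $\mathbb Z$-grading on $H_0(\mathfrak M)$, so is $\epsilon$; (2) there exists an $R'$-module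 isomorphism $\delta\colon H_0(\mathfrak M)\to IR'$ such that for each $\sigma\in G_I$ the automorphism $\mathfrak M(\sigma)\colon\mathfrak M\to\sigma_*\mathfrak M$ is a morphism of chain complexes of $R'$-modules, and the induced isomorphism $\bar\sigma\colon H_0(\mathfrak M)\to\sigma_*H_0(\mathfrak M)$ satisfies $\sigma\delta=\delta\bar\sigma$.
   Context: For a finite set $X$, $M(X)=\{f\colon X\to\mathbb N\}$ is the free abelian monoid on $X$, whose elements are identified with monomials $\prod_{y\in X}y^{f(y)}$. A monomial ideal is an ideal $I$ of the monoid $M(X)$; for a ring of coefficients $\Bbbk'$ it generates the ideal $IR'$ of $R'=\Bbbk'[X]$. Automorphisms of $M(X)$ are induced by permutations of $X$, and $G_I$ is identified with the set of permutations of $X$ leaving the set of monomials in $I$ invariant. Given an action of $G_I$ on $\Bbbk'$ by field automorphisms, each $\sigma\in G_I$ induces a ring automorphism, also denoted $\sigma$, of $R'$: it acts on coefficients via the action on $\Bbbk'$ and on the variables via the permutation; it preserves $IR'$. For a ring automorphism $\sigma$ of $R'$ and an $R'$-module $M$, $\sigma_*M$ is the same abelian group with module structure $r\cdot m=\sigma(r)m$; thus $\sigma\colon IR'\to\sigma_*(IR')$ is $R'$-linear. $R'(-d)$ is the twisted graded module with $R'(-d)_k=R'_{k-d}$. Definition of $I(p)$. Put $n=4$ if $p=2$ and $n=p$ otherwise. Let $X=X(p)=\{v_0,\dots,v_n,e_{1,2},e_{2,3},\dots,e_{n-1,n},e_{n,1}\}$ ($2n+1$ variables), and $m=\prod_{y\in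 X}y$. $I(p)$ is generated by the monomials $m_0,\dots,m_n$ where $$m_0=\frac{m}{v_0},\quad m_1=\frac{v_0m}{e_{n,1}v_1e_{1,2}},\quad m_n=\frac{v_0m}{e_{n-1,n}v_ne_{n,1}},\quad m_i=\frac{v_0m}{e_{i-1,i}v_ie_{i,i+1}}\ (2\le i\le n-1).$$ *)

theory Defs
  imports "HOL-Library.Poly_Mapping" "HOL-Computational_Algebra.Polynomial"
    "HOL-Algebra.Module" "HOL-Algebra.AbelCoset" "HOL-Algebra.Ideal"
    "HOL-Algebra.Bij" "HOL-Algebra.Generated_Groups"
begin

section \<open>The monoid $M(X)$ and monomial ideals\<close>

text \<open>
  A monomial is a finitely supported exponent function, written additively; a polynomial is a
  finitely supported function from monomials to coefficients, with the convolution product of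
  \<^theory>\<open>HOL-Library.Poly_Mapping\<close>.  As $X$ depends on a number, it is a set of
  elements of an ambient type \<open>'x\<close> rather than a type.
\<close>

type_synonym 'x monom = "'x \<Rightarrow>\<^sub>0 nat"
type_synonym ('x, 'k) mpol = "'x monom \<Rightarrow>\<^sub>0 'k"

definition monomial_monoid :: "'x set \<Rightarrow> 'x monom monoid" where
  "monomial_monoid X =
    \<lparr>carrier = {a. Poly_Mapping.keys a \<subseteq> X}, mult = (+), one = 0\<rparr>"

definition monoid_ideal :: "('a, 'b) monoid_scheme \<Rightarrow> 'a set \<Rightarrow> bool" where
  "monoid_ideal M I \<longleftrightarrow>
    I \<subseteq> carrier M \<and>
    (\<forall>a\<in>carrier M. \<forall>b\<in>I. a \<otimes>\<^bsub>M\<^esub> b \<in> I \<and> b \<otimes>\<^bsub>M\<^esub> a \<in> I)"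

definition ideal_automorphisms :: "('a, 'b) monoid_scheme \<Rightarrow> 'a set \<Rightarrow> ('a \<Rightarrow> 'a) monoid" where
  "ideal_automorphisms M I = (AutoGroup M)\<lparr>carrier := {\<sigma> \<in> auto M. \<sigma> ` I = I}\<rparr>"


section \<open>The polynomial ring $R' = k'[X]$\<close>

definition poly_ring :: "'x set \<Rightarrow> ('x, 'k::field) mpol ring" where
  "poly_ring X =
    \<lparr>carrier = {f. Poly_Mapping.keys f \<subseteq> carrier (monomial_monoid X)},
     mult = (*), one = 1, zero = 0, add = (+)\<rparr>"

definition monomial :: "'x monom \<Rightarrow> ('x, 'k::field) mpol" where
  "monomial a = Poly_Mapping.single a 1"

definition const_poly :: "'k::field \<Rightarrow> ('x, 'k) mpol" where
  "const_poly c = Poly_Mapping.single 0 c"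

definition variable_ideal :: "'x set \<Rightarrow> ('x, 'k::field) mpol set" where
  "variable_ideal X =
    Idl\<^bsub>poly_ring X\<^esub> ((\<lambda>y. monomial (Poly_Mapping.single y 1)) ` X)"

definition monomial_degree :: "'x monom \<Rightarrow> nat" where
  "monomial_degree a = (\<Sum>y\<in>Poly_Mapping.keys a. Poly_Mapping.lookup a y)"

definition poly_grade :: "'x set \<Rightarrow> int \<Rightarrow> ('x, 'k::field) mpol set" where
  "poly_grade X k =
    {f \<in> carrier (poly_ring X). \<forall>a\<in>Poly_Mapping.keys f. int (monomial_degree a) = k}"

text \<open>
  The automorphism of \<open>R'\<close> induced by an automorphism \<open>\<sigma>\<close> of $M(X)$ and the action
  \<open>act \<sigma>\<close> on coefficients.
\<close>

definition poly_aut ::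
    "(('x monom \<Rightarrow> 'x monom) \<Rightarrow> 'k \<Rightarrow> 'k) \<Rightarrow> ('x monom \<Rightarrow> 'x monom) \<Rightarrow>
     ('x, 'k::field) mpol \<Rightarrow> ('x, 'k) mpol" where
  "poly_aut act \<sigma> f =
    (\<Sum>a\<in>Poly_Mapping.keys f.
      Poly_Mapping.single (\<sigma> a) (act \<sigma> (Poly_Mapping.lookup f a)))"


section \<open>The coefficient field\<close>

text \<open>
  In a field of characteristic $p > 0$ the set \<^term>\<open>\<int>\<close>, i.e. the image of
  the integers, is the prime field $F_p$.  The library's \<open>algebraic\<close> is formulated in the same
  way but is restricted to characteristic 0.
\<close>

definition algebraic_over_prime_field :: "'k::field \<Rightarrow> bool" where
  "algebraic_over_prime_field x \<longleftrightarrow>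
    (\<exists>q. q \<noteq> 0 \<and> (\<forall>i. Polynomial.coeff q i \<in> \<int>) \<and> Polynomial.poly q x = 0)"

definition field_automorphisms :: "('k::field \<Rightarrow> 'k) monoid" where
  "field_automorphisms =
    \<lparr>carrier = {f. bij f \<and> f 1 = 1 \<and> (\<forall>x y. f (x + y) = f x + f y) \<and>
                   (\<forall>x y. f (x * y) = f x * f y) \<and> (\<forall>c\<in>\<int>. f c = c)},
     mult = (\<circ>), one = id\<rparr>"


section \<open>Modules\<close>

text \<open>
  The record \<^typ>\<open>('r, 'm) module\<close> inherits fields \<open>mult\<close> and \<open>one\<close> that play no
  role for modules; they are left unspecified below.
\<close>

text \<open>The extension $IR'$ of a monomial ideal, as an \<open>R'\<close>-module.\<close>

definition monomial_ideal_module ::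
    "'x set \<Rightarrow> 'x monom set \<Rightarrow> (('x, 'k::field) mpol, ('x, 'k) mpol) module" where
  "monomial_ideal_module X I =
    \<lparr>carrier = Idl\<^bsub>poly_ring X\<^esub> (monomial ` I),
     mult = undefined, one = undefined, zero = 0, add = (+), smult = (*)\<rparr>"

definition monomial_ideal_grade ::
    "'x set \<Rightarrow> 'x monom set \<Rightarrow> int \<Rightarrow> ('x, 'k::field) mpol set" where
  "monomial_ideal_grade X I k = carrier (monomial_ideal_module X I) \<inter> poly_grade X k"

definition module_hom ::
    "('r, 'c) ring_scheme \<Rightarrow> ('r, 'm, 'd) module_scheme \<Rightarrow> ('r, 'n, 'e) module_scheme \<Rightarrow>
     ('m \<Rightarrow> 'n) set" where
  "module_hom R M N =
    {h \<in> hom (add_monoid M) (add_monoid N).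
      \<forall>r\<in>carrier R. \<forall>x\<in>carrier M. h (r \<odot>\<^bsub>M\<^esub> x) = r \<odot>\<^bsub>N\<^esub> h x}"

definition module_iso ::
    "('r, 'c) ring_scheme \<Rightarrow> ('r, 'm, 'd) module_scheme \<Rightarrow> ('r, 'n, 'e) module_scheme \<Rightarrow>
     ('m \<Rightarrow> 'n) set" where
  "module_iso R M N = {h \<in> module_hom R M N. bij_betw h (carrier M) (carrier N)}"

definition finite_free ::
    "('r, 'c) ring_scheme \<Rightarrow> ('r, 'm, 'd) module_scheme \<Rightarrow> bool" where
  "finite_free R M \<longleftrightarrow>
    (\<exists>B. finite B \<and> B \<subseteq> carrier M \<and>
      (\<forall>x\<in>carrier M. \<exists>!c. c \<in> B \<rightarrow>\<^sub>E carrier R \<and>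
        x = (\<Oplus>\<^bsub>M\<^esub>b\<in>B. c b \<odot>\<^bsub>M\<^esub> b)))"

text \<open>The submodule $J M$ of $M$, for an ideal $J$.\<close>

definition ideal_times_module :: "'r set \<Rightarrow> ('r, 'm, 'd) module_scheme \<Rightarrow> 'm set" where
  "ideal_times_module J M =
    generate (add_monoid M) {r \<odot>\<^bsub>M\<^esub> x |r x. r \<in> J \<and> x \<in> carrier M}"

definition quotient_module ::
    "('r, 'm, 'd) module_scheme \<Rightarrow> 'm set \<Rightarrow> ('r, 'm set) module" where
  "quotient_module M N =
    \<lparr>carrier = a_rcosets\<^bsub>M\<^esub> N, mult = undefined, one = undefined,
     zero = N, add = set_add M,
     smult = (\<lambda>r C. \<Union>x\<in>C. N +>\<^bsub>M\<^esub> (r \<odot>\<^bsub>M\<^esub> x))\<rparr>"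

text \<open>Restriction of scalars $\sigma_* M$ along a ring endomorphism \<open>\<sigma>\<close>.\<close>

definition twisted_module ::
    "('r \<Rightarrow> 'r) \<Rightarrow> ('r, 'm) module \<Rightarrow> ('r, 'm) module" where
  "twisted_module \<sigma> M = M\<lparr>smult := \<lambda>r x. \<sigma> r \<odot>\<^bsub>M\<^esub> x\<rparr>"

text \<open>
  $\bigoplus_{d} R'(-d)^{\beta_d}$: the coordinate \<open>(d, i)\<close> with \<open>i < \<beta> d\<close> belongs to the
  \<open>i\<close>-th copy of $R'(-d)$, whose piece of degree $k$ is $R'_{k-d}$.
\<close>

definition graded_free_module ::
    "'x set \<Rightarrow> (int \<Rightarrow> nat) \<Rightarrow> (('x, 'k::field) mpol, int \<times> nat \<Rightarrow> ('x, 'k) mpol) module" where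
  "graded_free_module X \<beta> =
    \<lparr>carrier = {f. (\<forall>j. f j \<in> carrier (poly_ring X)) \<and>
                   (\<forall>d i. \<beta> d \<le> i \<longrightarrow> f (d, i) = 0) \<and> finite {j. f j \<noteq> 0}},
     mult = undefined, one = undefined,
     zero = (\<lambda>j. 0), add = (\<lambda>f g j. f j + g j), smult = (\<lambda>r f j. r * f j)\<rparr>"

definition graded_free_grade ::
    "'x set \<Rightarrow> (int \<Rightarrow> nat) \<Rightarrow> int \<Rightarrow> (int \<times> nat \<Rightarrow> ('x, 'k::field) mpol) set" where
  "graded_free_grade X \<beta> k =
    {f \<in> carrier (graded_free_module X \<beta>). \<forall>d i. f (d, i) \<in> poly_grade X (k - d)}"

definition graded_module_hom ::
    "('r, 'c) ring_scheme \<Rightarrow>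
     ('r, 'm, 'd) module_scheme \<Rightarrow> (int \<Rightarrow> 'm set) \<Rightarrow>
     ('r, 'n, 'e) module_scheme \<Rightarrow> (int \<Rightarrow> 'n set) \<Rightarrow> ('m \<Rightarrow> 'n) set" where
  "graded_module_hom R M gM N gN =
    {h \<in> module_hom R M N. \<forall>k. h ` gM k \<subseteq> gN k}"


section \<open>Chain complexes\<close>

text \<open>
  Complexes are concentrated in nonnegative degrees; \<open>\<mu> n\<close> maps \<open>M n\<close> to \<open>M (n - 1)\<close> for
  \<open>n \<ge> 1\<close>, and \<open>\<mu> 0\<close> is irrelevant.
\<close>

definition chain_complex ::
    "('r, 'c) ring_scheme \<Rightarrow> (nat \<Rightarrow> ('r, 'm) module) \<Rightarrow> (nat \<Rightarrow> 'm \<Rightarrow> 'm) \<Rightarrow> bool" where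
  "chain_complex R M \<mu> \<longleftrightarrow>
    (\<forall>n. module R (M n)) \<and>
    (\<forall>n. \<mu> (Suc n) \<in> module_hom R (M (Suc n)) (M n)) \<and>
    (\<forall>n. \<forall>x\<in>carrier (M (Suc (Suc n))). \<mu> (Suc n) (\<mu> (Suc (Suc n)) x) = \<zero>\<^bsub>M n\<^esub>)"

definition cycles :: "(nat \<Rightarrow> ('r, 'm) module) \<Rightarrow> (nat \<Rightarrow> 'm \<Rightarrow> 'm) \<Rightarrow> nat \<Rightarrow> 'm set" where
  "cycles M \<mu> n =
    (if n = 0 then carrier (M 0) else a_kernel (M n) (M (n - 1)) (\<mu> n))"

definition boundaries :: "(nat \<Rightarrow> ('r, 'm) module) \<Rightarrow> (nat \<Rightarrow> 'm \<Rightarrow> 'm) \<Rightarrow> nat \<Rightarrow> 'm set" where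
  "boundaries M \<mu> n = \<mu> (Suc n) ` carrier (M (Suc n))"

definition homology ::
    "(nat \<Rightarrow> ('r, 'm) module) \<Rightarrow> (nat \<Rightarrow> 'm \<Rightarrow> 'm) \<Rightarrow> nat \<Rightarrow> ('r, 'm set) module" where
  "homology M \<mu> n =
    quotient_module ((M n)\<lparr>carrier := cycles M \<mu> n\<rparr>) (boundaries M \<mu> n)"

definition acyclic_in_positive_degrees ::
    "(nat \<Rightarrow> ('r, 'm) module) \<Rightarrow> (nat \<Rightarrow> 'm \<Rightarrow> 'm) \<Rightarrow> bool" where
  "acyclic_in_positive_degrees M \<mu> \<longleftrightarrow>
    (\<forall>i\<ge>1. carrier (homology M \<mu> i) = {\<zero>\<^bsub>homology M \<mu> i\<^esub>})"

definition chain_map ::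
    "('r, 'c) ring_scheme \<Rightarrow> (nat \<Rightarrow> ('r, 'm) module) \<Rightarrow> (nat \<Rightarrow> 'm \<Rightarrow> 'm) \<Rightarrow>
     (nat \<Rightarrow> ('r, 'n) module) \<Rightarrow> (nat \<Rightarrow> 'n \<Rightarrow> 'n) \<Rightarrow> (nat \<Rightarrow> 'm \<Rightarrow> 'n) \<Rightarrow> bool" where
  "chain_map R M \<mu> N \<nu> f \<longleftrightarrow>
    (\<forall>n. f n \<in> module_hom R (M n) (N n)) \<and>
    (\<forall>n. \<forall>x\<in>carrier (M (Suc n)). f n (\<mu> (Suc n) x) = \<nu> (Suc n) (f (Suc n) x))"

text \<open>The map induced on \<open>H\<^sub>n\<close> by an endomorphism of complexes: $[x] \mapsto [f_n(x)]$.\<close>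

definition homology_map ::
    "(nat \<Rightarrow> ('r, 'm) module) \<Rightarrow> (nat \<Rightarrow> 'm \<Rightarrow> 'm) \<Rightarrow> (nat \<Rightarrow> 'm \<Rightarrow> 'm) \<Rightarrow> nat \<Rightarrow>
     'm set \<Rightarrow> 'm set" where
  "homology_map M \<mu> f n C = (\<Union>x\<in>C. boundaries M \<mu> n +>\<^bsub>M n\<^esub> f n x)"

text \<open>
  The group of automorphisms of a complex of modules over $k'[X]$ as a complex of vector spaces over
  the prime field (embedded as constant polynomials).  Following \<^const>\<open>Bij\<close>, its elements are
  extensional, so that they are determined by their values on the modules.
\<close>

definition complex_automorphisms ::
    "(nat \<Rightarrow> (('x, 'k::field) mpol, 'm) module) \<Rightarrow> (nat \<Rightarrow> 'm \<Rightarrow> 'm) \<Rightarrow>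
     (nat \<Rightarrow> 'm \<Rightarrow> 'm) monoid" where
  "complex_automorphisms M \<mu> =
    \<lparr>carrier =
       {f. (\<forall>n. f n \<in> Bij (carrier (M n)) \<inter> hom (add_monoid (M n)) (add_monoid (M n))) \<and>
           (\<forall>n. \<forall>c\<in>\<int>. \<forall>x\<in>carrier (M n).
             f n (const_poly c \<odot>\<^bsub>M n\<^esub> x) = const_poly c \<odot>\<^bsub>M n\<^esub> f n x) \<and>
           (\<forall>n. \<forall>x\<in>carrier (M (Suc n)). f n (\<mu> (Suc n) x) = \<mu> (Suc n) (f (Suc n) x))},
     mult = (\<lambda>f g n. compose (carrier (M n)) (f n) (g n)),
     one = (\<lambda>n. \<lambda>x\<in>carrier (M n). x)\<rparr>"

text \<open>
  The grading on $H_0$ induced by transporting, along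
  \<open>\<theta>\<^sub>0\<close>, the grading of a graded free module to \<open>M 0\<close>.
\<close>

definition induced_H0_grade ::
    "'x set \<Rightarrow> (nat \<Rightarrow> (('x, 'k::field) mpol, 'm) module) \<Rightarrow> (nat \<Rightarrow> 'm \<Rightarrow> 'm) \<Rightarrow>
     (int \<Rightarrow> nat) \<Rightarrow> ('m \<Rightarrow> int \<times> nat \<Rightarrow> ('x, 'k) mpol) \<Rightarrow> int \<Rightarrow> 'm set set" where
  "induced_H0_grade X M \<mu> \<beta>\<^sub>0 \<theta>\<^sub>0 k =
    {boundaries M \<mu> 0 +>\<^bsub>M 0\<^esub> x |x.
      x \<in> carrier (M 0) \<and> \<theta>\<^sub>0 x \<in> graded_free_grade X \<beta>\<^sub>0 k}"


section \<open>The ideal $I(p)$\<close>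

datatype Xvar = V nat | E nat nat

definition cycle_length :: "nat \<Rightarrow> nat" where
  "cycle_length p = (if p = 2 then 4 else p)"

definition vars :: "nat \<Rightarrow> Xvar set" where
  "vars p = (let n = cycle_length p in
    {V i |i. i \<le> n} \<union> {E i (i + 1) |i. 1 \<le> i \<and> i < n} \<union> {E n 1})"

text \<open>
  Monomials are additive, so quotients of monomials are differences.  All the divisions are exact,
  so the truncation of subtraction of exponents is never effective.
\<close>

definition full_monomial :: "nat \<Rightarrow> Xvar monom" where
  "full_monomial p = (\<Sum>y\<in>vars p. Poly_Mapping.single y 1)"

definition ideal_generator :: "nat \<Rightarrow> nat \<Rightarrow> Xvar monom" where
  "ideal_generator p i = (let n = cycle_length p; m = full_monomial p;
      x = (\<lambda>y. Poly_Mapping.single y (1::nat)) in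
    if i = 0 then m - x (V 0)
    else if i = 1 then (x (V 0) + m) - (x (E n 1) + x (V 1) + x (E 1 2))
    else if i = n then (x (V 0) + m) - (x (E (n - 1) n) + x (V n) + x (E n 1))
    else (x (V 0) + m) - (x (E (i - 1) i) + x (V i) + x (E i (i + 1))))"

definition ideal_of_prime :: "nat \<Rightarrow> Xvar monom set" where
  "ideal_of_prime p =
    monoid_ideal (monomial_monoid (vars p)) hull (ideal_generator p ` {0..cycle_length p})"

end

theory Submission
  imports Defs "HOL-Library.Function_Algebras" "HOL-Algebra.Multiplicative_Group"
begin

text \<open>
  The monomials $m_1, \dots, m_n$ sit at the vertices of an $n$-cycle and $m_0$ at an isolated hub.  The
  first syzygies of \<open>I\<close> are generated by the edges \<open>f\<^sub>i\<close> of the cycle and one syzygy \<open>g\<close> joining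
  the hub to some vertex; the only second syzygy is the full cycle $z = \sum_i e_{i+1} f_i$.  Let \<open>\<tau>\<close>
  be the rotation of the cycle by two steps.  It is a commutator in $G_I$, whereas automorphisms of an
  algebraic extension of $F_p$ commute; so \<open>\<tau>\<close> acts trivially on the coefficients.  It shifts the
  \<open>f\<^sub>i\<close> by two modulo $\mathfrak m M_1$, and modulo $\mathfrak m^2 M_1$ it satisfies
  $\tau g = g + e_1 f_0 + e_2 f_1 + c z$ with a constant \<open>c\<close>.  Iterating \<open>p\<close> times yields
  $g = \tau^p g = g + (2p/n) z + p c z$.  As $p = 0$ and $2p/n \in \{1, 2\}$ is invertible in $k'$, \<open>z\<close>
  lies in $\mathfrak m^2 M_1$, although the \<open>f\<^sub>i\<close> do not lie in $\mathfrak m M_1$.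
\<close>

section \<open>Polynomials\<close>

text \<open>Averaging over the rotation has to fail: were \<open>p\<close> invertible,
  \<open>c = -2/n\<close> would balance the equation for \<open>\<tau>^p g\<close>. Hence a cycle on
  which the rotation by two has order \<open>p\<close>, while the number \<open>2p/n\<close> of full
  turns is prime to \<open>p\<close>. Length \<open>p\<close> achieves this for odd
  \<open>p\<close>; for \<open>p = 2\<close> a cycle of length 2 would have two vertices with the
  same pair of edges, so length 4 takes its place. Rotating by two steps gives the commutator of the
  one-step rotation and a reflection. A nontrivial action of it on coefficients would replace
  \<open>p c\<close> by a sum of conjugates of \<open>c\<close>, a trace, which could cancel
  \<open>2p/n\<close>. The terms \<open>e_1 f_0 + e_2 f_1\<close> arise because \<open>g\<close> is
  anchored at one vertex and \<open>\<tau>\<close> moves the anchor along two edges;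
  \<open>c\<close> is out of control because only the boundary of \<open>\<tau> g\<close> is known.
  No basis of \<open>M_1\<close> adapted to the syzygies is given, so the \<open>f_i\<close> and
  \<open>g\<close> are arbitrary lifts, and comparison maps with the explicit resolution are used to
  compute the kernel of \<open>M_1 -> M_0\<close> modulo \<open>m^2 M_1\<close>.\<close>

lemma poly_mapping_sum_single:
  fixes f :: "'a \<Rightarrow>\<^sub>0 'b::comm_monoid_add"
  shows "f = (\<Sum>a\<in>Poly_Mapping.keys f. Poly_Mapping.single a (Poly_Mapping.lookup f a))"
  by (rule poly_mapping_eqI) (auto simp: lookup_sum lookup_single when_def in_keys_iff)

lemma lookup_single_times:
  fixes a t :: "'x monom" and f :: "('x, 'k::field) mpol"
  shows "Poly_Mapping.lookup (Poly_Mapping.single a c * f) t =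
    (if \<exists>b. t = a + b then c * Poly_Mapping.lookup f (t - a) else 0)"
proof -
  have "Poly_Mapping.single a c * f =
      (\<Sum>b\<in>Poly_Mapping.keys f. Poly_Mapping.single (a + b) (c * Poly_Mapping.lookup f b))"
    by (subst poly_mapping_sum_single[of f]) (simp add: sum_distrib_left mult_single)
  then have *: "Poly_Mapping.lookup (Poly_Mapping.single a c * f) t =
      (\<Sum>b\<in>Poly_Mapping.keys f. if a + b = t then c * Poly_Mapping.lookup f b else 0)"
    by (simp add: lookup_sum lookup_single when_def)
  show ?thesis
  proof (cases "\<exists>b. t = a + b")
    case True
    then obtain d where d: "t = a + d" by blast
    have "(\<Sum>b\<in>Poly_Mapping.keys f. if a + b = t then c * Poly_Mapping.lookup f b else 0) =
        (\<Sum>b\<in>Poly_Mapping.keys f. if d = b then c * Poly_Mapping.lookup f b else 0)"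
      by (rule sum.cong) (auto simp: d)
    then show ?thesis using * True d
      by (simp add: in_keys_iff)
  next
    case False
    then show ?thesis using * by (auto intro!: sum.neutral)
  qed
qed

section \<open>Cancellation of monomials, and substitution of zero for variables\<close>

definition indet :: "'x \<Rightarrow> ('x, 'k::field) mpol" where
  "indet y = monomial (Poly_Mapping.single y 1)"

lemma monomial_add: "(monomial (a + b) :: ('x, 'k::field) mpol) = monomial a * monomial b"
  by (simp add: monomial_def mult_single)

lemma lookup_monomial_times_add [simp]:
  fixes f :: "('x, 'k::field) mpol"
  shows "Poly_Mapping.lookup (monomial a * f) (a + b) = Poly_Mapping.lookup f b"
  by (auto simp: monomial_def lookup_single_times)

text \<open>Multiplication by a monomial merely shifts coefficients, so it can be cancelled by
  comparing them.\<close>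

lemma monomial_times_cancel [simp]:
  fixes f g :: "('x, 'k::field) mpol"
  shows "monomial a * f = monomial a * g \<longleftrightarrow> f = g"
  by (metis lookup_monomial_times_add poly_mapping_eqI)

lemma monomial_times_eq_0 [simp]:
  fixes f :: "('x, 'k::field) mpol"
  shows "monomial a * f = 0 \<longleftrightarrow> f = 0"
  using monomial_times_cancel[of a f 0] by simp

lemma indet_times_cancel [simp]:
  fixes f g :: "('x, 'k::field) mpol"
  shows "indet y * f = indet y * g \<longleftrightarrow> f = g" "indet y * f = 0 \<longleftrightarrow> f = 0"
  by (simp_all add: indet_def)

text \<open>The ring endomorphism that sets the variables in \<open>K\<close> to zero. Applied to a
  relation it isolates the terms free of \<open>K\<close>; for \<open>K = - X\<close> it is the
  retraction onto the polynomials in \<open>X\<close>.\<close>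

definition kill :: "'x set \<Rightarrow> ('x, 'k::field) mpol \<Rightarrow> ('x, 'k) mpol" where
  "kill K f = (\<Sum>a\<in>{a \<in> Poly_Mapping.keys f. Poly_Mapping.keys a \<inter> K = {}}.
     Poly_Mapping.single a (Poly_Mapping.lookup f a))"

lemma lookup_kill:
  "Poly_Mapping.lookup (kill K f) a =
    (if Poly_Mapping.keys a \<inter> K = {} then Poly_Mapping.lookup f a else 0)"
  by (auto simp: kill_def lookup_sum lookup_single when_def in_keys_iff)

lemma kill_add: "kill K (f + g) = kill K f + kill K g"
  by (rule poly_mapping_eqI) (simp add: lookup_kill lookup_add)

lemma kill_diff: "kill K (f - g) = kill K f - kill K g"
  by (rule poly_mapping_eqI) (simp add: lookup_kill lookup_minus)

lemma kill_zero [simp]: "kill K 0 = 0"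
  by (rule poly_mapping_eqI) (simp add: lookup_kill)

lemma kill_sum: "kill K (\<Sum>i\<in>A. f i) = (\<Sum>i\<in>A. kill K (f i))"
  by (rule poly_mapping_eqI) (simp add: lookup_kill lookup_sum)

lemma kill_single:
  "kill K (Poly_Mapping.single a c) =
    (if Poly_Mapping.keys a \<inter> K = {} then Poly_Mapping.single a c else 0)"
  by (rule poly_mapping_eqI) (auto simp: lookup_kill lookup_single when_def)

lemma keys_add_nat: "Poly_Mapping.keys (a + b :: 'x monom) = Poly_Mapping.keys a \<union> Poly_Mapping.keys b"
  by (auto simp: in_keys_iff lookup_add)

lemma kill_mult: "kill K (f * g) = kill K f * kill K (g :: ('x, 'k::field) mpol)"
proof -
  have 1: "kill K (Poly_Mapping.single a c * g) = kill K (Poly_Mapping.single a c) * kill K g"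
    for a and c :: 'k
  proof -
    have "Poly_Mapping.single a c * g =
      (\<Sum>b\<in>Poly_Mapping.keys g. Poly_Mapping.single (a + b) (c * Poly_Mapping.lookup g b))"
      by (subst poly_mapping_sum_single[of g]) (simp add: sum_distrib_left mult_single)
    then have "kill K (Poly_Mapping.single a c * g) =
      (\<Sum>b\<in>Poly_Mapping.keys g. kill K (Poly_Mapping.single (a + b) (c * Poly_Mapping.lookup g b)))"
      by (simp add: kill_sum)
    also have "\<dots> = (\<Sum>b\<in>Poly_Mapping.keys g. kill K (Poly_Mapping.single a c) *
        kill K (Poly_Mapping.single b (Poly_Mapping.lookup g b)))"
      by (rule sum.cong) (auto simp: kill_single keys_add_nat mult_single)
    also have "\<dots> = kill K (Poly_Mapping.single a c) * kill K g"
      by (simp only: sum_distrib_left[symmetric] kill_sum[symmetric] poly_mapping_sum_single[symmetric])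
    finally show ?thesis .
  qed
  have "f * g = (\<Sum>a\<in>Poly_Mapping.keys f. Poly_Mapping.single a (Poly_Mapping.lookup f a) * g)"
    by (subst poly_mapping_sum_single[of f]) (simp add: sum_distrib_right)
  then have "kill K (f * g) = (\<Sum>a\<in>Poly_Mapping.keys f. kill K (Poly_Mapping.single a (Poly_Mapping.lookup f a)) * kill K g)"
    by (simp add: kill_sum 1)
  also have "\<dots> = kill K f * kill K g"
    by (simp only: sum_distrib_right[symmetric] kill_sum[symmetric] poly_mapping_sum_single[symmetric])
  finally show ?thesis .
qed

lemma kill_monomial:
  "kill K (monomial a) = (if Poly_Mapping.keys a \<inter> K = {} then monomial a else 0)"
  by (simp add: monomial_def kill_single)

lemma kill_kill: "kill K (kill L f) = kill (K \<union> L) f"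
  by (rule poly_mapping_eqI) (auto simp: lookup_kill)

lemma kill_decomp: "\<exists>q. f = kill {y} f + indet y * q"
proof -
  let ?s = "Poly_Mapping.single y (1::nat)"
  \<comment> \<open>The quotient of the terms divisible by \<open>y\<close>: its coefficient at
    \<open>b\<close> is that of \<open>f\<close> at \<open>b\<close> times \<open>y\<close>.\<close>
  define q where "q = Poly_Mapping.map_key (\<lambda>b. ?s + b) f"
  have inj: "inj (\<lambda>b. ?s + b)" by (auto simp: inj_def)
  have q: "Poly_Mapping.lookup q b = Poly_Mapping.lookup f (?s + b)" for b
    unfolding q_def using inj by (simp add: map_key.rep_eq)
  have "Poly_Mapping.lookup f t = Poly_Mapping.lookup (kill {y} f + indet y * q) t" for t
  proof (cases "Poly_Mapping.lookup t y = 0")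
    case True
    then have "\<not> (\<exists>b. t = ?s + b)" by (auto simp: lookup_add)
    with True show ?thesis
      by (simp add: lookup_add lookup_kill indet_def monomial_def lookup_single_times in_keys_iff)
  next
    case False
    have "t = ?s + (t - ?s)"
      by (rule poly_mapping_eqI) (use False in \<open>auto simp: lookup_add lookup_minus lookup_single when_def\<close>)
    then obtain b where b: "t = ?s + b" by blast
    have "y \<in> Poly_Mapping.keys t" using False by (simp add: in_keys_iff)
    then show ?thesis
      by (auto simp: lookup_add lookup_kill indet_def b q lookup_single)
  qed
  then show ?thesis by (metis poly_mapping_eqI)
qed

lemma kill_eq_0D: "kill {y} f = 0 \<Longrightarrow> \<exists>q. f = indet y * q"
  using kill_decomp[of f y] by auto

text \<open>Divide by \<open>z\<close> first; the remainder is still zero at \<open>y = 0\<close>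
  and is therefore a multiple of \<open>y\<close>.\<close>

lemma kill_eq_0D2: "kill {y, z} f = 0 \<Longrightarrow> \<exists>q r. f = q * indet y + r * indet z"
proof -
  assume "kill {y, z} f = 0"
  then have "kill {y} (kill {z} f) = 0" by (simp only: kill_kill insert_is_Un[of y "{z}"])
  from kill_eq_0D[OF this] obtain q where q: "kill {z} f = indet y * q" ..
  from kill_decomp[of f z] obtain r where r: "f = kill {z} f + indet z * r" ..
  have "f = q * indet y + r * indet z" by (subst r, subst q) (simp add: mult.commute)
  then show ?thesis by blast
qed

lemma kill_indet: "kill K (indet y) = (if y \<in> K then 0 else indet y)"
  by (simp add: indet_def kill_monomial)

section \<open>The filtration of the polynomial ring by order\<close>

lemma monomial_degree_add: "monomial_degree (a + b) = monomial_degree a + monomial_degree b"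
proof -
  let ?K = "Poly_Mapping.keys a \<union> Poly_Mapping.keys b"
  have *: "monomial_degree c = (\<Sum>y\<in>?K. Poly_Mapping.lookup c y)"
    if "Poly_Mapping.keys c \<subseteq> ?K" for c
    unfolding monomial_degree_def
    by (rule sum.mono_neutral_left) (use that in \<open>auto simp: in_keys_iff\<close>)
  show ?thesis
    using *[of a] *[of b] *[of "a + b"] by (simp add: lookup_add sum.distrib keys_add_nat)
qed

lemma monomial_degree_single [simp]: "monomial_degree (Poly_Mapping.single y k) = k"
  by (simp add: monomial_degree_def)

lemma monomial_degree_eq_0_iff: "monomial_degree a = 0 \<longleftrightarrow> a = 0"
  by (auto simp: monomial_degree_def in_keys_iff intro: poly_mapping_eqI)

text \<open>The \<open>k\<close>-th power of the ideal generated by all variables, described by the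
  absence of terms of smaller degree.\<close>

definition deg_ge :: "nat \<Rightarrow> ('x, 'k::field) mpol set" where
  "deg_ge k = {f. \<forall>a\<in>Poly_Mapping.keys f. k \<le> monomial_degree a}"

lemma deg_ge_0 [simp]: "f \<in> deg_ge 0"
  by (simp add: deg_ge_def)

lemma deg_ge_mono: "f \<in> deg_ge k \<Longrightarrow> l \<le> k \<Longrightarrow> f \<in> deg_ge l"
  by (auto simp: deg_ge_def)

lemma zero_deg_ge [simp]: "0 \<in> deg_ge k"
  by (simp add: deg_ge_def)

lemma deg_ge_add: "f \<in> deg_ge k \<Longrightarrow> g \<in> deg_ge k \<Longrightarrow> f + g \<in> deg_ge k"
  using keys_add[of f g] by (auto simp: deg_ge_def)

lemma deg_ge_uminus [simp]: "- f \<in> deg_ge k \<longleftrightarrow> f \<in> deg_ge k"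
  by (auto simp: deg_ge_def in_keys_iff)

lemma deg_ge_diff: "f \<in> deg_ge k \<Longrightarrow> g \<in> deg_ge k \<Longrightarrow> f - g \<in> deg_ge k"
  using deg_ge_add[of f k "- g"] by simp

lemma deg_ge_sum: "(\<And>i. i \<in> A \<Longrightarrow> f i \<in> deg_ge k) \<Longrightarrow> (\<Sum>i\<in>A. f i) \<in> deg_ge k"
  by (induction A rule: infinite_finite_induct) (simp_all add: deg_ge_add)

lemma deg_ge_mult: "f \<in> deg_ge k \<Longrightarrow> g \<in> deg_ge l \<Longrightarrow> f * g \<in> deg_ge (k + l)"
  using keys_mult[of f g] by (fastforce simp: deg_ge_def monomial_degree_add)

lemma deg_ge_mult_left: "g \<in> deg_ge l \<Longrightarrow> f * g \<in> deg_ge l"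
  using deg_ge_mult[of f 0 g l] by simp

lemma deg_ge_mult_right: "f \<in> deg_ge k \<Longrightarrow> f * g \<in> deg_ge k"
  using deg_ge_mult[of f k g 0] by simp

lemma indet_deg_ge [simp]: "indet y \<in> deg_ge 1" "indet y \<in> deg_ge (Suc 0)"
  by (simp_all add: deg_ge_def indet_def monomial_def)

lemma deg_ge_decomp: "f - const_poly (Poly_Mapping.lookup f 0) \<in> deg_ge 1"
proof -
  have "monomial_degree a \<noteq> 0" if "a \<in> Poly_Mapping.keys (f - const_poly (Poly_Mapping.lookup f 0))" for a
    using that by (auto simp: monomial_degree_eq_0_iff const_poly_def in_keys_iff lookup_minus)
  then show ?thesis by (auto simp: deg_ge_def Suc_le_eq)
qed

lemma deg_ge_lookup: "f \<in> deg_ge k \<Longrightarrow> monomial_degree a < k \<Longrightarrow> Poly_Mapping.lookup f a = 0"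
  by (auto simp: deg_ge_def in_keys_iff not_le[symmetric])

text \<open>Used at the very end: in a combination of edge variables, the linear coefficient at one
  of them recovers the constant terms of its factors.\<close>

lemma lookup_indet_times_single:
  "Poly_Mapping.lookup (indet x * f) (Poly_Mapping.single y 1) = (if x = y then Poly_Mapping.lookup f 0 else 0)"
proof -
  have "\<not> (\<exists>b. Poly_Mapping.single y (1::nat) = Poly_Mapping.single x 1 + b)" if "x \<noteq> y"
  proof
    assume "\<exists>b. Poly_Mapping.single y (1::nat) = Poly_Mapping.single x 1 + b"
    then obtain b where "Poly_Mapping.single y (1::nat) = Poly_Mapping.single x 1 + b" by blast
    then have "Poly_Mapping.lookup (Poly_Mapping.single y (1::nat)) x =
       Poly_Mapping.lookup (Poly_Mapping.single x 1 + b) x" by simp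
    then show False using that by (simp add: lookup_add lookup_single when_def)
  qed
  moreover have "Poly_Mapping.lookup (indet y * f) (Poly_Mapping.single y 1) = Poly_Mapping.lookup f 0"
    using lookup_monomial_times_add[of "Poly_Mapping.single y 1" f 0] by (simp add: indet_def)
  ultimately show ?thesis by (auto simp: indet_def monomial_def lookup_single_times)
qed

text \<open>Elements of the type may involve variables outside \<open>X\<close>. Membership in the
  subring becomes a fixed-point condition for a ring endomorphism, from which all closure properties
  follow.\<close>

lemma carrier_poly_ring_iff: "f \<in> carrier (poly_ring X) \<longleftrightarrow> kill (- X) f = f"
proof
  assume "f \<in> carrier (poly_ring X)"
  then have *: "Poly_Mapping.keys a \<subseteq> X" if "a \<in> Poly_Mapping.keys f" for a
    using that by (auto simp: poly_ring_def monomial_monoid_def)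
  show "kill (- X) f = f"
  proof (rule poly_mapping_eqI)
    fix a
    show "Poly_Mapping.lookup (kill (- X) f) a = Poly_Mapping.lookup f a"
    proof (cases "a \<in> Poly_Mapping.keys f")
      case True
      with *[of a] have "Poly_Mapping.keys a \<inter> - X = {}" by blast
      then show ?thesis by (simp add: lookup_kill)
    qed (simp add: lookup_kill in_keys_iff)
  qed
next
  assume a: "kill (- X) f = f"
  have "Poly_Mapping.keys a \<subseteq> X" if "a \<in> Poly_Mapping.keys f" for a
    using that by (subst (asm) a[symmetric]) (auto simp: in_keys_iff lookup_kill split: if_splits)
  then show "f \<in> carrier (poly_ring X)" by (auto simp: poly_ring_def monomial_monoid_def)
qed

abbreviation polys :: "'x set \<Rightarrow> ('x, 'k::field) mpol set" where
  "polys X \<equiv> carrier (poly_ring X)"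

lemma kill_one [simp]: "kill K 1 = 1"
  using kill_single[of K 0 1] by simp

lemma kill_const_poly [simp]: "kill K (const_poly c) = const_poly c"
  by (simp add: const_poly_def kill_single)

lemma polys_closed [simp]:
  "0 \<in> polys X" "1 \<in> polys X" "const_poly c \<in> polys X"
  "f \<in> polys X \<Longrightarrow> g \<in> polys X \<Longrightarrow> f + g \<in> polys X"
  "f \<in> polys X \<Longrightarrow> g \<in> polys X \<Longrightarrow> f - g \<in> polys X"
  "f \<in> polys X \<Longrightarrow> g \<in> polys X \<Longrightarrow> f * g \<in> polys X"
  "f \<in> polys X \<Longrightarrow> - f \<in> polys X"
  using kill_diff[of "- X" 0 f]
  by (auto simp: carrier_poly_ring_iff kill_add kill_diff kill_mult)

lemma polys_sum: "(\<And>i. i \<in> A \<Longrightarrow> f i \<in> polys X) \<Longrightarrow> (\<Sum>i\<in>A. f i) \<in> polys X"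
  by (induction A rule: infinite_finite_induct) auto

lemma monomial_polys: "monomial a \<in> polys X \<longleftrightarrow> Poly_Mapping.keys a \<subseteq> X"
  by (simp add: poly_ring_def monomial_monoid_def monomial_def)

lemma indet_polys [simp]: "indet y \<in> polys X \<longleftrightarrow> y \<in> X"
  by (simp add: indet_def monomial_polys)

lemma cring_poly_ring: "cring (poly_ring X :: ('x, 'k::field) mpol ring)"
proof -
  have s: "add (poly_ring X :: ('x, 'k) mpol ring) = (+)" "mult (poly_ring X :: ('x, 'k) mpol ring) = (*)"
    "zero (poly_ring X :: ('x, 'k) mpol ring) = 0" "one (poly_ring X :: ('x, 'k) mpol ring) = 1"
    by (simp_all add: poly_ring_def)
  show ?thesis
  proof (rule cringI)
    show "abelian_group (poly_ring X :: ('x, 'k) mpol ring)"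
    proof (rule abelian_groupI)
      fix f :: "('x, 'k) mpol" assume "f \<in> polys X"
      then show "\<exists>g\<in>polys X. g \<oplus>\<^bsub>poly_ring X\<^esub> f = \<zero>\<^bsub>poly_ring X\<^esub>"
        by (intro bexI[of _ "- f"]) (auto simp: s)
    qed (auto simp: s algebra_simps)
    show "Group.comm_monoid (poly_ring X :: ('x, 'k) mpol ring)"
      by (rule comm_monoidI) (auto simp: s algebra_simps)
  qed (auto simp: s algebra_simps)
qed

section \<open>The generators of the ideal and their syzygies\<close>

lemma periodic_mod:
  fixes f :: "nat \<Rightarrow> 'a"
  assumes "\<And>i. f (i + n) = f i"
  shows "f (i mod n) = f i"
proof -
  have "f (j + k * n) = f j" for j k
  proof (induction k)
    case (Suc k)
    then show ?case using assms[of "j + k * n"] by (simp add: ac_simps)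
  qed simp
  from this[of "i mod n" "i div n"] show ?thesis by simp
qed

lemma sum_periodic_Suc:
  fixes f :: "nat \<Rightarrow> 'a::ab_group_add"
  assumes "\<And>i. f (i + n) = f i"
  shows "(\<Sum>i<n. f (i + 1)) = (\<Sum>i<n. f i)"
proof -
  have "(\<Sum>i<n. f (Suc i)) + f 0 = (\<Sum>i<n. f i) + f n"
    using sum.lessThan_Suc_shift[of f n] by (simp add: add.commute)
  then show ?thesis using assms[of 0] by simp
qed

text \<open>
  Vertices and edges of the cycle are indexed by the natural numbers modulo \<open>n\<close>, so that
  \<open>vtx i\<close> is $v_{i+1}$ and \<open>edg i\<close> joins \<open>vtx (i - 1)\<close> to \<open>vtx i\<close>.
\<close>

locale prime_ideal_data =
  fixes p :: nat
  assumes prime_p: "prime p"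
begin

definition n :: nat where "n = cycle_length p"

definition vtx :: "nat \<Rightarrow> Xvar" where "vtx i = V (i mod n + 1)"

definition edg :: "nat \<Rightarrow> Xvar" where
  "edg i = (if i mod n = 0 then E n 1 else E (i mod n) (i mod n + 1))"

abbreviation hub :: Xvar where "hub \<equiv> V 0"

abbreviation gen0 :: "Xvar monom" where "gen0 \<equiv> ideal_generator p 0"

definition gen :: "nat \<Rightarrow> Xvar monom" where "gen i = ideal_generator p (i mod n + 1)"

text \<open>A vertex with its two edges: the variables by which \<open>gen i\<close> falls short of
  \<open>top_monom\<close>.\<close>

definition star :: "nat \<Rightarrow> Xvar monom" where
  "star i = Poly_Mapping.single (edg i) 1 + Poly_Mapping.single (vtx i) 1 +
     Poly_Mapping.single (edg (i + 1)) 1"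

lemma n_ge_3: "n \<ge> 3"
  using prime_ge_2_nat[OF prime_p] by (auto simp: n_def cycle_length_def)

lemma n_pos [simp]: "0 < n"
  using n_ge_3 by simp

lemma vtx_eq_iff [simp]: "vtx i = vtx j \<longleftrightarrow> i mod n = j mod n"
  by (simp add: vtx_def)

lemma edg_eq_iff [simp]: "edg i = edg j \<longleftrightarrow> i mod n = j mod n"
  using n_ge_3 by (auto simp: edg_def)

lemma vtx_neq [simp]: "vtx i \<noteq> edg j" "edg j \<noteq> vtx i" "vtx i \<noteq> hub" "hub \<noteq> vtx i" "edg i \<noteq> hub" "hub \<noteq> edg i"
  by (auto simp: vtx_def edg_def)

lemma edg_Suc_neq: "edg (i + 1) \<noteq> edg i"
  using n_ge_3 by (auto simp: mod_Suc split: if_splits)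

lemma periodic [simp]: "vtx (i + n) = vtx i" "edg (i + n) = edg i" "gen (i + n) = gen i" "star (i + n) = star i"
  by (simp_all add: vtx_def edg_def gen_def star_def mod_Suc)

lemma vars_eq: "vars p = insert hub (range vtx \<union> range edg)"
proof -
  have "V j \<in> vars p \<longleftrightarrow> j = 0 \<or> V j \<in> range vtx" for j
  proof -
    have "V j \<in> range vtx" if "1 \<le> j" "j \<le> n"
      by (rule range_eqI[of _ _ "j - 1"]) (use that in \<open>simp add: vtx_def\<close>)
    moreover have "i mod n + 1 \<le> n" for i
      using mod_less_divisor[OF n_pos, of i] by linarith
    ultimately show ?thesis
      by (cases "j = 0") (auto simp: vars_def Let_def n_def[symmetric] vtx_def)
  qed
  moreover have "E j k \<in> vars p \<longleftrightarrow> E j k \<in> range edg" for j k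
  proof -
    have "E j (j + 1) \<in> range edg" if "1 \<le> j" "j < n" for j
      by (rule range_eqI[of _ _ j]) (use that in \<open>simp add: edg_def\<close>)
    moreover have "E n 1 \<in> range edg"
      by (rule range_eqI[of _ _ 0]) (simp add: edg_def)
    moreover have "edg i = E j k \<Longrightarrow> (1 \<le> j \<and> j < n \<and> k = j + 1) \<or> (j = n \<and> k = 1)" for i
      using mod_less_divisor[OF n_pos, of i] by (auto simp: edg_def split: if_splits)
    ultimately show ?thesis
      by (auto simp: vars_def Let_def n_def[symmetric])
  qed
  moreover have "V j \<notin> range edg" "E j k \<notin> range vtx" for j k
    by (auto simp: vtx_def edg_def)
  ultimately have "y \<in> vars p \<longleftrightarrow> y \<in> insert hub (range vtx \<union> range edg)" for y
    by (cases y) auto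
  then show ?thesis by blast
qed

lemma vars_mem [simp]: "vtx i \<in> vars p" "edg i \<in> vars p" "hub \<in> vars p"
  by (simp_all add: vars_eq)

lemma finite_vars: "finite (vars p)"
proof -
  have "vtx i = vtx (i mod n)" "edg i = edg (i mod n)" for i by simp_all
  then have "range vtx \<subseteq> vtx ` {..<n}" "range edg \<subseteq> edg ` {..<n}"
    using mod_less_divisor[OF n_pos] by blast+
  then have "finite (range vtx)" "finite (range edg)"
    by (meson finite_imageI finite_lessThan finite_subset)+
  then show ?thesis by (simp add: vars_eq)
qed

lemma lookup_full: "Poly_Mapping.lookup (full_monomial p) y = (if y \<in> vars p then 1 else 0)"
  using finite_vars by (simp add: full_monomial_def lookup_sum lookup_single when_def)

lemma lookup_star: "Poly_Mapping.lookup (star i) y = (if y = edg i \<or> y = vtx i \<or> y = edg (i + 1) then 1 else 0)"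
  using edg_Suc_neq[of i] by (auto simp: star_def lookup_add lookup_single when_def)

text \<open>Indexing modulo \<open>n\<close> merges the separate cases of the definition for the
  first, last and middle vertices.\<close>

lemma gen_eq: "gen i = (Poly_Mapping.single hub 1 + full_monomial p) - star i"
proof -
  have "i mod n < n" "Suc (i mod n) = n \<Longrightarrow> n - Suc 0 = i mod n" by auto
  then show ?thesis
    unfolding gen_def ideal_generator_def Let_def n_def[symmetric] star_def vtx_def edg_def
    using n_ge_3 by (auto simp: mod_Suc add_ac numeral_2_eq_2)
qed

lemma lookup_gen: "Poly_Mapping.lookup (gen i) y =
   (if y = hub then 2 else if y \<in> vars p \<and> y \<noteq> edg i \<and> y \<noteq> vtx i \<and> y \<noteq> edg (i + 1) then 1 else 0)"
  by (auto simp: gen_eq lookup_minus lookup_add lookup_full lookup_star lookup_single when_def vars_eq)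

lemma lookup_gen0: "Poly_Mapping.lookup gen0 y = (if y \<in> vars p \<and> y \<noteq> hub then 1 else 0)"
  by (auto simp: ideal_generator_def Let_def lookup_minus lookup_full lookup_single when_def)

text \<open>The least common multiple of \<open>gen0\<close> with any \<open>gen i\<close>, hence
  the multidegree of the syzygy that joins the hub to the cycle.\<close>

definition top_monom :: "Xvar monom" where
  "top_monom = Poly_Mapping.single hub 1 + full_monomial p"

lemma gen_star: "gen i + star i = top_monom"
  by (rule poly_mapping_eqI)
    (auto simp: top_monom_def lookup_add lookup_gen lookup_star lookup_full lookup_single when_def vars_eq)

lemma gen0_hub: "gen0 + Poly_Mapping.single hub 2 = top_monom"
  by (rule poly_mapping_eqI)
    (auto simp: top_monom_def lookup_add lookup_gen0 lookup_full lookup_single when_def vars_eq)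

abbreviation (input) v :: "nat \<Rightarrow> (Xvar, 'k::field) mpol" where "v i \<equiv> indet (vtx i)"
abbreviation (input) e :: "nat \<Rightarrow> (Xvar, 'k::field) mpol" where "e i \<equiv> indet (edg i)"
abbreviation (input) h :: "(Xvar, 'k::field) mpol" where "h \<equiv> indet hub"
abbreviation (input) m0 :: "(Xvar, 'k::field) mpol" where "m0 \<equiv> monomial gen0"
abbreviation (input) m :: "nat \<Rightarrow> (Xvar, 'k::field) mpol" where "m i \<equiv> monomial (gen i)"
abbreviation (input) w :: "(Xvar, 'k::field) mpol" where "w \<equiv> monomial top_monom"

lemma m_star: "m i * (e i * v i * e (i + 1)) = w"
  unfolding gen_star[of i, symmetric] by (simp add: star_def indet_def monomial_add mult.assoc)

lemma m0_hub: "m0 * (h * h) = w"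
  unfolding gen0_hub[symmetric]
  by (simp add: indet_def monomial_add[symmetric] single_add[symmetric] numeral_2_eq_2)

lemma kill_hub_gens: "kill {hub} m0 = m0" "kill {hub} (m i) = 0"
  by (auto simp: kill_monomial in_keys_iff lookup_gen0 lookup_gen)

text \<open>The least common multiple of the generators at the two ends of \<open>edg i\<close>:
  both stars contain this edge and nothing else in common.\<close>

definition cofactor :: "nat \<Rightarrow> Xvar monom" where
  "cofactor i = top_monom - Poly_Mapping.single (edg i) 1"

lemma lookup_cofactor: "Poly_Mapping.lookup (cofactor i) y =
   (if y = hub then 2 else if y \<in> vars p \<and> y \<noteq> edg i then 1 else 0)"
  by (auto simp: cofactor_def top_monom_def lookup_minus lookup_add lookup_full lookup_single when_def vars_eq)

lemma cofactor_edg: "monomial (cofactor i) * e i = w"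
proof -
  have "cofactor i + Poly_Mapping.single (edg i) 1 = top_monom"
    by (rule poly_mapping_eqI)
      (auto simp: top_monom_def lookup_add lookup_cofactor lookup_full lookup_single when_def vars_eq)
  then show ?thesis by (simp add: indet_def monomial_add[symmetric])
qed

lemma m_cofactor:
  "m i * v i * e i = monomial (cofactor (i + 1))" "m i * v i * e (i + 1) = monomial (cofactor i)"
proof -
  have "m i * (e i * v i * e (i + 1)) = monomial (cofactor (i + 1)) * e (i + 1)"
    "m i * (e i * v i * e (i + 1)) = monomial (cofactor i) * e i"
    by (simp_all only: m_star cofactor_edg)
  then have "e (i + 1) * (m i * v i * e i) = e (i + 1) * monomial (cofactor (i + 1))"
    "e i * (m i * v i * e (i + 1)) = e i * monomial (cofactor i)"
    by (simp_all only: mult_ac)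
  then show "m i * v i * e i = monomial (cofactor (i + 1))" "m i * v i * e (i + 1) = monomial (cofactor i)"
    by simp_all
qed

section \<open>Syzygies of the generators, by successive substitution of zero\<close>

lemma kill_vtx_m: "i < n \<Longrightarrow> j < n \<Longrightarrow> kill {vtx i} (m j) = (if j = i then m j else 0)"
  by (auto simp: kill_monomial in_keys_iff lookup_gen vars_eq)

lemma kill_edg_cofactor:
  "i < n \<Longrightarrow> j < n \<Longrightarrow> kill {edg i} (monomial (cofactor j)) = (if j = i then monomial (cofactor j) else 0)"
  by (auto simp: kill_monomial in_keys_iff lookup_cofactor vars_eq)

text \<open>As \<open>n \<ge> 3\<close>, distinct vertices share at most one edge, so some edge at
  vertex \<open>i\<close> does not meet vertex \<open>j\<close> and hence divides
  \<open>m j\<close>.\<close>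

lemma kill_edges_mv:
  assumes "i < n" "j < n"
  shows "kill {edg i, edg (i + 1)} (m j * v j :: (Xvar, 'k::field) mpol) = (if j = i then m j * v j else 0)"
proof (cases "j = i")
  case True
  then show ?thesis by (auto simp: kill_mult kill_monomial kill_indet in_keys_iff lookup_gen)
next
  case False
  have "edg i \<noteq> edg j \<and> edg i \<noteq> edg (j + 1) \<or> edg (i + 1) \<noteq> edg j \<and> edg (i + 1) \<noteq> edg (j + 1)"
    using assms False n_ge_3 by (auto simp: mod_Suc split: if_splits)
  then have "kill {edg i, edg (i + 1)} (m j :: (Xvar, 'k) mpol) = 0"
    by (auto simp: kill_monomial in_keys_iff lookup_gen vars_eq)
  then show ?thesis using False by (simp add: kill_mult)
qed

text \<open>Setting \<open>K\<close> to zero leaves a single term of the relation, and its known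
  factor cancels. What remains says that the coefficient lies in the ideal generated by
  \<open>K\<close>.\<close>

lemma killed_coefficient:
  assumes eq: "(\<Sum>j<n. y j * q j) = 0"
    and q: "\<And>j. j < n \<Longrightarrow> kill K (q j) = (if j = i then q j else 0)"
    and i: "i < n" and cancel: "\<And>f. f * q i = 0 \<Longrightarrow> f = 0"
  shows "kill K (y i) = 0"
proof -
  have "0 = kill K (\<Sum>j<n. y j * q j)" by (simp add: eq)
  also have "\<dots> = (\<Sum>j<n. if j = i then kill K (y i) * q i else 0)"
    unfolding kill_sum by (rule sum.cong) (auto simp: kill_mult q)
  also have "\<dots> = kill K (y i) * q i" using i by simp
  finally show ?thesis using cancel by metis
qed

text \<open>Choose on one period only. Periodic families allow index shifts later without any
  reduction modulo \<open>n\<close>.\<close>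

lemma choose_periodic:
  assumes "\<And>i. i < n \<Longrightarrow> \<exists>q. P i q" and "\<And>i q. P (i mod n) q \<Longrightarrow> P i q"
  shows "\<exists>q. (\<forall>i. P i (q i)) \<and> (\<forall>i. q (i + n) = q i)"
proof -
  from assms(1) have "\<forall>i. \<exists>q. P (i mod n) q" by simp
  then obtain q where "\<And>i. P (i mod n) (q i)" by metis
  then have "P i (q (i mod n))" for i using assms(2) by (metis mod_mod_trivial)
  then show ?thesis by (intro exI[of _ "\<lambda>i. q (i mod n)"]) simp
qed

text \<open>Every syzygy is \<open>a0\<close> times the hub syzygy plus \<open>a i\<close> times the
  edge syzygies. The hub syzygy is anchored at vertex 0, which is the case
  \<open>n dvd i + 1\<close>; coordinates are taken at \<open>i + 1\<close> so that the preceding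
  edge has index \<open>i\<close> rather than a truncated difference. The proof strips the hub, the
  vertices and the edges from the coefficients in turn, until only a sum around the cycle is
  left.\<close>

theorem syzygies:
  fixes x :: "nat \<Rightarrow> (Xvar, 'k::field) mpol"
  assumes eq: "x0 * m0 + (\<Sum>i<n. x i * m i) = 0" and per: "\<And>i. x (i + n) = x i"
  shows "\<exists>a0 a. (\<forall>i. a (i + n) = a i) \<and> x0 = a0 * (h * h) \<and>
    (\<forall>i. x (i + 1) = a (i + 1) * (e (i + 1) * v (i + 1)) - a i * (v (i + 1) * e (i + 2)) -
       (if n dvd i + 1 then a0 * (e (i + 1) * v (i + 1) * e (i + 2)) else 0))"
proof -
  \<comment> \<open>The hub has exponent 2 in every \<open>gen i\<close> and does not occur in
    \<open>gen0\<close>, so setting it to zero twice extracts the factor \<open>h * h\<close> from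
    \<open>x0\<close>.\<close>
  have "kill {hub} (x0 * m0 + (\<Sum>i<n. x i * m i)) = kill {hub} x0 * m0"
    by (simp add: kill_add kill_sum kill_mult kill_hub_gens)
  then have "kill {hub} x0 * m0 = 0" using eq by simp
  then have "kill {hub} x0 = 0" by (simp add: mult.commute)
  from kill_eq_0D[OF this] obtain x0' where x0': "x0 = h * x0'" ..
  define m' where "m' i = (monomial (gen i - Poly_Mapping.single hub 1) :: (Xvar, 'k) mpol)" for i
  have m': "m i = h * m' i" for i
  proof -
    have "gen i = Poly_Mapping.single hub 1 + (gen i - Poly_Mapping.single hub 1)"
      by (rule poly_mapping_eqI) (auto simp: lookup_add lookup_minus lookup_gen lookup_single when_def)
    then show ?thesis unfolding m'_def indet_def by (metis monomial_add)
  qed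
  have "kill {hub} (m' i) = 0" for i
    unfolding m'_def by (auto simp: kill_monomial in_keys_iff lookup_gen lookup_minus)
  moreover have "x0' * m0 + (\<Sum>i<n. x i * m' i) = 0"
  proof -
    have "h * (x0' * m0 + (\<Sum>i<n. x i * m' i)) = x0 * m0 + (\<Sum>i<n. x i * m i)"
      by (simp add: x0' m' algebra_simps sum_distrib_left)
    then show ?thesis using eq by (metis indet_times_cancel(2))
  qed
  then have "kill {hub} (x0' * m0 + (\<Sum>i<n. x i * m' i)) = 0" by simp
  ultimately have "kill {hub} x0' * m0 = 0"
    by (simp add: kill_add kill_sum kill_mult kill_hub_gens)
  then have "kill {hub} x0' = 0" by (simp add: mult.commute)
  from kill_eq_0D[OF this] obtain a0 where "x0' = h * a0" ..
  with x0' have x0: "x0 = a0 * (h * h)" by (simp add: mult_ac)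

  \<comment> \<open>Subtracting \<open>a0\<close> times the hub syzygy leaves a syzygy among the
    cycle generators.\<close>
  define y where "y i = x i + (if n dvd i then a0 * (e i * v i * e (i + 1)) else 0)" for i
  have per_y: "y (i + n) = y i" for i
  proof -
    have "edg (Suc (i + n)) = edg (Suc i)" by (simp add: mod_Suc)
    from arg_cong[OF this, of "indet :: _ \<Rightarrow> (Xvar, 'k) mpol"] show ?thesis by (simp add: y_def per)
  qed
  have "(\<Sum>i<n. y i * m i) = 0"
  proof -
    have "(\<Sum>i<n. y i * m i) = (\<Sum>i<n. x i * m i) + (\<Sum>i<n. if i = 0 then a0 * w else 0)"
      unfolding sum.distrib[symmetric]
    proof (rule sum.cong)
      fix i assume "i \<in> {..<n}"
      then have "n dvd i \<longleftrightarrow> i = 0" by (auto dest: dvd_imp_le)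
      moreover have "a0 * (e i * v i * e (i + 1)) * m i = a0 * w"
        unfolding m_star[of i, symmetric] by (simp only: mult_ac)
      ultimately show "y i * m i = x i * m i + (if i = 0 then a0 * w else 0)"
        by (auto simp: y_def distrib_right)
    qed simp
    also have "\<dots> = x0 * m0 + (\<Sum>i<n. x i * m i)"
      unfolding m0_hub[symmetric] x0 by (simp add: mult_ac)
    finally show ?thesis using eq by simp
  qed
  have cancel_monomial: "f * monomial b = 0 \<Longrightarrow> f = 0" for f :: "(Xvar, 'k) mpol" and b
    by (simp add: mult.commute[of f])
  \<comment> \<open>Within one period \<open>vtx i\<close> divides every generator except
    \<open>gen i\<close>.\<close>
  have "\<exists>q. y i = v i * q" if "i < n" for i
    using kill_eq_0D[OF killed_coefficient[OF \<open>(\<Sum>i<n. y i * m i) = 0\<close> kill_vtx_m[OF that] that cancel_monomial]]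
    by simp
  then have "\<exists>y'. (\<forall>i. y i = v i * y' i) \<and> (\<forall>i. y' (i + n) = y' i)"
    by (rule choose_periodic) (simp_all add: vtx_def periodic_mod[of y, OF per_y])
  then obtain y' where y': "\<And>i. y i = v i * y' i" and per_y': "\<And>i. y' (i + n) = y' i" by blast
  have y'0: "(\<Sum>i<n. y' i * (m i * v i)) = 0"
    using \<open>(\<Sum>i<n. y i * m i) = 0\<close> by (simp add: y' mult_ac)
  have cancel: "f * (m i * v i) = 0 \<Longrightarrow> f = 0" for i and f :: "(Xvar, 'k) mpol"
    by (simp add: indet_def monomial_add[symmetric]) (simp add: mult.commute[of f])
  \<comment> \<open>After the vertices are moved into the monomials, only the term at
    \<open>i\<close> avoids both edges at vertex \<open>i\<close>.\<close>
  have "\<exists>q. y' i = fst q * e i + snd q * e (i + 1)" if "i < n" for i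
    using kill_eq_0D2[OF killed_coefficient[OF y'0 kill_edges_mv[OF that] that cancel]] by simp
  then have "\<exists>q. (\<forall>i. y' i = fst (q i) * e i + snd (q i) * e (i + 1)) \<and> (\<forall>i. q (i + n) = q i)"
  proof (rule choose_periodic)
    fix i and q :: "(Xvar, 'k) mpol \<times> (Xvar, 'k) mpol"
    assume "y' (i mod n) = fst q * e (i mod n) + snd q * e (i mod n + 1)"
    moreover have "edg (i mod n) = edg i" "edg (i mod n + 1) = edg (i + 1)"
      by (simp_all add: edg_eq_iff mod_Suc)
    ultimately show "y' i = fst q * e i + snd q * e (i + 1)"
      by (simp only: periodic_mod[of y', OF per_y'])
  qed
  then obtain q where q: "\<And>i. y' i = fst (q i) * e i + snd (q i) * e (i + 1)" and per_q: "\<And>i. q (i + n) = q i"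
    by blast
  define A B where "A i = fst (q i)" and "B i = snd (q i)" for i
  have AB: "y' i = A i * e i + B i * e (i + 1)" for i by (simp add: q A_def B_def)
  have per_AB: "A (i + n) = A i" "B (i + n) = B i" for i by (simp_all add: A_def B_def per_q)
  \<comment> \<open>The two ends of \<open>edg (i + 1)\<close> contribute to the same monomial
    \<open>cofactor (i + 1)\<close>, with coefficients \<open>A i\<close> and
    \<open>B (i + 1)\<close>. Their sum measures the deviation from a combination of edge syzygies,
    for which it vanishes.\<close>
  define D where "D i = A i + B (i + 1)" for i
  have per_D: "D (i + n) = D i" for i
    using per_AB(2)[of "i + 1"] by (simp add: D_def per_AB add_ac)
  have cof_per: "cofactor (i + n) = cofactor i" for i by (simp add: cofactor_def)
  have D0: "(\<Sum>i<n. D i * monomial (cofactor (i + 1))) = 0"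
  proof -
    have "y' i * (m i * v i) = A i * monomial (cofactor (i + 1)) + B i * monomial (cofactor i)" for i
    proof -
      have "y' i * (m i * v i) = A i * (m i * v i * e i) + B i * (m i * v i * e (i + 1))"
        by (simp add: AB algebra_simps)
      then show ?thesis by (simp only: m_cofactor)
    qed
    then have "(\<Sum>i<n. A i * monomial (cofactor (i + 1))) + (\<Sum>i<n. B i * monomial (cofactor i)) = 0"
      using y'0 by (simp add: sum.distrib)
    moreover have "(\<Sum>i<n. B (i + 1) * monomial (cofactor (i + 1))) = (\<Sum>i<n. B i * monomial (cofactor i))"
      by (rule sum_periodic_Suc) (simp add: per_AB cof_per)
    ultimately show ?thesis by (simp add: D_def distrib_right sum.distrib)
  qed
  \<comment> \<open>Reindexing so that \<open>D' i\<close> belongs to \<open>cofactor i\<close>;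
    \<open>i + n - 1\<close> is the predecessor modulo \<open>n\<close>, also for
    \<open>i = 0\<close>.\<close>
  define D' where "D' i = D (i + n - 1)" for i
  have D'_Suc: "D' (i + 1) = D i" for i by (simp add: D'_def per_D)
  have per_D': "D' (i + n) = D' i" for i
    using per_D[of "i + n - 1"] n_ge_3 by (simp add: D'_def)
  have D'0: "(\<Sum>i<n. D' i * monomial (cofactor i)) = 0"
    using D0 sum_periodic_Suc[of "\<lambda>i. D' i * monomial (cofactor i)" n] D'_Suc by (simp add: per_D' cof_per)
  have "\<exists>q. D' i = e i * q" if "i < n" for i
    using kill_eq_0D[OF killed_coefficient[OF D'0 kill_edg_cofactor[OF that] that cancel_monomial]]
    by simp
  then have "\<exists>d. (\<forall>i. D' i = e i * d i) \<and> (\<forall>i. d (i + n) = d i)"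
    by (rule choose_periodic) (simp_all add: edg_def periodic_mod[of D', OF per_D'])
  then obtain d where d: "\<And>i. D' i = e i * d i" and per_d: "\<And>i. d (i + n) = d i" by blast
  have "w * (\<Sum>i<n. d i) = 0"
  proof -
    have "w * (\<Sum>i<n. d i) = (\<Sum>i<n. D' i * monomial (cofactor i))"
      unfolding sum_distrib_left
    proof (rule sum.cong)
      fix i
      show "w * d i = D' i * monomial (cofactor i)"
        unfolding cofactor_edg[of i, symmetric] d by (simp only: mult_ac)
    qed simp
    then show ?thesis using D'0 by simp
  qed
  then have d0: "(\<Sum>i<n. d i) = 0" by simp

  \<comment> \<open>As the \<open>d i\<close> add up to zero around the cycle, their partial sums
    form a periodic primitive. Adding \<open>e (i + 1) * s i\<close> to \<open>A i\<close> absorbs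
    the deviation. The primitive is unique up to a constant, which is the freedom of adding a
    multiple of \<open>z\<close>.\<close>
  define s where "s i = (\<Sum>j<i + 1. d j)" for i
  have s_Suc: "s (i + 1) = s i + d (i + 1)" for i by (simp add: s_def)
  have per_s: "s (i + n) = s i" for i
  proof (induction i)
    case 0
    have "s n = (\<Sum>j<n. d j) + d n" by (simp add: s_def)
    then show ?case using d0 per_d[of 0] by (simp add: s_def)
  next
    case (Suc i)
    then show ?case using s_Suc[of i] s_Suc[of "i + n"] per_d[of "i + 1"] by (simp add: add_ac)
  qed
  define a where "a i = A i + e (i + 1) * s i" for i
  have "a (i + n) = a i" for i
  proof -
    have "edg (Suc (i + n)) = edg (Suc i)" by (simp add: mod_Suc)
    from arg_cong[OF this, of "indet :: _ \<Rightarrow> (Xvar, 'k) mpol"] show ?thesis by (simp add: a_def per_AB per_s)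
  qed
  moreover have "x (i + 1) = a (i + 1) * (e (i + 1) * v (i + 1)) - a i * (v (i + 1) * e (i + 2)) -
       (if n dvd i + 1 then a0 * (e (i + 1) * v (i + 1) * e (i + 2)) else 0)" for i
  proof -
    have "B (i + 1) = e (i + 1) * d (i + 1) - A i"
      using D'_Suc[of i] d[of "i + 1"] by (simp add: D_def algebra_simps)
    then have "y' (i + 1) = A (i + 1) * e (i + 1) + (e (i + 1) * d (i + 1) - A i) * e (i + 2)"
      by (simp add: AB)
    also have "\<dots> = a (i + 1) * e (i + 1) - a i * e (i + 2)"
    proof -
      have "d (i + 1) = s (i + 1) - s i" unfolding s_Suc by simp
      then show ?thesis unfolding a_def \<open>d (i + 1) = s (i + 1) - s i\<close>
        by (simp add: algebra_simps)
    qed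
    finally have "y (i + 1) = v (i + 1) * (a (i + 1) * e (i + 1) - a i * e (i + 2))"
      by (simp add: y')
    then show ?thesis by (cases "n dvd i + 1") (simp_all add: y_def algebra_simps)
  qed
  ultimately show ?thesis using x0 by blast
qed

text \<open>Each vertex gives \<open>a (i + 1) * e (i + 1) = a i * e (i + 2)\<close>. As
  neighbouring edges are different variables, \<open>e (i + 1)\<close> divides \<open>a i\<close>,
  and the quotients agree from one index to the next. So the relations among the syzygies are the
  multiples of \<open>z\<close>.\<close>

theorem second_syzygies:
  fixes a :: "nat \<Rightarrow> (Xvar, 'k::field) mpol"
  assumes per: "\<And>i. a (i + n) = a i" and a0: "a0 * (h * h) = 0"
    and eq: "\<And>i. a (i + 1) * (e (i + 1) * v (i + 1)) - a i * (v (i + 1) * e (i + 2)) -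
       (if n dvd i + 1 then a0 * (e (i + 1) * v (i + 1) * e (i + 2)) else 0) = 0"
  shows "a0 = 0 \<and> (\<exists>c. \<forall>i. a i = c * e (i + 1))"
proof -
  have "h * (h * a0) = 0" using a0 by (simp add: mult_ac)
  then have 0: "a0 = 0" by (simp only: indet_times_cancel(2))
  have *: "a (i + 1) * e (i + 1) = a i * e (i + 2)" for i
  proof -
    have "v (i + 1) * (a (i + 1) * e (i + 1)) = v (i + 1) * (a i * e (i + 2))"
      using eq[of i] by (simp add: 0 algebra_simps)
    then show ?thesis by (simp only: indet_times_cancel(1))
  qed
  have "\<exists>c. a i = e (i + 1) * c" for i
  proof -
    have "kill {edg (i + 1)} (a i * e (i + 2)) = 0"
      unfolding *[symmetric] by (simp add: kill_mult kill_indet)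
    moreover have "edg (i + 2) \<noteq> edg (i + 1)" using edg_Suc_neq[of "i + 1"] by simp
    ultimately have "e (i + 2) * kill {edg (i + 1)} (a i) = 0"
      by (simp add: kill_mult kill_indet mult.commute)
    then have "kill {edg (i + 1)} (a i) = 0" by (simp only: indet_times_cancel(2))
    then show ?thesis by (rule kill_eq_0D)
  qed
  then obtain c where c: "\<And>i. a i = e (i + 1) * c i" by metis
  have "c i = c 0" for i
  proof (induction i)
    case (Suc i)
    have "e (i + 1) * (e (i + 2) * c (i + 1)) = e (i + 1) * (e (i + 2) * c i)"
      using *[of i] by (simp add: c mult_ac)
    then have "c (i + 1) = c i" by (simp only: indet_times_cancel(1))
    with Suc show ?case by simp
  qed simp
  then have "a i = c 0 * e (i + 1)" for i using c[of i] by (metis mult.commute)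
  with 0 show ?thesis by blast
qed

end

section \<open>Minimal presentations with a semilinear symmetry\<close>

definition scl :: "'a::comm_ring_1 \<Rightarrow> ('b \<Rightarrow> 'a) \<Rightarrow> 'b \<Rightarrow> 'a"  (infixr \<open>*s\<close> 75) where
  "r *s x = (\<lambda>b. r * x b)"

lemma scl_apply [simp]: "(r *s x) b = r * x b"
  by (simp add: scl_def)

lemma scl_simps:
  "r *s (x + y) = r *s x + r *s y" "r *s (x - y) = r *s x - r *s y"
  "(r + s) *s x = r *s x + s *s x" "(r - s) *s x = r *s x - s *s x"
  "r *s s *s x = (r * s) *s x" "1 *s x = x" "0 *s x = 0" "r *s 0 = 0"
  by (auto simp: fun_eq_iff algebra_simps)

lemma sum_fun_apply: "(\<Sum>i\<in>A. f i) b = (\<Sum>i\<in>A. f i (b :: 'b) :: 'a::comm_monoid_add)"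
  by (induction A rule: infinite_finite_induct) auto

lemma scl_sum: "r *s (\<Sum>i\<in>A. f i) = (\<Sum>i\<in>A. r *s f i)"
  by (auto simp: fun_eq_iff sum_fun_apply sum_distrib_left)

lemma scl_sum_left: "(\<Sum>i\<in>A. f i) *s x = (\<Sum>i\<in>A. f i *s x)"
  by (auto simp: fun_eq_iff sum_fun_apply sum_distrib_right)

lemma additive_sum:
  fixes L :: "'a::ab_group_add \<Rightarrow> 'b::ab_group_add"
  assumes "\<And>x y. L (x + y) = L x + L y"
  shows "L (\<Sum>i\<in>A. f i) = (\<Sum>i\<in>A. L (f i))"
proof -
  have "L 0 = 0" using assms[of 0 0] by simp
  then show ?thesis by (induction A rule: infinite_finite_induct) (auto simp: assms)
qed

lemma additive_diff:
  fixes L :: "'a::ab_group_add \<Rightarrow> 'b::ab_group_add"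
  assumes "\<And>x y. L (x + y) = L x + L y"
  shows "L (x - y) = L x - L y"
  using assms[of "x - y" y] by simp

definition unit_vec :: "'b \<Rightarrow> 'b \<Rightarrow> 'a::comm_ring_1" where
  "unit_vec c = (\<lambda>b. if b = c then 1 else 0)"

text \<open>The free module over the subring with basis \<open>B\<close>, embedded in the functions
  with arbitrary polynomial values by extension with zero.\<close>

definition vecs :: "'x set \<Rightarrow> 'b set \<Rightarrow> ('b \<Rightarrow> ('x, 'k::field) mpol) set" where
  "vecs X B = {x. (\<forall>b. x b \<in> polys X) \<and> (\<forall>b. b \<notin> B \<longrightarrow> x b = 0)}"

lemma vecs_closed [simp]:
  "0 \<in> vecs X B" "x \<in> vecs X B \<Longrightarrow> y \<in> vecs X B \<Longrightarrow> x + y \<in> vecs X B"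
  "x \<in> vecs X B \<Longrightarrow> y \<in> vecs X B \<Longrightarrow> x - y \<in> vecs X B"
  "r \<in> polys X \<Longrightarrow> x \<in> vecs X B \<Longrightarrow> r *s x \<in> vecs X B"
  by (auto simp: vecs_def)

lemma vecs_sum [simp]: "(\<And>i. i \<in> A \<Longrightarrow> f i \<in> vecs X B) \<Longrightarrow> (\<Sum>i\<in>A. f i) \<in> vecs X B"
  by (induction A rule: infinite_finite_induct) auto

lemma vecs_apply: "x \<in> vecs X B \<Longrightarrow> x b \<in> polys X"
  by (simp add: vecs_def)

lemma unit_vec_vecs [simp]: "c \<in> B \<Longrightarrow> unit_vec c \<in> vecs X B"
  by (auto simp: vecs_def unit_vec_def)

lemma vec_expand:
  assumes "x \<in> vecs X B" "finite B"
  shows "x = (\<Sum>c\<in>B. x c *s unit_vec c)"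
proof
  fix b
  have "(\<Sum>c\<in>B. x c * unit_vec c b) = (\<Sum>c\<in>B. if b = c then x c else 0)"
    by (rule sum.cong) (simp_all add: unit_vec_def)
  also have "\<dots> = x b" using assms by (simp add: vecs_def)
  finally show "x b = (\<Sum>c\<in>B. x c *s unit_vec c) b" by (simp add: sum_fun_apply)
qed

text \<open>In coordinates, the submodule \<open>m^k F\<close> of a free module
  \<open>F\<close>.\<close>

definition ord_ge :: "nat \<Rightarrow> ('b \<Rightarrow> ('x, 'k::field) mpol) set" where
  "ord_ge k = {x. \<forall>b. x b \<in> deg_ge k}"

lemma ord_ge_add: "x \<in> ord_ge k \<Longrightarrow> y \<in> ord_ge k \<Longrightarrow> x + y \<in> ord_ge k"
  by (simp add: ord_ge_def deg_ge_add)

lemma ord_ge_diff: "x \<in> ord_ge k \<Longrightarrow> y \<in> ord_ge k \<Longrightarrow> x - y \<in> ord_ge k"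
  by (simp add: ord_ge_def deg_ge_diff)

lemma ord_ge_sum: "(\<And>i. i \<in> A \<Longrightarrow> f i \<in> ord_ge k) \<Longrightarrow> (\<Sum>i\<in>A. f i) \<in> ord_ge k"
  by (simp add: ord_ge_def sum_fun_apply deg_ge_sum)

lemma ord_ge_scl: "r \<in> deg_ge k \<Longrightarrow> x \<in> ord_ge l \<Longrightarrow> r *s x \<in> ord_ge (k + l)"
  by (simp add: ord_ge_def deg_ge_mult)

lemma ord_ge_0 [simp]: "x \<in> ord_ge 0"
  by (simp add: ord_ge_def)

lemma ord_ge_scl_deg: "r \<in> deg_ge k \<Longrightarrow> r *s x \<in> ord_ge k"
  using ord_ge_scl[of r k x 0] by simp

lemma ord_ge_scl_left: "x \<in> ord_ge l \<Longrightarrow> r *s x \<in> ord_ge l"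
  using ord_ge_scl[of r 0 x l] by simp

text \<open>The bookkeeping of one iteration: the rotation moves the \<open>2 * j\<close> terms
  gathered so far by two places, and two new terms fill the gap.\<close>

lemma sum_shift_two:
  fixes F :: "nat \<Rightarrow> 'a::comm_monoid_add"
  shows "(\<Sum>i<2. F i) + (\<Sum>i<2 * j. F (i + 2)) = (\<Sum>i<2 * Suc j. F i)"
proof -
  have "(\<Sum>i<2. F i) + (\<Sum>i<l. F (i + 2)) = (\<Sum>i<l + 2. F i)" for l
  proof (induction l)
    case (Suc l)
    then show ?case by (simp add: add.assoc[symmetric])
  qed (simp add: numeral_2_eq_2)
  from this[of "2 * j"] show ?thesis by simp
qed

text \<open>What the contradiction needs from an equivariant resolution, in coordinates: the map
  \<open>mu\<close> from \<open>M_1\<close> to \<open>M_0\<close>, the surjection \<open>pi\<close>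
  onto the ideal, and lifts \<open>T0\<close>, \<open>T1\<close> of the rotation by two, semilinear
  over the ring automorphism \<open>\<theta>\<close>. The maps \<open>mu\<close> and
  \<open>pi\<close> are linear on all functions, whereas \<open>T0\<close> and \<open>T1\<close> are
  controlled only on vectors over the subring. \<open>minimal\<close> combines acyclicity in degree
  1 with the minimality of the next differential; \<open>\<theta>_const\<close> is the triviality of
  the coefficient action.\<close>

locale symmetric_presentation = prime_ideal_data p for p +
  fixes B0 :: "'b set" and B1 :: "'c set"
    and mu :: "('c \<Rightarrow> (Xvar, 'k::field) mpol) \<Rightarrow> 'b \<Rightarrow> (Xvar, 'k) mpol"
    and pi :: "('b \<Rightarrow> (Xvar, 'k) mpol) \<Rightarrow> (Xvar, 'k) mpol"
    and T0 :: "('b \<Rightarrow> (Xvar, 'k) mpol) \<Rightarrow> ('b \<Rightarrow> (Xvar, 'k) mpol)"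
    and T1 :: "('c \<Rightarrow> (Xvar, 'k) mpol) \<Rightarrow> ('c \<Rightarrow> (Xvar, 'k) mpol)"
    and \<theta> :: "(Xvar, 'k) mpol \<Rightarrow> (Xvar, 'k) mpol"
  assumes finite_B0: "finite B0" and finite_B1: "finite B1"
    and char: "CHAR('k) = p"
    and mu_add: "mu (x + y) = mu x + mu y" and mu_scl: "mu (r *s x) = r *s mu x"
    and mu_vecs: "x \<in> vecs (vars p) B1 \<Longrightarrow> mu x \<in> vecs (vars p) B0"
    and pi_add: "pi (x' + y') = pi x' + pi y'" and pi_scl: "pi (r *s x') = r * pi x'"
    and pi_vecs: "x' \<in> vecs (vars p) B0 \<Longrightarrow>
      \<exists>q0 q. q0 \<in> polys (vars p) \<and> (\<forall>i. q i \<in> polys (vars p)) \<and>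
        pi x' = q0 * monomial gen0 + (\<Sum>i<n. q i * monomial (gen i))"
    and exact: "x' \<in> vecs (vars p) B0 \<Longrightarrow> pi x' = 0 \<Longrightarrow> \<exists>y\<in>vecs (vars p) B1. mu y = x'"
    and complex: "x \<in> vecs (vars p) B1 \<Longrightarrow> pi (mu x) = 0"
    and minimal: "x \<in> vecs (vars p) B1 \<Longrightarrow> mu x = 0 \<Longrightarrow> x \<in> ord_ge 1"
    and ex_gen0: "\<exists>x\<in>vecs (vars p) B0. pi x = monomial gen0"
    and ex_gen: "\<exists>x\<in>vecs (vars p) B0. pi x = monomial (gen i)"
    and T0_add: "x' \<in> vecs (vars p) B0 \<Longrightarrow> y' \<in> vecs (vars p) B0 \<Longrightarrow> T0 (x' + y') = T0 x' + T0 y'"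
    and T1_add: "x \<in> vecs (vars p) B1 \<Longrightarrow> y \<in> vecs (vars p) B1 \<Longrightarrow> T1 (x + y) = T1 x + T1 y"
    and T0_scl: "r \<in> polys (vars p) \<Longrightarrow> x' \<in> vecs (vars p) B0 \<Longrightarrow> T0 (r *s x') = \<theta> r *s T0 x'"
    and T1_scl: "r \<in> polys (vars p) \<Longrightarrow> x \<in> vecs (vars p) B1 \<Longrightarrow> T1 (r *s x) = \<theta> r *s T1 x"
    and T0_vecs: "x' \<in> vecs (vars p) B0 \<Longrightarrow> T0 x' \<in> vecs (vars p) B0"
    and T1_vecs: "x \<in> vecs (vars p) B1 \<Longrightarrow> T1 x \<in> vecs (vars p) B1"
    and T_mu: "x \<in> vecs (vars p) B1 \<Longrightarrow> T0 (mu x) = mu (T1 x)"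
    and T_gen0: "x' \<in> vecs (vars p) B0 \<Longrightarrow> pi x' = monomial gen0 \<Longrightarrow> pi (T0 x') = monomial gen0"
    and T_gen: "x' \<in> vecs (vars p) B0 \<Longrightarrow> pi x' = monomial (gen i) \<Longrightarrow> pi (T0 x') = monomial (gen (i + 2))"
    and T1_order: "x \<in> vecs (vars p) B1 \<Longrightarrow> (T1 ^^ p) x = x"
    and \<theta>_deg: "r \<in> polys (vars p) \<Longrightarrow> r \<in> deg_ge k \<Longrightarrow> \<theta> r \<in> deg_ge k"
    and \<theta>_const: "\<theta> (const_poly c) = const_poly c"
    and \<theta>_e: "\<theta> (indet (edg i)) = indet (edg (i + 2))"
    and \<theta>_hh: "\<theta> (indet hub * indet hub) = indet hub * indet hub"
    and \<theta>_ev: "\<theta> (indet (edg i) * indet (vtx i)) = indet (edg (i + 2)) * indet (vtx (i + 2))"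
    and \<theta>_ve: "\<theta> (indet (vtx i) * indet (edg (i + 1))) = indet (vtx (i + 2)) * indet (edg (i + 3))"
    and \<theta>_eve: "\<theta> (indet (edg 0) * indet (vtx 0) * indet (edg 1)) =
      indet (edg 2) * indet (vtx 2) * indet (edg 3)"
begin

abbreviation (input) "R \<equiv> polys (vars p) :: (Xvar, 'k) mpol set"
abbreviation (input) "F0 \<equiv> vecs (vars p) B0 :: ('b \<Rightarrow> (Xvar, 'k) mpol) set"
abbreviation (input) "F1 \<equiv> vecs (vars p) B1 :: ('c \<Rightarrow> (Xvar, 'k) mpol) set"

lemmas mu_sum = additive_sum[of mu, OF mu_add]
lemmas pi_sum = additive_sum[of pi, OF pi_add]
lemmas mu_diff = additive_diff[of mu, OF mu_add]
lemmas pi_diff = additive_diff[of pi, OF pi_add]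

lemma T0_diff: "x \<in> F0 \<Longrightarrow> y \<in> F0 \<Longrightarrow> T0 (x - y) = T0 x - T0 y"
  using T0_add[of "x - y" y] by simp

lemma T1_sum: "(\<And>i. i \<in> A \<Longrightarrow> f i \<in> F1) \<Longrightarrow> T1 (\<Sum>i\<in>A. f i) = (\<Sum>i\<in>A. T1 (f i))"
proof -
  have "T1 0 = 0" using T1_add[of 0 0] by simp
  then show "(\<And>i. i \<in> A \<Longrightarrow> f i \<in> F1) \<Longrightarrow> T1 (\<Sum>i\<in>A. f i) = (\<Sum>i\<in>A. T1 (f i))"
    by (induction A rule: infinite_finite_induct) (auto simp: T1_add)
qed

text \<open>Semilinearity suffices: \<open>\<theta>\<close> preserves the order of the coordinates,
  whatever \<open>T1\<close> does to the basis vectors.\<close>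

lemma T1_ord_ge: "x \<in> F1 \<Longrightarrow> x \<in> ord_ge k \<Longrightarrow> T1 x \<in> ord_ge k"
proof -
  assume x: "x \<in> F1" and "x \<in> ord_ge k"
  have "T1 x = T1 (\<Sum>c\<in>B1. x c *s unit_vec c)" using vec_expand[OF x finite_B1] by simp
  also have "\<dots> = (\<Sum>c\<in>B1. \<theta> (x c) *s T1 (unit_vec c))"
    using vecs_apply[OF x] by (subst T1_sum) (simp_all add: T1_scl)
  also have "\<dots> \<in> ord_ge k"
    using vecs_apply[OF x] \<open>x \<in> ord_ge k\<close>
    by (intro ord_ge_sum ord_ge_scl_deg \<theta>_deg) (simp_all add: ord_ge_def)
  finally show ?thesis .
qed

lemma m_relation:
  "(indet (edg i) * indet (vtx i)) * monomial (gen i) =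
   (indet (vtx (i + 1)) * indet (edg (i + 2))) * (monomial (gen (i + 1)) :: (Xvar, 'k) mpol)"
proof -
  have "monomial (gen i) * indet (vtx i) * indet (edg i) =
     monomial (gen (i + 1)) * indet (vtx (i + 1)) * (indet (edg (i + 1 + 1)) :: (Xvar, 'k) mpol)"
    by (simp only: m_cofactor)
  then show ?thesis by (simp add: mult_ac)
qed

lemma m0_relation:
  "(indet hub * indet hub) * monomial gen0 =
   (indet (edg i) * indet (vtx i) * indet (edg (i + 1))) * (monomial (gen i) :: (Xvar, 'k) mpol)"
  using m0_hub m_star[of i] by (metis mult.commute)

text \<open>Lifts of the generators and of the syzygies are determined only up to the kernel of the
  next map. Each comparison below is therefore made on boundaries and pulled back at the cost of a
  kernel element: of order 1 by minimality, and a constant multiple of \<open>z\<close> modulo order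
  2.\<close>

lemma contradiction: False
proof -
  obtain b0 where b0: "b0 \<in> F0" "pi b0 = monomial gen0" using ex_gen0 by blast
  have "\<exists>x. x \<in> F0 \<and> pi x = monomial (gen i)" for i using ex_gen by blast
  then have "\<exists>b. (\<forall>i. b i \<in> F0 \<and> pi (b i) = monomial (gen i)) \<and> (\<forall>i. b (i + n) = b i)"
    by (intro choose_periodic; (blast | simp add: gen_def))
  then obtain b where b: "\<And>i. b i \<in> F0" "\<And>i. pi (b i) = monomial (gen i)" and per_b: "\<And>i. b (i + n) = b i"
    by blast
  \<comment> \<open>\<open>kap0\<close>, \<open>kap1\<close> map the explicit resolution of the ideal to the given one, \<open>lam0\<close>, \<open>lam1\<close> go
    back (the suffix \<open>h\<close> marks the component at the hub), and \<open>s0\<close> is a homotopy from \<open>kap0 \<circ> lam0\<close>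
    to the identity.\<close>
  define kap0 where "kap0 q0 q = q0 *s b0 + (\<Sum>i<n. q i *s b i)" for q0 and q :: "nat \<Rightarrow> (Xvar, 'k) mpol"
  have kap0_F0: "kap0 q0 q \<in> F0" if "q0 \<in> R" "\<And>i. q i \<in> R" for q0 q
    using that b b0 by (simp add: kap0_def)
  have pi_kap0: "pi (kap0 q0 q) = q0 * monomial gen0 + (\<Sum>i<n. q i * monomial (gen i))" for q0 q
    by (simp add: kap0_def pi_add pi_scl pi_sum b0 b)

  \<comment> \<open>All choices are made on basis vectors and extended by finite sums, so that
    \<open>lam0h\<close>, \<open>lam0\<close> and \<open>s0\<close> are linear by
    construction.\<close>
  have "\<forall>c\<in>B0. \<exists>q0 q. q0 \<in> R \<and> (\<forall>i. q i \<in> R) \<and>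
      pi (unit_vec c) = q0 * monomial gen0 + (\<Sum>i<n. q i * monomial (gen i))"
    by (intro ballI pi_vecs) simp
  from bchoice[OF this] obtain P0 where "\<forall>c\<in>B0. \<exists>q. P0 c \<in> R \<and> (\<forall>i. q i \<in> R) \<and>
      pi (unit_vec c) = P0 c * monomial gen0 + (\<Sum>i<n. q i * monomial (gen i))" ..
  from bchoice[OF this] obtain P where "\<forall>c\<in>B0. P0 c \<in> R \<and> (\<forall>i. P c i \<in> R) \<and>
      pi (unit_vec c) = P0 c * monomial gen0 + (\<Sum>i<n. P c i * monomial (gen i))" ..
  then have P: "\<And>c. c \<in> B0 \<Longrightarrow> P0 c \<in> R" "\<And>c i. c \<in> B0 \<Longrightarrow> P c i \<in> R"
     "\<And>c. c \<in> B0 \<Longrightarrow> pi (unit_vec c) = P0 c * monomial gen0 + (\<Sum>i<n. P c i * monomial (gen i))"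
    by blast+
  have "\<forall>c\<in>B0. \<exists>y. y \<in> F1 \<and> mu y = unit_vec c - kap0 (P0 c) (P c)"
  proof
    fix c assume c: "c \<in> B0"
    have "pi (unit_vec c - kap0 (P0 c) (P c)) = 0"
      by (simp add: pi_diff pi_kap0 P c)
    then show "\<exists>y. y \<in> F1 \<and> mu y = unit_vec c - kap0 (P0 c) (P c)"
      using exact[of "unit_vec c - kap0 (P0 c) (P c)"] c P kap0_F0 by auto
  qed
  from bchoice[OF this] obtain Y where "\<forall>c\<in>B0. Y c \<in> F1 \<and> mu (Y c) = unit_vec c - kap0 (P0 c) (P c)" ..
  then have Y: "\<And>c. c \<in> B0 \<Longrightarrow> Y c \<in> F1" "\<And>c. c \<in> B0 \<Longrightarrow> mu (Y c) = unit_vec c - kap0 (P0 c) (P c)"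
    by blast+
  define lam0h where "lam0h x = (\<Sum>c\<in>B0. x c * P0 c)" for x
  \<comment> \<open>The chosen coefficients matter only below \<open>n\<close>; reading them at
    \<open>i mod n\<close> makes the family periodic.\<close>
  define lam0 where "lam0 x i = (\<Sum>c\<in>B0. x c * P c (i mod n))" for x and i :: nat
  define s0 where "s0 x = (\<Sum>c\<in>B0. x c *s Y c)" for x
  have s0_F1: "s0 x \<in> F1" if "x \<in> F0" for x
    using vecs_apply[OF that] Y by (simp add: s0_def)
  have lam0_per: "lam0 x (i + n) = lam0 x i" for x i by (simp add: lam0_def)
  have lam0_R: "lam0h x \<in> R" "lam0 x i \<in> R" if "x \<in> F0" for x i
    using vecs_apply[OF that] P by (simp_all add: lam0h_def lam0_def polys_sum)
  have lam0_add: "lam0h (x + y) = lam0h x + lam0h y" "lam0 (x + y) i = lam0 x i + lam0 y i" for x y i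
    by (simp_all add: lam0h_def lam0_def distrib_right sum.distrib)
  have lam0_scl: "lam0h (r *s x) = r * lam0h x" "lam0 (r *s x) i = r * lam0 x i" for r x i
    by (simp_all add: lam0h_def lam0_def sum_distrib_left mult.assoc)
  have lam0_diff: "lam0 (x - y) i = lam0 x i - lam0 y i" for x y i
    using lam0_add(2)[of "x - y" y i] by simp
  have kap0_lam0: "kap0 (lam0h x) (lam0 x) = (\<Sum>c\<in>B0. x c *s kap0 (P0 c) (P c))" for x
  proof -
    have "(\<Sum>i<n. lam0 x i *s b i) = (\<Sum>i<n. \<Sum>c\<in>B0. x c *s P c i *s b i)"
      by (rule sum.cong) (auto simp: lam0_def scl_sum_left scl_simps)
    also have "\<dots> = (\<Sum>c\<in>B0. \<Sum>i<n. x c *s P c i *s b i)" by (rule sum.swap)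
    finally show ?thesis
      by (simp add: kap0_def lam0h_def scl_sum_left scl_sum scl_simps sum.distrib)
  qed
  have decomp0: "x = kap0 (lam0h x) (lam0 x) + mu (s0 x)" if "x \<in> F0" for x
  proof -
    have "mu (s0 x) = (\<Sum>c\<in>B0. x c *s (unit_vec c - kap0 (P0 c) (P c)))"
      by (auto simp: s0_def mu_sum mu_scl Y intro!: sum.cong)
    also have "\<dots> = x - kap0 (lam0h x) (lam0 x)"
      unfolding kap0_lam0 using vec_expand[OF that finite_B0] by (simp add: scl_simps sum_subtractf)
    finally show ?thesis by simp
  qed
  have pi_lam0: "pi x = lam0h x * monomial gen0 + (\<Sum>i<n. lam0 x i * monomial (gen i))" if "x \<in> F0" for x
  proof -
    have "pi x = pi (kap0 (lam0h x) (lam0 x)) + pi (mu (s0 x))"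
      using decomp0[OF that] by (metis pi_add)
    then show ?thesis using complex[OF s0_F1[OF that]] by (simp add: pi_kap0)
  qed

  have "\<exists>y. y \<in> F1 \<and> mu y = (indet (edg i) * indet (vtx i)) *s b i -
      (indet (vtx (i + 1)) * indet (edg (i + 2))) *s b (i + 1)" for i
  proof -
    let ?x = "(indet (edg i) * indet (vtx i)) *s b i -
      (indet (vtx (i + 1)) * indet (edg (i + 2))) *s b (i + 1)"
    have "?x \<in> F0" using b by simp
    moreover have "pi ?x = 0" using m_relation[of i] by (simp add: pi_diff pi_scl b)
    ultimately show ?thesis using exact by blast
  qed
  then have "\<exists>f. (\<forall>i. f i \<in> F1 \<and> mu (f i) = (indet (edg i) * indet (vtx i)) *s b i -
      (indet (vtx (i + 1)) * indet (edg (i + 2))) *s b (i + 1)) \<and> (\<forall>i. f (i + n) = f i)"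
  proof (intro choose_periodic)
    fix i and q :: "'c \<Rightarrow> (Xvar, 'k) mpol"
    have "b (i mod n) = b i" "b (i mod n + 1) = b (i + 1)"
      using periodic_mod[of b, OF per_b] by (metis mod_add_left_eq)+
    moreover have "edg (i mod n) = edg i" "vtx (i mod n) = vtx i" "vtx (i mod n + 1) = vtx (i + 1)"
      "edg (i mod n + 2) = edg (i + 2)"
      by (simp_all only: edg_eq_iff vtx_eq_iff mod_mod_trivial mod_add_left_eq)
    moreover assume "q \<in> F1 \<and> mu q = (indet (edg (i mod n)) * indet (vtx (i mod n))) *s b (i mod n) -
      (indet (vtx (i mod n + 1)) * indet (edg (i mod n + 2))) *s b (i mod n + 1)"
    ultimately show "q \<in> F1 \<and> mu q = (indet (edg i) * indet (vtx i)) *s b i -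
      (indet (vtx (i + 1)) * indet (edg (i + 2))) *s b (i + 1)"
      by (simp only:)
  qed
  then obtain f where f: "\<And>i. f i \<in> F1" "\<And>i. mu (f i) = (indet (edg i) * indet (vtx i)) *s b i -
      (indet (vtx (i + 1)) * indet (edg (i + 2))) *s b (i + 1)" and per_f: "\<And>i. f (i + n) = f i"
    by blast
  obtain g where g: "g \<in> F1" "mu g = (indet hub * indet hub) *s b0 -
      (indet (edg 0) * indet (vtx 0) * indet (edg 1)) *s b 0"
  proof -
    let ?x = "(indet hub * indet hub) *s b0 - (indet (edg 0) * indet (vtx 0) * indet (edg 1)) *s b 0"
    have "?x \<in> F0" using b b0 by simp
    moreover have "pi ?x = 0" using m0_relation[of 0] by (simp add: pi_diff pi_scl b b0)
    ultimately show ?thesis using exact that by blast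
  qed
  define kap1 where "kap1 a0 a = a0 *s g + (\<Sum>i<n. a i *s f i)" for a0 and a :: "nat \<Rightarrow> (Xvar, 'k) mpol"
  have kap1_F1: "kap1 a0 a \<in> F1" if "a0 \<in> R" "\<And>i. a i \<in> R" for a0 a
    using that f g by (simp add: kap1_def)
  \<comment> \<open>The coordinate at vertex \<open>i + 1\<close> of the boundary, in the explicit
    resolution, of \<open>a0\<close> times the hub syzygy plus \<open>a\<close> times the edge
    syzygies.\<close>
  define psi where "psi a0 a i = a (i + 1) * (indet (edg (i + 1)) * indet (vtx (i + 1))) -
      a i * (indet (vtx (i + 1)) * indet (edg (i + 2))) -
      (if n dvd i + 1 then a0 * (indet (edg (i + 1)) * indet (vtx (i + 1)) * indet (edg (i + 2))) else 0)"
    for a0 and a :: "nat \<Rightarrow> (Xvar, 'k) mpol" and i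
  have mu_kap1: "mu (kap1 a0 a) = kap0 q0 q"
    if a: "\<And>i. a (i + n) = a i" and q0: "q0 = a0 * (indet hub * indet hub)"
      and q: "\<And>i. q (i + n) = q i" and eq: "\<And>i. q (i + 1) = psi a0 a i" for a0 a q0 q
  proof -
    let ?ev = "\<lambda>i. indet (edg i) * indet (vtx i) :: (Xvar, 'k) mpol"
    let ?ve = "\<lambda>i. indet (vtx i) * indet (edg (i + 1)) :: (Xvar, 'k) mpol"
    let ?u = "indet (edg 0) * indet (vtx 0) * indet (edg 1) :: (Xvar, 'k) mpol"
    have "(\<Sum>i<n. q i *s b i) = (\<Sum>i<n. q (i + 1) *s b (i + 1))"
      by (rule sum_periodic_Suc[symmetric]) (simp add: q per_b)
    \<comment> \<open>The hub syzygy contributes to the summand \<open>i = n - 1\<close>, whose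
      successor \<open>n\<close> stands for vertex 0.\<close>
    also have "\<dots> = (\<Sum>i<n. (a (i + 1) * ?ev (i + 1)) *s b (i + 1) - (a i * ?ve (i + 1)) *s b (i + 1) -
        (if i = n - 1 then (a0 * ?u) *s b 0 else 0))"
    proof (rule sum.cong)
      fix i assume "i \<in> {..<n}"
      then have i: "n dvd i + 1 \<longleftrightarrow> i = n - 1"
        using n_pos by (auto dest: dvd_imp_le)
      have E: "edg n = edg 0" "vtx n = vtx 0" "edg (n + 1) = edg 1" "b n = b 0"
        using per_b[of 0] n_ge_3 by (simp_all add: mod_Suc)
      have last: "indet (edg (i + 1)) * indet (vtx (i + 1)) * indet (edg (i + 2)) = ?u" "b (i + 1) = b 0"
        if "i = n - 1"
      proof -
        have "i + 1 = n" "i + 2 = n + 1" using that n_ge_3 by auto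
        then show "indet (edg (i + 1)) * indet (vtx (i + 1)) * indet (edg (i + 2)) = ?u" "b (i + 1) = b 0"
          by (simp_all only: E)
      qed
      have "q (i + 1) = a (i + 1) * ?ev (i + 1) - a i * ?ve (i + 1) - (if i = n - 1 then a0 * ?u else 0)"
        unfolding eq psi_def i using last(1)
        by (cases "i = n - 1") (simp_all only: simp_thms if_True if_False add.assoc one_add_one)
      then show "q (i + 1) *s b (i + 1) = (a (i + 1) * ?ev (i + 1)) *s b (i + 1) - (a i * ?ve (i + 1)) *s b (i + 1) -
        (if i = n - 1 then (a0 * ?u) *s b 0 else 0)"
        using last(2)
        by (cases "i = n - 1") (simp_all only: simp_thms if_True if_False scl_simps diff_0_right)
    qed simp
    also have "\<dots> = (\<Sum>i<n. (a (i + 1) * ?ev (i + 1)) *s b (i + 1)) - (\<Sum>i<n. (a i * ?ve (i + 1)) *s b (i + 1)) -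
        (a0 * ?u) *s b 0"
      by (simp add: sum_subtractf)
    also have "(\<Sum>i<n. (a (i + 1) * ?ev (i + 1)) *s b (i + 1)) = (\<Sum>i<n. (a i * ?ev i) *s b i)"
      by (rule sum_periodic_Suc) (simp add: a per_b)
    finally have qb: "(\<Sum>i<n. q i *s b i) =
      (\<Sum>i<n. (a i * ?ev i) *s b i) - (\<Sum>i<n. (a i * ?ve (i + 1)) *s b (i + 1)) - (a0 * ?u) *s b 0" .
    have "mu (kap1 a0 a) = q0 *s b0 +
      ((\<Sum>i<n. (a i * ?ev i) *s b i) - (\<Sum>i<n. (a i * ?ve (i + 1)) *s b (i + 1)) - (a0 * ?u) *s b 0)"
      by (simp add: kap1_def q0 mu_add mu_scl mu_sum f g scl_simps sum_subtractf)
    then show ?thesis by (simp only: kap0_def qb)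
  qed

  have "\<forall>c\<in>B1. \<exists>a0 a. a0 \<in> R \<and> (\<forall>i. a i \<in> R \<and> a (i + n) = a i \<and> lam0 (mu (unit_vec c)) (i + 1) = psi a0 a i)
      \<and> lam0h (mu (unit_vec c)) = a0 * (indet hub * indet hub)"
  proof
    fix c assume c: "c \<in> B1"
    let ?x = "mu (unit_vec c)"
    have x: "?x \<in> F0" using c by (simp add: mu_vecs)
    have "pi ?x = 0" using c by (simp add: complex)
    then have "lam0h ?x * monomial gen0 + (\<Sum>i<n. lam0 ?x i * monomial (gen i)) = 0"
      using pi_lam0[OF x] by simp
    from syzygies[OF this lam0_per] obtain a0 a where a: "\<And>i. a (i + n) = a i"
      "lam0h ?x = a0 * (indet hub * indet hub)" "\<And>i. lam0 ?x (i + 1) = psi a0 a i"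
      unfolding psi_def by blast
    \<comment> \<open>The coefficients supplied by \<open>syzygies\<close> may involve foreign
      variables. This retraction fixes the variables of \<open>X\<close> and commutes with
      \<open>psi\<close>, so it moves them into \<open>R\<close> and keeps the equations.\<close>
    define \<rho> where "\<rho> = (kill (- vars p) :: (Xvar, 'k) mpol \<Rightarrow> _)"
    have \<rho>: "\<rho> r \<in> R" "r \<in> R \<Longrightarrow> \<rho> r = r" "\<rho> (r * s) = \<rho> r * \<rho> s" "\<rho> (r - s) = \<rho> r - \<rho> s" "\<rho> 0 = 0" for r s
      by (simp_all add: \<rho>_def carrier_poly_ring_iff kill_kill kill_mult kill_diff)
    have "\<rho> (psi a0 a i) = psi (\<rho> a0) (\<rho> \<circ> a) i" for i
      by (simp add: psi_def \<rho>)
    then have "lam0 ?x (i + 1) = psi (\<rho> a0) (\<rho> \<circ> a) i" for i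
      using a(3)[of i] lam0_R(2)[OF x, of "i + 1"] \<rho>(2) by metis
    moreover have "lam0h ?x = \<rho> a0 * (indet hub * indet hub)"
      using a(2) lam0_R(1)[OF x] \<rho> indet_polys vars_mem by metis
    ultimately show "\<exists>a0 a. a0 \<in> R \<and> (\<forall>i. a i \<in> R \<and> a (i + n) = a i \<and> lam0 ?x (i + 1) = psi a0 a i)
      \<and> lam0h ?x = a0 * (indet hub * indet hub)"
      by (intro exI[of _ "\<rho> a0"] exI[of _ "\<rho> \<circ> a"]) (simp add: \<rho> a)
  qed
  from bchoice[OF this] obtain Q0 where
    "\<forall>c\<in>B1. \<exists>a. Q0 c \<in> R \<and> (\<forall>i. a i \<in> R \<and> a (i + n) = a i \<and> lam0 (mu (unit_vec c)) (i + 1) = psi (Q0 c) a i)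
      \<and> lam0h (mu (unit_vec c)) = Q0 c * (indet hub * indet hub)" ..
  from bchoice[OF this] obtain Q where
    "\<forall>c\<in>B1. Q0 c \<in> R \<and> (\<forall>i. Q c i \<in> R \<and> Q c (i + n) = Q c i \<and> lam0 (mu (unit_vec c)) (i + 1) = psi (Q0 c) (Q c) i)
      \<and> lam0h (mu (unit_vec c)) = Q0 c * (indet hub * indet hub)" ..
  then have Q: "\<And>c. c \<in> B1 \<Longrightarrow> Q0 c \<in> R" "\<And>c i. c \<in> B1 \<Longrightarrow> Q c i \<in> R"
    "\<And>c i. c \<in> B1 \<Longrightarrow> Q c (i + n) = Q c i"
    "\<And>c i. c \<in> B1 \<Longrightarrow> lam0 (mu (unit_vec c)) (i + 1) = psi (Q0 c) (Q c) i"
    "\<And>c. c \<in> B1 \<Longrightarrow> lam0h (mu (unit_vec c)) = Q0 c * (indet hub * indet hub)"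
    by blast+
  \<comment> \<open>the failure of \<open>kap1 \<circ> lam1\<close> to be the identity up to homotopy takes values in the kernel of \<open>mu\<close>\<close>
  define k where "k c = unit_vec c - kap1 (Q0 c) (Q c) - s0 (mu (unit_vec c))" for c
  have k: "k c \<in> ord_ge 1" if c: "c \<in> B1" for c
  proof (rule minimal)
    show "k c \<in> F1" using c Q by (simp add: k_def kap1_F1 s0_F1 mu_vecs)
    have "mu (kap1 (Q0 c) (Q c)) = kap0 (lam0h (mu (unit_vec c))) (lam0 (mu (unit_vec c)))"
      by (rule mu_kap1) (use Q c lam0_per in auto)
    then show "mu (k c) = 0"
      using decomp0[of "mu (unit_vec c)"] c by (simp add: k_def mu_diff mu_add mu_vecs algebra_simps)
  qed
  define lam1h where "lam1h y = (\<Sum>c\<in>B1. y c * Q0 c)" for y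
  define lam1 where "lam1 y i = (\<Sum>c\<in>B1. y c * Q c i)" for y and i :: nat
  have lam1_per: "lam1 y (i + n) = lam1 y i" for y i by (simp add: lam1_def Q)
  have mu_expand: "mu y = (\<Sum>c\<in>B1. y c *s mu (unit_vec c))" if "y \<in> F1" for y
  proof -
    have "mu y = mu (\<Sum>c\<in>B1. y c *s unit_vec c)" using vec_expand[OF that finite_B1] by simp
    then show ?thesis by (simp add: mu_sum mu_scl)
  qed
  have lam0_mu: "lam0 (mu y) (i + 1) = psi (lam1h y) (lam1 y) i"
      "lam0h (mu y) = lam1h y * (indet hub * indet hub)" if y: "y \<in> F1" for y i
  proof -
    have "lam0 (mu y) (i + 1) = (\<Sum>c\<in>B1. y c * lam0 (mu (unit_vec c)) (i + 1))"
      unfolding mu_expand[OF y]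
      by (subst additive_sum[of "\<lambda>x. lam0 x (i + 1)"]) (simp_all only: lam0_add lam0_scl)
    also have "\<dots> = (\<Sum>c\<in>B1. y c * psi (Q0 c) (Q c) i)" by (rule sum.cong) (simp_all only: Q)
    also have "\<dots> = psi (lam1h y) (lam1 y) i"
      by (simp add: psi_def lam1h_def lam1_def sum_distrib_right right_diff_distrib sum_subtractf mult.assoc if_distrib cong: if_cong)
    finally show "lam0 (mu y) (i + 1) = psi (lam1h y) (lam1 y) i" .
    have "lam0h (mu y) = (\<Sum>c\<in>B1. y c * lam0h (mu (unit_vec c)))"
      unfolding mu_expand[OF y]
      by (subst additive_sum[of lam0h]) (simp_all only: lam0_add lam0_scl)
    then show "lam0h (mu y) = lam1h y * (indet hub * indet hub)"
      by (simp add: Q lam1h_def sum_distrib_right mult.assoc)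
  qed
  have decomp1: "y = kap1 (lam1h y) (lam1 y) + s0 (mu y) + (\<Sum>c\<in>B1. y c *s k c)" if y: "y \<in> F1" for y
  proof -
    have s0_add: "s0 (x + x') = s0 x + s0 x'" for x x'
      by (simp add: s0_def scl_simps sum.distrib)
    have s0_scl: "s0 (r *s x) = r *s s0 x" for r x
      by (simp add: s0_def scl_sum scl_simps)
    have 1: "s0 (mu y) = (\<Sum>c\<in>B1. y c *s s0 (mu (unit_vec c)))"
      unfolding mu_expand[OF y] by (subst additive_sum[of s0]) (simp_all only: s0_add s0_scl)
    have "(\<Sum>i<n. lam1 y i *s f i) = (\<Sum>i<n. \<Sum>c\<in>B1. y c *s Q c i *s f i)"
      by (rule sum.cong) (auto simp: lam1_def scl_sum_left scl_simps)
    also have "\<dots> = (\<Sum>c\<in>B1. \<Sum>i<n. y c *s Q c i *s f i)" by (rule sum.swap)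
    finally have 2: "kap1 (lam1h y) (lam1 y) = (\<Sum>c\<in>B1. y c *s kap1 (Q0 c) (Q c))"
      by (simp add: kap1_def lam1h_def scl_sum_left scl_sum scl_simps sum.distrib)
    have "(\<Sum>c\<in>B1. y c *s k c) = (\<Sum>c\<in>B1. y c *s unit_vec c) - kap1 (lam1h y) (lam1 y) - s0 (mu y)"
      unfolding 1 2 k_def by (simp add: scl_simps sum_subtractf)
    then show ?thesis using vec_expand[OF y finite_B1] by simp
  qed

  define z where "z = (\<Sum>i<n. indet (edg (i + 1)) *s f i)"
  have z_F1: "z \<in> F1" by (simp add: z_def f)
  \<comment> \<open>On the kernel of \<open>mu\<close> the homotopy term drops out and
    \<open>lam1\<close> yields a multiple of \<open>z\<close>. The error is a sum of coordinates of
    order 1 times vectors \<open>k c\<close> of order 1, thus of order 2; replacing the multiplier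
    by its constant term costs another term of order 2.\<close>
  have kernel: "\<exists>c. \<zeta> - const_poly c *s z \<in> ord_ge 2" if \<zeta>: "\<zeta> \<in> F1" "mu \<zeta> = 0" for \<zeta>
  proof -
    have \<zeta>1: "\<zeta> \<in> ord_ge 1" by (rule minimal[OF \<zeta>])
    have [simp]: "lam0 0 i = 0" "lam0h 0 = 0" for i by (simp_all add: lam0_def lam0h_def)
    have "psi (lam1h \<zeta>) (lam1 \<zeta>) i = 0" "lam1h \<zeta> * (indet hub * indet hub) = 0" for i
      using lam0_mu[OF \<zeta>(1)] \<zeta>(2) by simp_all
    from second_syzygies[OF lam1_per this(2) this(1)[unfolded psi_def]]
    obtain c where c: "lam1h \<zeta> = 0" "\<And>i. lam1 \<zeta> i = c * indet (edg (i + 1))" by blast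
    have "s0 (mu \<zeta>) = 0" by (simp add: \<zeta> s0_def scl_simps)
    then have "\<zeta> = c *s z + (\<Sum>c\<in>B1. \<zeta> c *s k c)"
      using decomp1[OF \<zeta>(1)] by (simp add: kap1_def c z_def scl_sum scl_simps)
    then have "\<zeta> - const_poly (Poly_Mapping.lookup c 0) *s z =
        (c - const_poly (Poly_Mapping.lookup c 0)) *s z + (\<Sum>c\<in>B1. \<zeta> c *s k c)"
      by (simp add: scl_simps)
    moreover have "z \<in> ord_ge 1"
      unfolding z_def by (intro ord_ge_sum ord_ge_scl_deg) simp
    then have "(c - const_poly (Poly_Mapping.lookup c 0)) *s z \<in> ord_ge (1 + 1)"
      by (intro ord_ge_scl deg_ge_decomp)
    moreover have "(\<Sum>c\<in>B1. \<zeta> c *s k c) \<in> ord_ge (1 + 1)"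
      using \<zeta>1 k by (intro ord_ge_sum ord_ge_scl) (auto simp: ord_ge_def)
    ultimately show ?thesis by (intro exI[of _ "Poly_Mapping.lookup c 0"]) (simp add: ord_ge_add numeral_2_eq_2)
  qed

  \<comment> \<open>By degrees: \<open>psi\<close> raises the order by two, so if \<open>f 0\<close>
    had order 1, its boundary would have order 3 in explicit coordinates. But the coordinate at
    vertex 0 has the quadratic leading term \<open>e 0 * v 0\<close>.\<close>
  have f0: "f 0 \<notin> ord_ge 1"
  proof
    assume f0: "f 0 \<in> ord_ge 1"
    have two: "indet x * indet y \<in> deg_ge 2" for x y
      using deg_ge_mult[OF indet_deg_ge(1)[of x] indet_deg_ge(1)[of y]] by (simp add: numeral_2_eq_2)
    have psi_deg: "psi a0 a i \<in> deg_ge (l + 2)" if "a0 \<in> deg_ge l" "\<And>i. a i \<in> deg_ge l" for a0 a i l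
    proof -
      have 2: "r * (indet x * indet y) \<in> deg_ge (l + 2)" if "r \<in> deg_ge l" for r :: "(Xvar, 'k) mpol" and x y
        by (rule deg_ge_mult[OF that two])
      have 3: "r * (indet x * indet y * indet u) \<in> deg_ge (l + 2)" if "r \<in> deg_ge l" for r :: "(Xvar, 'k) mpol" and x y u
        using 2[OF deg_ge_mult_left[OF that, of "indet u"], of x y] by (simp only: mult_ac)
      show ?thesis
        unfolding psi_def by (cases "n dvd i + 1")
          (simp_all only: if_True if_False diff_0_right deg_ge_diff 2 3 that)
    qed
    \<comment> \<open>The coordinates of \<open>b j\<close> differ from a unit vector by a syzygy of
      the generators, and syzygies have coefficients of order 2.\<close>
    have lam0_b: "lam0 (b j) 0 - (if n dvd j then 1 else 0) \<in> deg_ge 2" for j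
    proof -
      define x where "x i = lam0 (b j) i - (if i mod n = j mod n then 1 else 0)" for i
      have "(\<Sum>i<n. (if i mod n = j mod n then 1 else 0) * monomial (gen i)) = 
         (\<Sum>i<n. if i = j mod n then monomial (gen j) else (0 :: (Xvar, 'k) mpol))"
        by (rule sum.cong) (auto simp: gen_def)
      also have "\<dots> = monomial (gen j)" by simp
      finally have "lam0h (b j) * monomial gen0 + (\<Sum>i<n. x i * monomial (gen i)) = 0"
        using pi_lam0[OF b(1)[of j]] by (simp add: x_def left_diff_distrib sum_subtractf b(2))
      moreover have "x (i + n) = x i" for i by (simp add: x_def lam0_per)
      ultimately obtain a0 a where "\<And>i. x (i + 1) = psi a0 a i"
        unfolding psi_def using syzygies by blast
      from this[of "n - 1"] have "x n \<in> deg_ge 2" using psi_deg[of a0 0 a "n - 1"] by (simp add: numeral_2_eq_2)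
      moreover have "x n = lam0 (b j) 0 - (if n dvd j then 1 else 0)"
        using lam0_per[of "b j" 0] by (auto simp: x_def dvd_eq_mod_eq_0)
      ultimately show ?thesis by simp
    qed
    have "\<not> n dvd 1" using n_ge_3 by auto
    with lam0_b[of 0] lam0_b[of 1] have l: "lam0 (b 0) 0 - 1 \<in> deg_ge 2" "lam0 (b 1) 0 \<in> deg_ge 2"
      by simp_all
    let ?ev = "indet (edg 0) * indet (vtx 0) :: (Xvar, 'k) mpol"
    let ?ve = "indet (vtx 1) * indet (edg 2) :: (Xvar, 'k) mpol"
    \<comment> \<open>Coordinate 0 is reached as the successor of \<open>n - 1\<close>, because
      \<open>psi\<close> computes coordinates at successors.\<close>
    have "lam0 (mu (f 0)) (n - 1 + 1) \<in> deg_ge (1 + 2)"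
      unfolding lam0_mu(1)[OF f(1)]
      by (rule psi_deg; unfold lam1h_def lam1_def; intro deg_ge_sum)
        (use f0 in \<open>simp_all add: ord_ge_def deg_ge_mult_right\<close>)
    then have "lam0 (mu (f 0)) 0 \<in> deg_ge 3"
      using lam0_per[of "mu (f 0)" 0] by (simp add: numeral_3_eq_3)
    moreover have "mu (f 0) = ?ev *s b 0 - ?ve *s b 1" using f(2)[of 0] by (simp add: numeral_2_eq_2)
    then have "lam0 (mu (f 0)) 0 = ?ev * lam0 (b 0) 0 - ?ve * lam0 (b 1) 0"
      by (simp add: lam0_diff lam0_scl)
    then have "?ev = lam0 (mu (f 0)) 0 - ?ev * (lam0 (b 0) 0 - 1) + ?ve * lam0 (b 1) 0"
      by (simp add: algebra_simps)
    moreover have "?ev * (lam0 (b 0) 0 - 1) \<in> deg_ge 3" "?ve * lam0 (b 1) 0 \<in> deg_ge 3"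
      by (rule deg_ge_mono[OF deg_ge_mult[OF two]], rule l, simp)+
    ultimately have "?ev \<in> deg_ge 3" by (metis deg_ge_add deg_ge_diff)
    then have "monomial (Poly_Mapping.single (edg 0) 1 + Poly_Mapping.single (vtx 0) 1) \<in> (deg_ge 3 :: (Xvar, 'k) mpol set)"
      by (simp add: indet_def monomial_add)
    then show False
      by (simp add: deg_ge_def monomial_def monomial_degree_add)
  qed

  \<comment> \<open>Both vectors are lifts of the generator at vertex \<open>i + 2\<close>, so they
    differ by a boundary.\<close>
  have "\<exists>t. t \<in> F1 \<and> mu t = T0 (b i) - b (i + 2)" for i
    using exact[of "T0 (b i) - b (i + 2)"] b T_gen[OF b, of i] T0_vecs[OF b(1)] by (auto simp: pi_diff)
  then obtain t where t: "\<And>i. t i \<in> F1" "\<And>i. mu (t i) = T0 (b i) - b (i + 2)" by metis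
  obtain t0 where t0: "t0 \<in> F1" "mu t0 = T0 b0 - b0"
    using exact[of "T0 b0 - b0"] b0 T_gen0[OF b0] T0_vecs[OF b0(1)] by (auto simp: pi_diff)
  have T0b: "T0 (b i) = b (i + 2) + mu (t i)" "T0 b0 = b0 + mu t0" for i
    by (simp_all add: t t0)
  \<comment> \<open>The boundaries of \<open>T1 (f i)\<close> and \<open>f (i + 2)\<close> differ by
    that of \<open>?t\<close>, which has order 1 since its coefficients are products of variables;
    the remaining discrepancy lies in the kernel of \<open>mu\<close>.\<close>
  have T1f: "T1 (f i) - f (i + 2) \<in> ord_ge 1" for i
  proof -
    let ?ev = "indet (edg (i + 2)) * indet (vtx (i + 2)) :: (Xvar, 'k) mpol"
    let ?ve = "indet (vtx (i + 3)) * indet (edg (i + 4)) :: (Xvar, 'k) mpol"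
    let ?t = "?ev *s t i - ?ve *s t (i + 1)"
    have "\<theta> (indet (vtx (i + 1)) * indet (edg (i + 2))) = ?ve"
      using \<theta>_ve[of "i + 1"] by (simp add: eval_nat_numeral)
    then have "T0 (mu (f i)) = ?ev *s T0 (b i) - ?ve *s T0 (b (i + 1))"
      unfolding f(2) using b by (simp add: T0_diff T0_scl \<theta>_ev)
    also have "\<dots> = mu (f (i + 2)) + mu ?t"
      by (simp add: T0b f(2) mu_diff mu_scl scl_simps eval_nat_numeral algebra_simps)
    finally have "mu (T1 (f i) - f (i + 2) - ?t) = 0"
      by (simp add: T_mu[symmetric] f(1) mu_diff)
    then have "T1 (f i) - f (i + 2) - ?t \<in> ord_ge 1"
      using f t by (intro minimal) (simp_all add: T1_vecs)
    moreover have "?t \<in> ord_ge 1"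
      by (intro ord_ge_diff ord_ge_scl_deg deg_ge_mult_left) simp_all
    ultimately show ?thesis using ord_ge_add by fastforce
  qed
  have T1ef: "T1 (indet (edg i) *s f j) - indet (edg (i + 2)) *s f (j + 2) \<in> ord_ge 2" for i j
  proof -
    have "T1 (indet (edg i) *s f j) - indet (edg (i + 2)) *s f (j + 2) =
        indet (edg (i + 2)) *s (T1 (f j) - f (j + 2))"
      using f by (simp add: T1_scl \<theta>_e scl_simps)
    moreover have "\<dots> \<in> ord_ge (1 + 1)" by (intro ord_ge_scl T1f) simp
    ultimately show ?thesis by (simp add: numeral_2_eq_2)
  qed
  have T1efs: "T1 (\<Sum>i<j. indet (edg (i + 1)) *s f i) - (\<Sum>i<j. indet (edg (i + 3)) *s f (i + 2)) \<in> ord_ge 2" for j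
  proof -
    have "T1 (\<Sum>i<j. indet (edg (i + 1)) *s f i) - (\<Sum>i<j. indet (edg (i + 3)) *s f (i + 2)) =
        (\<Sum>i<j. T1 (indet (edg (i + 1)) *s f i) - indet (edg (i + 1 + 2)) *s f (i + 2))"
      using f by (subst T1_sum) (simp_all add: sum_subtractf eval_nat_numeral)
    also have "\<dots> \<in> ord_ge 2" by (intro ord_ge_sum T1ef)
    finally show ?thesis .
  qed
  have ef_per: "indet (edg (i + n + 1)) *s f (i + n) = (indet (edg (i + 1)) *s f i :: _ \<Rightarrow> (Xvar, 'k) mpol)" for i
  proof -
    have "edg (i + n + 1) = edg (i + 1)" by (simp add: mod_Suc)
    then show ?thesis by (simp only: per_f)
  qed
  \<comment> \<open>Rotation by two only permutes the terms of a sum over a full period.\<close>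
  have T1z: "T1 z - z \<in> ord_ge 2"
  proof -
    define F where "F i = (indet (edg (i + 1)) *s f i :: _ \<Rightarrow> (Xvar, 'k) mpol)" for i
    have per_F: "F (i + n) = F i" for i unfolding F_def by (rule ef_per)
    have "(\<Sum>i<n. F (i + 1 + 1)) = (\<Sum>i<n. F (i + 1))"
      by (rule sum_periodic_Suc[of "\<lambda>i. F (i + 1)"]) (use per_F in \<open>metis add.assoc add.commute\<close>)
    also have "\<dots> = (\<Sum>i<n. F i)" by (rule sum_periodic_Suc) (rule per_F)
    finally have "(\<Sum>i<n. indet (edg (i + 3)) *s f (i + 2)) = z"
      by (simp add: F_def z_def eval_nat_numeral)
    then show ?thesis using T1efs[of n] by (simp add: z_def)
  qed

  \<comment> \<open>\<open>T1 g\<close> is anchored at vertex 2 instead of vertex 0. The boundary of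
    \<open>?s\<close> telescopes along the two edges in between and compensates for this;
    \<open>?t\<close>, which accounts for the choice of lifts, has coefficients of order 2. The rest
    is in the kernel of \<open>mu\<close>, where \<open>c\<close> comes from.\<close>
  have "\<exists>c. T1 g - (g + (\<Sum>i<2. indet (edg (i + 1)) *s f i) + const_poly c *s z) \<in> ord_ge 2"
  proof -
    let ?u0 = "indet (edg 0) * indet (vtx 0) * indet (edg 1) :: (Xvar, 'k) mpol"
    let ?u2 = "indet (edg 2) * indet (vtx 2) * indet (edg 3) :: (Xvar, 'k) mpol"
    let ?hh = "indet hub * indet hub :: (Xvar, 'k) mpol"
    let ?t = "?hh *s t0 - ?u2 *s t 0"
    let ?s = "\<Sum>i<2. indet (edg (i + 1)) *s f i"
    have "T0 (mu g) = ?hh *s T0 b0 - ?u2 *s T0 (b 0)"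
      using b b0 \<theta>_hh \<theta>_eve by (simp add: g T0_diff T0_scl del: One_nat_def)
    also have "\<dots> = ?hh *s b0 - ?u2 *s b 2 + mu ?t"
    proof -
      have "T0 (b 0) = b 2 + mu (t 0)" using T0b(1)[of 0] by (simp add: numeral_2_eq_2)
      then show ?thesis by (simp add: T0b(2) mu_diff mu_scl scl_simps algebra_simps)
    qed
    finally have "mu (T1 g) = ?hh *s b0 - ?u2 *s b 2 + mu ?t" unfolding T_mu[OF g(1)] .
    moreover have "mu ?s = ?u0 *s b 0 - ?u2 *s b 2"
    proof -
      have "?s = indet (edg 1) *s f 0 + indet (edg 2) *s f 1" by (simp add: numeral_2_eq_2)
      moreover have "mu (f 0) = (indet (edg 0) * indet (vtx 0)) *s b 0 - (indet (vtx 1) * indet (edg 2)) *s b 1"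
        "mu (f 1) = (indet (edg 1) * indet (vtx 1)) *s b 1 - (indet (vtx 2) * indet (edg 3)) *s b 2"
        using f(2)[of 0] f(2)[of 1] by (simp_all add: eval_nat_numeral)
      ultimately show ?thesis
        by (simp add: mu_add mu_scl scl_simps mult_ac del: One_nat_def)
    qed
    ultimately have "mu (T1 g - g - ?s - ?t) = 0"
      by (simp add: mu_diff g)
    moreover have "T1 g - g - ?s - ?t \<in> F1"
      using g f t t0 by (simp add: T1_vecs)
    ultimately obtain c where "T1 g - g - ?s - ?t - const_poly c *s z \<in> ord_ge 2"
      using kernel by blast
    moreover have "?t \<in> ord_ge 2"
    proof (intro ord_ge_diff ord_ge_scl_deg)
      show "?hh \<in> deg_ge 2"
        using deg_ge_mult[OF indet_deg_ge(1) indet_deg_ge(1), of hub hub] by (simp add: numeral_2_eq_2)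
      show "?u2 \<in> deg_ge 2"
        unfolding mult.assoc
        using deg_ge_mult_left[OF deg_ge_mult[OF indet_deg_ge(1) indet_deg_ge(1), of "vtx 2" "edg 3"], of "indet (edg 2)"]
        by (simp add: numeral_2_eq_2)
    qed
    ultimately have "T1 g - g - ?s - ?t - const_poly c *s z + ?t \<in> ord_ge 2" by (rule ord_ge_add)
    then show ?thesis by (intro exI[of _ c]) (simp add: algebra_simps)
  qed
  then obtain c where Tg: "T1 g - (g + (\<Sum>i<2. indet (edg (i + 1)) *s f i) + const_poly c *s z) \<in> ord_ge 2"
    by blast
  \<comment> \<open>The constants simply add up because \<open>\<theta>\<close> fixes constants and
    \<open>T1\<close> fixes \<open>z\<close> modulo order 2.\<close>
  have iter: "(T1 ^^ j) g \<in> F1 \<and> (T1 ^^ j) g -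
     (g + (\<Sum>i<2 * j. indet (edg (i + 1)) *s f i) + const_poly (of_nat j * c) *s z) \<in> ord_ge 2" for j
  proof (induction j)
    case 0
    show ?case using g by (simp add: ord_ge_def const_poly_def)
  next
    case (Suc j)
    let ?S = "\<lambda>j. \<Sum>i<j. indet (edg (i + 1)) *s f i"
    let ?a = "(T1 ^^ j) g" and ?c = "const_poly (of_nat j * c) :: (Xvar, 'k) mpol"
    let ?b = "g + ?S (2 * j) + ?c *s z"
    have a: "?a \<in> F1" "?a - ?b \<in> ord_ge 2" using Suc.IH by blast+
    have b: "?b \<in> F1" using f g z_F1 by simp
    have "T1 (?a - ?b) \<in> ord_ge 2"
      by (rule T1_ord_ge) (use a b in \<open>simp_all del: One_nat_def\<close>)
    moreover have "T1 ?a = T1 (?a - ?b) + T1 ?b"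
      using T1_add[of "?a - ?b" ?b] a b by simp
    moreover have "T1 ?b = T1 g + T1 (?S (2 * j)) + ?c *s T1 z"
      using f g z_F1 by (simp add: T1_add T1_scl \<theta>_const)
    moreover have "(\<Sum>i<2. indet (edg (i + 1)) *s f i) + (\<Sum>i<2 * j. indet (edg (i + 3)) *s f (i + 2)) = ?S (2 * Suc j)"
      using sum_shift_two[of "\<lambda>i. indet (edg (i + 1)) *s f i" j] by (simp add: eval_nat_numeral)
    moreover have "const_poly (of_nat (Suc j) * c) = ?c + const_poly c"
      by (simp add: const_poly_def single_add[symmetric] algebra_simps)
    ultimately have "T1 ?a - (g + ?S (2 * Suc j) + const_poly (of_nat (Suc j) * c) *s z) =
       T1 (?a - ?b) + (T1 g - (g + ?S 2 + const_poly c *s z)) +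
       (T1 (?S (2 * j)) - (\<Sum>i<2 * j. indet (edg (i + 3)) *s f (i + 2))) + ?c *s (T1 z - z)"
      by (simp add: scl_simps algebra_simps)
    moreover have "\<dots> \<in> ord_ge 2"
      using \<open>T1 (?a - ?b) \<in> ord_ge 2\<close> Tg T1efs[of "2 * j"] ord_ge_scl_left[OF T1z, of ?c]
      by (intro ord_ge_add) simp_all
    ultimately show ?case unfolding funpow.simps o_apply using T1_vecs[OF a(1)] by metis
  qed
  \<comment> \<open>The characteristic removes the unknown constant after \<open>p\<close>
    rounds.\<close>
  have "const_poly (of_nat p * c) = (0 :: (Xvar, 'k) mpol)"
    using of_nat_CHAR[where 'a = 'k] by (simp add: char const_poly_def)
  then have "g - (g + (\<Sum>i<2 * p. indet (edg (i + 1)) *s f i)) \<in> ord_ge 2"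
    using iter[of p] T1_order[OF g(1)] by (simp add: scl_simps)
  then have S0: "0 - (\<Sum>i<2 * p. indet (edg (i + 1)) *s f i) \<in> ord_ge 2" by simp
  \<comment> \<open>The \<open>2 * p\<close> edges make \<open>l\<close> full turns: one for
    \<open>p = 2\<close>, where \<open>n = 4\<close>, and two for odd \<open>p\<close>, where
    \<open>n = p\<close>.\<close>
  obtain l where l: "2 * p = l * n" "of_nat l \<noteq> (0 :: 'k)"
  proof (cases "p = 2")
    case True
    then have "n = 4" unfolding n_def by (simp add: cycle_length_def)
    with True show ?thesis by (intro that[of 1]) simp_all
  next
    case False
    then have "\<not> p dvd 2" using prime_p by (metis primes_dvd_imp_eq two_is_prime_nat)
    then have "of_nat 2 \<noteq> (0 :: 'k)" unfolding of_nat_eq_0_iff_char_dvd char .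
    moreover have "n = p" using False unfolding n_def by (simp add: cycle_length_def)
    ultimately show ?thesis by (intro that[of 2]) simp_all
  qed
  \<comment> \<open>Order 2 leaves no linear terms, so the coefficient at \<open>edg 1\<close>
    vanishes. This variable occurs once in each turn, together with \<open>f 0\<close>, which gives
    \<open>l\<close> times the constant term of \<open>f 0 d\<close>.\<close>
  have "Poly_Mapping.lookup (f 0 d) 0 = 0" for d
  proof -
    let ?y = "Poly_Mapping.single (edg 1) (1 :: nat)"
    have *: "Poly_Mapping.lookup ((indet (edg (i + 1)) *s f i) d) ?y =
       (if n dvd i then Poly_Mapping.lookup (f 0 d) 0 else 0)" for i
    proof -
      have "edg (i + 1) = edg 1 \<longleftrightarrow> n dvd i"
        using n_ge_3 by (auto simp: mod_Suc dvd_eq_mod_eq_0 split: if_splits)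
      moreover have "n dvd i \<Longrightarrow> f i = f 0"
        using periodic_mod[of f, OF per_f, of i] by (simp add: dvd_eq_mod_eq_0)
      ultimately show ?thesis by (auto simp: lookup_indet_times_single simp del: edg_eq_iff One_nat_def)
    qed
    have "(\<Sum>i<l * n. if n dvd i then x else (0 :: 'k)) = of_nat l * x" for x
    proof (induction l)
      case (Suc l)
      have "(\<Sum>i<Suc l * n. if n dvd i then x else 0) =
         (\<Sum>i<l * n. if n dvd i then x else 0) + (\<Sum>i<n. if n dvd l * n + i then x else 0)"
        using sum.atLeastLessThan_concat[of 0 "l * n" "Suc l * n" "\<lambda>i. if n dvd i then x else 0"]
          sum.shift_bounds_nat_ivl[of "\<lambda>i. if n dvd i then x else 0" 0 "l * n" n]
        by (simp add: lessThan_atLeast0 add.commute)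
      also have "(\<Sum>i<n. if n dvd l * n + i then x else 0) = (\<Sum>i<n. if i = 0 then x else 0)"
        by (rule sum.cong) (auto dest: dvd_imp_le)
      finally show ?case using Suc by (simp add: algebra_simps)
    qed simp
    moreover have "Poly_Mapping.lookup ((0 - (\<Sum>i<2 * p. indet (edg (i + 1)) *s f i)) d) ?y = 0"
      using S0 by (intro deg_ge_lookup[of _ 2]) (simp_all add: ord_ge_def)
    then have "(\<Sum>i<l * n. Poly_Mapping.lookup ((indet (edg (i + 1)) *s f i) d) ?y) = 0"
      unfolding l(1) by (simp add: sum_fun_apply lookup_sum)
    ultimately show ?thesis using l(2) by (simp only: *) simp
  qed
  then have "f 0 \<in> ord_ge 1"
    using deg_ge_decomp[of "f 0 d" for d] by (simp add: ord_ge_def const_poly_def)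
  with f0 show False ..
qed

end

section \<open>Automorphisms of algebraic extensions of prime fields commute\<close>

text \<open>Frobenius fixes the coefficients of \<open>q\<close>, hence maps roots of
  \<open>q\<close> to roots. The finitely many roots force the orbit of \<open>x\<close> to repeat,
  and injectivity of Frobenius brings the repetition back to \<open>x\<close>.\<close>

lemma algebraic_over_prime_field_frobenius_period:
  fixes x :: "'k::field"
  assumes alg: "algebraic_over_prime_field x" and prime: "prime CHAR('k)"
  shows "\<exists>d>0. x ^ (CHAR('k) ^ d) = x"
proof -
  let ?p = "CHAR('k)"
  have add: "(y + z) ^ (?p ^ i) = y ^ (?p ^ i) + z ^ (?p ^ i)" for y z :: 'k and i
    by (rule freshmans_dream'[OF prime refl])
  have p_pos: "0 < ?p" using prime prime_gt_0_nat by blast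
  have inj: "y = z" if "y ^ (?p ^ i) = z ^ (?p ^ i)" for y z :: 'k and i
  proof -
    have "(y - z) ^ (?p ^ i) = 0" using add[of "y - z" z i] that by simp
    then show ?thesis by simp
  qed
  have frob_int: "(of_int c :: 'k) ^ ?p = of_int c" for c
  proof (induction c rule: int_induct[of _ 0])
    case (step1 c)
    then show ?case using add[of "of_int c" 1 1] by simp
  next
    case (step2 c)
    then have "of_int c = (of_int (c - 1) :: 'k) ^ ?p + 1" using add[of "of_int (c - 1)" 1 1] by simp
    then have "(of_int (c - 1) :: 'k) ^ ?p = of_int c - 1" by (metis add_diff_cancel_right')
    then show ?case by simp
  qed (use p_pos in simp)
  obtain q where q: "q \<noteq> 0" "\<And>i. Polynomial.coeff q i \<in> \<int>" "Polynomial.poly q x = 0"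
    using alg by (auto simp: algebraic_over_prime_field_def)
  have coeff: "Polynomial.coeff q i ^ ?p = Polynomial.coeff q i" for i
    using q(2)[of i] frob_int by (auto simp: Ints_def)
  have root: "Polynomial.poly q (x ^ (?p ^ i)) = 0" for i
  proof (induction i)
    case (Suc i)
    let ?y = "x ^ (?p ^ i)"
    have "Polynomial.poly q (?y ^ ?p) = (\<Sum>i\<le>Polynomial.degree q. (Polynomial.coeff q i * ?y ^ i) ^ ?p)"
      unfolding poly_altdef
      by (rule sum.cong) (simp_all add: power_mult_distrib coeff, simp add: power_mult[symmetric] mult_ac)
    also have "\<dots> = (Polynomial.poly q ?y) ^ ?p"
      unfolding poly_altdef by (rule freshmans_dream_sum[OF prime refl, symmetric])
    also have "\<dots> = 0" using Suc p_pos by simp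
    finally show ?case by (simp add: power_mult[symmetric] mult.commute)
  qed (use q in simp)
  have "range (\<lambda>i. x ^ (?p ^ i)) \<subseteq> {y. Polynomial.poly q y = 0}" using root by auto
  then have "finite (range (\<lambda>i. x ^ (?p ^ i)))" using poly_roots_finite[OF q(1)] finite_subset by blast
  then have "\<not> inj (\<lambda>i. x ^ (?p ^ i))" using range_inj_infinite by blast
  then obtain i j where ij: "i < j" "x ^ (?p ^ i) = x ^ (?p ^ j)"
    unfolding inj_def by (metis linorder_neqE_nat)
  have "?p ^ j = ?p ^ (j - i) * ?p ^ i" using ij by (simp add: power_add[symmetric])
  then have "(x ^ (?p ^ (j - i))) ^ (?p ^ i) = x ^ (?p ^ i)" using ij by (simp add: power_mult)
  then have "x ^ (?p ^ (j - i)) = x" by (rule inj)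
  then show ?thesis using ij by (intro exI[of _ "j - i"]) simp
qed

text \<open>
  Both automorphisms act on the cyclic unit group of a finite subfield by raising to a power.
\<close>

lemma field_automorphisms_commute:
  fixes f g :: "'k::field \<Rightarrow> 'k"
  assumes alg: "\<forall>x::'k. algebraic_over_prime_field x" and prime: "prime CHAR('k)"
    and f: "f \<in> carrier field_automorphisms" and g: "g \<in> carrier field_automorphisms"
  shows "f (g x) = g (f x)"
proof -
  have hom: "h (y * z) = h y * h z" "h 1 = 1" "h 0 = 0" "h (y ^ i) = h y ^ i"
    if "h \<in> carrier field_automorphisms" for h :: "'k \<Rightarrow> 'k" and y z i
  proof -
    show *: "h (y * z) = h y * h z" "h 1 = 1" for y z
      using that by (auto simp: field_automorphisms_def)
    show "h 0 = 0"
      using that by (simp add: field_automorphisms_def)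
    show "h (y ^ i) = h y ^ i" by (induction i) (simp_all add: *)
  qed
  obtain d where d: "d > 0" "x ^ (CHAR('k) ^ d) = x"
    using algebraic_over_prime_field_frobenius_period alg prime by blast
  define q where "q = CHAR('k) ^ d"
  have q2: "q \<ge> 2"
    unfolding q_def using prime_ge_2_nat[OF prime] power_increasing[of 1 d "CHAR('k)"] d(1) by simp
  \<comment> \<open>The fixed points of the \<open>q\<close>-th power map form a subfield containing
    \<open>x\<close> by the choice of \<open>d\<close>, and they are the roots of a polynomial of
    degree \<open>q\<close>, hence finite in number.\<close>
  define K where "K = {y :: 'k. y ^ q = y}"
  define F :: "'k ring" where "F = \<lparr>carrier = K, mult = (*), one = 1, zero = 0, add = (+)\<rparr>"
  have add: "y + z \<in> K" if "y \<in> K" "z \<in> K" for y z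
    using that freshmans_dream'[OF prime q_def, of y z] by (simp add: K_def)
  \<comment> \<open>Additivity of the \<open>q\<close>-th power settles the sign for even and odd
    \<open>q\<close> alike.\<close>
  have minus: "- y \<in> K" if "y \<in> K" for y
    using that freshmans_dream'[OF prime q_def, of y "- y"] q2
    by (simp add: K_def eq_neg_iff_add_eq_0 add.commute power_0_left)
  have ring: "cring F"
  proof (rule cringI)
    show "abelian_group F"
    proof (rule abelian_groupI)
      fix y assume "y \<in> carrier F"
      then show "\<exists>z\<in>carrier F. z \<oplus>\<^bsub>F\<^esub> y = \<zero>\<^bsub>F\<^esub>"
        using minus by (intro bexI[of _ "- y"]) (auto simp: F_def)
    qed (use add q2 in \<open>auto simp: F_def K_def algebra_simps\<close>)
    show "Group.comm_monoid F"
      by (rule comm_monoidI) (auto simp: F_def K_def algebra_simps power_mult_distrib)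
  qed (auto simp: F_def algebra_simps)
  have "field F"
  proof (rule cring.cring_fieldI[OF ring])
    show "Units F = carrier F - {\<zero>\<^bsub>F\<^esub>}"
    proof
      show "Units F \<subseteq> carrier F - {\<zero>\<^bsub>F\<^esub>}" by (auto simp: Units_def F_def)
      show "carrier F - {\<zero>\<^bsub>F\<^esub>} \<subseteq> Units F"
      proof
        fix y assume "y \<in> carrier F - {\<zero>\<^bsub>F\<^esub>}"
        then show "y \<in> Units F"
          unfolding Units_def
          by (auto simp: F_def K_def power_inverse intro!: exI[of _ "inverse y"])
      qed
    qed
  qed
  moreover have "finite K"
  proof -
    let ?P = "Polynomial.monom 1 q - Polynomial.monom 1 1 :: 'k poly"
    have "Polynomial.coeff ?P q = 1" using q2 by simp
    then have "?P \<noteq> 0" by (metis coeff_0 zero_neq_one)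
    moreover have "K = {y. Polynomial.poly ?P y = 0}" by (auto simp: K_def poly_monom)
    ultimately show ?thesis using poly_roots_finite by metis
  qed
  ultimately obtain u where u: "u \<in> K" "u \<noteq> 0" "K - {0} = {u [^]\<^bsub>F\<^esub> i | i::nat. i \<in> UNIV}"
    using field.finite_field_mult_group_has_gen[of F] by (auto simp: F_def)
  have pow: "u [^]\<^bsub>F\<^esub> i = u ^ i" for i :: nat
    by (induction i) (simp_all add: F_def nat_pow_def mult.commute)
  have K: "\<exists>i. y = u ^ i" if "y \<in> K" "y \<noteq> 0" for y
    using u(3) that unfolding pow by blast
  have h_u: "\<exists>i. h u = u ^ i" if h: "h \<in> carrier field_automorphisms" for h :: "'k \<Rightarrow> 'k"
  proof (rule K)
    show "h u \<in> K" using u(1) hom(4)[OF h, of u q] by (simp add: K_def)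
    have "inj h" using h by (simp add: field_automorphisms_def bij_def)
    then have "h u \<noteq> h 0" using u(2) by (metis injD)
    then show "h u \<noteq> 0" using hom(3)[OF h] by simp
  qed
  obtain i j where ij: "f u = u ^ i" "g u = u ^ j" using h_u f g by blast
  show ?thesis
  proof (cases "x = 0")
    case True
    then show ?thesis by (simp add: hom(3)[OF f] hom(3)[OF g])
  next
    case False
    then obtain l where "x = u ^ l" using K d(2) by (auto simp: K_def q_def)
    then show ?thesis
      by (simp add: hom(4)[OF f] hom(4)[OF g] ij) (simp add: power_mult[symmetric] mult.commute mult.left_commute)
  qed
qed


text \<open>Since \<open>f\<close> and \<open>g\<close> commute, \<open>t\<close> fixes the image of
  \<open>g \<circ> f\<close>, which is everything.\<close>

lemma field_automorphism_commutator_trivial: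
  fixes f g t :: "'k::field \<Rightarrow> 'k"
  assumes "\<forall>x::'k. algebraic_over_prime_field x" "prime CHAR('k)"
    and fg: "f \<in> carrier field_automorphisms" "g \<in> carrier field_automorphisms"
    and eq: "f \<circ> g = t \<circ> (g \<circ> f)"
  shows "t = id"
proof
  fix x
  have "surj (g \<circ> f)" using fg unfolding field_automorphisms_def bij_def by (intro comp_surj) auto
  then obtain y where y: "x = g (f y)" by (metis comp_apply surjD)
  then show "t x = id x"
    using fun_cong[OF eq, of y] field_automorphisms_commute[OF assms(1-4), of y] by simp
qed

section \<open>Symmetries of the ideal\<close>

text \<open>\<open>map_key q\<close> composes exponent functions with \<open>q\<close>, so it moves
  monomials by the inverse permutation. An inclusion is enough for the generators: on a finite set
  it becomes an equality.\<close>

definition symmetry :: "'x set \<Rightarrow> 'x monom set \<Rightarrow> ('x \<Rightarrow> 'x) \<Rightarrow> bool" where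
  "symmetry X A q \<longleftrightarrow> bij q \<and> q -` X = X \<and> Poly_Mapping.map_key q ` A \<subseteq> A"

text \<open>Restricted to the carrier, as elements of the automorphism group are
  extensional.\<close>

definition induced_aut :: "'x set \<Rightarrow> ('x \<Rightarrow> 'x) \<Rightarrow> 'x monom \<Rightarrow> 'x monom" where
  "induced_aut X q = (\<lambda>a\<in>carrier (monomial_monoid X). Poly_Mapping.map_key q a)"

lemma lookup_map_key: "inj q \<Longrightarrow> Poly_Mapping.lookup (Poly_Mapping.map_key q a) y = Poly_Mapping.lookup a (q y)"
  by (simp add: map_key.rep_eq)

lemma symmetry_comp: "symmetry X A q \<Longrightarrow> symmetry X A q' \<Longrightarrow> symmetry X A (q \<circ> q')"
proof -
  assume q: "symmetry X A q" and q': "symmetry X A q'"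
  then have "inj q" "inj q'" by (auto simp: symmetry_def bij_def)
  then have "Poly_Mapping.map_key (q \<circ> q') a = Poly_Mapping.map_key q' (Poly_Mapping.map_key q a)"
    for a :: "'a monom" by (simp add: map_key_compose)
  moreover have "(q \<circ> q') -` X = X"
    using q q' by (metis symmetry_def vimage_comp)
  moreover have "Poly_Mapping.map_key q' (Poly_Mapping.map_key q a) \<in> A" if "a \<in> A" for a
    using q q' that unfolding symmetry_def by (meson image_subset_iff)
  ultimately show ?thesis
    using q q' unfolding symmetry_def by (auto simp: bij_comp)
qed

lemma map_key_carrier:
  assumes "symmetry X A q" "a \<in> carrier (monomial_monoid X)"
  shows "Poly_Mapping.map_key q a \<in> carrier (monomial_monoid X)"
proof -
  have "inj q" using assms by (auto simp: symmetry_def bij_def)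
  then have "Poly_Mapping.keys (Poly_Mapping.map_key q a) \<subseteq> q -` X"
    using assms(2) by (auto simp: keys_map_key monomial_monoid_def)
  then show ?thesis using assms(1) by (simp add: symmetry_def monomial_monoid_def)
qed

lemma inj_map_key: "bij q \<Longrightarrow> inj (Poly_Mapping.map_key q :: 'x monom \<Rightarrow> 'x monom)"
proof (rule injI)
  fix a b :: "'x monom"
  assume q: "bij q" and eq: "Poly_Mapping.map_key q a = Poly_Mapping.map_key q b"
  then have "Poly_Mapping.lookup a (q y) = Poly_Mapping.lookup b (q y)" for y
    by (metis bij_is_inj lookup_map_key)
  then show "a = b" by (metis q bij_pointE poly_mapping_eqI)
qed

text \<open>An injective self-map of the finite set \<open>A\<close> is onto, so the inverse
  permutation preserves \<open>A\<close> as well.\<close>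

lemma symmetry_inv:
  assumes q: "symmetry X A q" and A: "finite A"
  shows "symmetry X A (inv_into UNIV q)"
proof -
  have b: "bij q" "bij (inv_into UNIV q)" using q by (auto simp: symmetry_def bij_imp_bij_inv)
  have "Poly_Mapping.map_key q ` A = A"
    using q A by (intro endo_inj_surj) (auto simp: symmetry_def intro: inj_on_subset[OF inj_map_key])
  moreover have "Poly_Mapping.map_key (inv_into UNIV q) (Poly_Mapping.map_key q a) = a" for a :: "'a monom"
    using b by (simp add: map_key_compose bij_is_inj bij_is_surj surj_iff[THEN iffD1] comp_def map_key_id surj_f_inv_f)
  ultimately have "Poly_Mapping.map_key (inv_into UNIV q) ` A \<subseteq> A" by (metis (no_types, lifting) imageE image_subsetI)
  moreover have "inv_into UNIV q -` X = X"
    using q b(1) by (auto simp: symmetry_def) (metis bij_inv_eq_iff vimageD vimageI)+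
  ultimately show ?thesis using b by (simp add: symmetry_def)
qed

lemma monoid_ideal_hull_eq:
  assumes "A \<subseteq> carrier (monomial_monoid X)"
  shows "monoid_ideal (monomial_monoid X) hull A = {b + a |a b. a \<in> A \<and> b \<in> carrier (monomial_monoid X)}"
proof (rule hull_unique)
  show "A \<subseteq> {b + a |a b. a \<in> A \<and> b \<in> carrier (monomial_monoid X)}"
  proof
    fix a assume "a \<in> A"
    then show "a \<in> {b + a |a b. a \<in> A \<and> b \<in> carrier (monomial_monoid X)}"
      by (intro CollectI exI[of _ a] exI[of _ 0]) (simp add: monomial_monoid_def)
  qed
  show "monoid_ideal (monomial_monoid X) {b + a |a b. a \<in> A \<and> b \<in> carrier (monomial_monoid X)}"
    unfolding monoid_ideal_def
  proof (intro conjI ballI)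
    show "{b + a |a b. a \<in> A \<and> b \<in> carrier (monomial_monoid X)} \<subseteq> carrier (monomial_monoid X)"
      using assms by (fastforce simp: monomial_monoid_def keys_add_nat)
    fix c d assume c: "c \<in> carrier (monomial_monoid X)" and "d \<in> {b + a |a b. a \<in> A \<and> b \<in> carrier (monomial_monoid X)}"
    then obtain a b where "d = b + a" "a \<in> A" "b \<in> carrier (monomial_monoid X)" by blast
    moreover from this c have "c + b \<in> carrier (monomial_monoid X)" by (auto simp: monomial_monoid_def keys_add_nat)
    ultimately have "c + d \<in> {b + a |a b. a \<in> A \<and> b \<in> carrier (monomial_monoid X)}"
      by (intro CollectI exI[of _ a] exI[of _ "c + b"]) (simp add: add_ac)
    then show "c \<otimes>\<^bsub>monomial_monoid X\<^esub> d \<in> {b + a |a b. a \<in> A \<and> b \<in> carrier (monomial_monoid X)}"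
      "d \<otimes>\<^bsub>monomial_monoid X\<^esub> c \<in> {b + a |a b. a \<in> A \<and> b \<in> carrier (monomial_monoid X)}"
      by (simp_all add: monomial_monoid_def add.commute)
  qed
  fix J assume "A \<subseteq> J" "monoid_ideal (monomial_monoid X) J"
  then show "{b + a |a b. a \<in> A \<and> b \<in> carrier (monomial_monoid X)} \<subseteq> J"
    by (auto simp: monoid_ideal_def monomial_monoid_def)
qed

lemma induced_aut_in_ideal_automorphisms:
  assumes q: "symmetry X A q" and A: "finite A" "A \<subseteq> carrier (monomial_monoid X)"
  shows "induced_aut X q \<in> carrier (ideal_automorphisms (monomial_monoid X) (monoid_ideal (monomial_monoid X) hull A))"
proof -
  let ?M = "monomial_monoid X" and ?I = "monoid_ideal (monomial_monoid X) hull A"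
  have q': "symmetry X A (inv_into UNIV q)" by (rule symmetry_inv[OF q A(1)])
  have inj: "inj q" "inj (inv_into UNIV q)" using q q' by (auto simp: symmetry_def bij_def)
  have inv: "Poly_Mapping.map_key q (Poly_Mapping.map_key (inv_into UNIV q) a) = a"
    "Poly_Mapping.map_key (inv_into UNIV q) (Poly_Mapping.map_key q a) = a" for a :: "'a monom"
    using q inj by (simp_all add: map_key_compose comp_def map_key_id surj_f_inv_f symmetry_def bij_is_surj)
  have I_sub: "?I \<subseteq> carrier ?M"
    using A(2) unfolding monoid_ideal_hull_eq[OF A(2)] by (fastforce simp: monomial_monoid_def keys_add_nat)
  have I: "Poly_Mapping.map_key r a \<in> ?I" if "symmetry X A r" "a \<in> ?I" for r a
  proof -
    have "inj r" using that(1) by (auto simp: symmetry_def bij_def)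
    with that show ?thesis
      unfolding monoid_ideal_hull_eq[OF A(2)]
      using map_key_carrier[OF that(1)] by (fastforce simp: map_key_plus symmetry_def)
  qed
  have "induced_aut X q \<in> Bij (carrier ?M)"
    unfolding Bij_def induced_aut_def
    using map_key_carrier[OF q] map_key_carrier[OF q'] inv
    by (auto intro!: bij_betw_byWitness[where f' = "Poly_Mapping.map_key (inv_into UNIV q)"])
  moreover have "induced_aut X q \<in> hom ?M ?M"
    using map_key_carrier[OF q] inj
    by (auto simp: hom_def induced_aut_def map_key_plus monomial_monoid_def keys_add_nat)
  moreover have "induced_aut X q ` ?I = ?I"
  proof
    show "induced_aut X q ` ?I \<subseteq> ?I"
      using I[OF q] I_sub by (auto simp: induced_aut_def)
    show "?I \<subseteq> induced_aut X q ` ?I"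
    proof
      fix a assume a: "a \<in> ?I"
      have "a = induced_aut X q (Poly_Mapping.map_key (inv_into UNIV q) a)"
        using I[OF q' a] I_sub by (auto simp: induced_aut_def inv)
      then show "a \<in> induced_aut X q ` ?I" using I[OF q' a] by blast
    qed
  qed
  ultimately show ?thesis by (simp add: ideal_automorphisms_def auto_def)
qed

text \<open>The order is reversed because \<open>map_key\<close> composes on the right.\<close>

lemma induced_aut_mult:
  assumes q: "symmetry X A q" and q': "symmetry X A q'" and A: "finite A" "A \<subseteq> carrier (monomial_monoid X)"
  shows "induced_aut X q \<otimes>\<^bsub>ideal_automorphisms (monomial_monoid X) I\<^esub> induced_aut X q' = induced_aut X (q' \<circ> q)"
proof -
  have "induced_aut X r \<in> Bij (carrier (monomial_monoid X))" if "symmetry X A r" for r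
    using induced_aut_in_ideal_automorphisms[OF that A] by (simp add: ideal_automorphisms_def auto_def)
  moreover have "inj q" "inj q'" using q q' by (auto simp: symmetry_def bij_def)
  ultimately show ?thesis
    using q q' map_key_carrier[OF q']
    by (auto simp: ideal_automorphisms_def AutoGroup_def BijGroup_def compose_def induced_aut_def map_key_compose fun_eq_iff)
qed

lemma mod_add_cancel_right: "(a + c) mod n = (b + c) mod n \<longleftrightarrow> a mod n = b mod (n :: nat)"
proof -
  have "int ((a + c) mod n) = int ((b + c) mod n) \<longleftrightarrow> int (a mod n) = int (b mod n)"
    unfolding zmod_int mod_eq_dvd_iff by simp
  then show ?thesis by simp
qed

section \<open>The dihedral symmetries of the cycle\<close>

context prime_ideal_data
begin

abbreviation gens :: "Xvar monom set" where "gens \<equiv> insert gen0 (range gen)"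

lemma gens_eq: "ideal_generator p ` {0..n} = gens"
proof
  show "ideal_generator p ` {0..n} \<subseteq> gens"
  proof
    fix a assume "a \<in> ideal_generator p ` {0..n}"
    then obtain i where i: "a = ideal_generator p i" "i \<le> n" by auto
    show "a \<in> gens"
    proof (cases i)
      case (Suc j)
      then have "a = gen j" using i by (simp add: gen_def)
      then show ?thesis by blast
    qed (use i in simp)
  qed
  have "i mod n + 1 \<in> {0..n}" for i using mod_less_divisor[OF n_pos, of i] by (simp add: Suc_leI)
  then have "gen i \<in> ideal_generator p ` {0..n}" for i unfolding gen_def by blast
  then show "gens \<subseteq> ideal_generator p ` {0..n}" by auto
qed

lemma ideal_of_prime_eq: "ideal_of_prime p = monoid_ideal (monomial_monoid (vars p)) hull gens"
  unfolding ideal_of_prime_def gens_eq[symmetric] n_def ..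

lemma finite_gens: "finite gens"
  unfolding gens_eq[symmetric] by simp

lemma gens_carrier: "gens \<subseteq> carrier (monomial_monoid (vars p))"
  by (auto simp: monomial_monoid_def in_keys_iff lookup_gen lookup_gen0 split: if_splits)

lemma Xvar_cases:
  obtains (vtx) i where "y = vtx i" | (edg) i where "y = edg i" | (other) "y \<notin> range vtx" "y \<notin> range edg"
  by blast

definition respects_mod :: "(nat \<Rightarrow> nat) \<Rightarrow> bool" where
  "respects_mod f \<longleftrightarrow> (\<forall>i j. i mod n = j mod n \<longrightarrow> f i mod n = f j mod n)"

text \<open>\<open>f\<close> acts on vertex indices and \<open>g\<close> on edge indices; the
  arbitrary representative is harmless for maps that respect congruence modulo
  \<open>n\<close>.\<close>

definition perm :: "(nat \<Rightarrow> nat) \<Rightarrow> (nat \<Rightarrow> nat) \<Rightarrow> Xvar \<Rightarrow> Xvar" where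
  "perm f g y = (if y \<in> range vtx then vtx (f (SOME i. y = vtx i))
     else if y \<in> range edg then edg (g (SOME i. y = edg i)) else y)"

lemma perm_vtx: "respects_mod f \<Longrightarrow> perm f g (vtx i) = vtx (f i)"
proof -
  assume f: "respects_mod f"
  have "vtx i = vtx (SOME j. vtx i = vtx j)" by (rule someI_ex) blast
  then have "vtx (f i) = vtx (f (SOME j. vtx i = vtx j))"
    using f unfolding respects_mod_def by (metis vtx_eq_iff)
  then show ?thesis by (simp only: perm_def rangeI if_True)
qed

lemma perm_edg: "respects_mod g \<Longrightarrow> perm f g (edg i) = edg (g i)"
proof -
  assume g: "respects_mod g"
  have "edg i = edg (SOME j. edg i = edg j)" by (rule someI_ex) blast
  then have "edg (g i) = edg (g (SOME j. edg i = edg j))"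
    using g unfolding respects_mod_def by (metis edg_eq_iff)
  moreover have "edg i \<notin> range vtx" by auto
  ultimately show ?thesis by (simp only: perm_def rangeI if_True if_False)
qed

lemma perm_other: "y \<notin> range vtx \<Longrightarrow> y \<notin> range edg \<Longrightarrow> perm f g y = y"
  by (simp add: perm_def)

lemma perm_hub: "perm f g hub = hub"
  by (rule perm_other) auto

lemma vimage_perm_vars:
  assumes "respects_mod f" "respects_mod g"
  shows "perm f g -` vars p = vars p"
proof -
  have "perm f g y \<in> vars p \<longleftrightarrow> y \<in> vars p" for y
    by (cases y rule: Xvar_cases) (simp_all add: perm_vtx perm_edg perm_other assms)
  then show ?thesis by auto
qed

text \<open>\<open>k\<close> inverts \<open>f\<close> modulo \<open>n\<close>, since
  \<open>map_key\<close> composes with the permutation. The second condition is incidence: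
  \<open>g\<close> carries the pair of edges at vertex \<open>k j\<close> to the pair at vertex
  \<open>j\<close>.\<close>

lemma symmetry_permI:
  assumes "respects_mod f" "respects_mod g" "bij (perm f g)"
    and v: "\<And>i j. f i mod n = j mod n \<longleftrightarrow> i mod n = k j mod n"
    and e: "\<And>i j. g i mod n = j mod n \<or> g i mod n = (j + 1) mod n \<longleftrightarrow>
       i mod n = k j mod n \<or> i mod n = (k j + 1) mod n"
  shows "symmetry (vars p) gens (perm f g)" "Poly_Mapping.map_key (perm f g) (gen j) = gen (k j)"
    "Poly_Mapping.map_key (perm f g) gen0 = gen0"
proof -
  let ?q = "perm f g"
  have inj: "inj ?q" using assms(3) by (rule bij_is_inj)
  have hub: "?q y = hub \<longleftrightarrow> y = hub" for y
    using inj perm_hub by (metis injD)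
  have vars: "?q y \<in> vars p \<longleftrightarrow> y \<in> vars p" for y
    using vimage_perm_vars[OF assms(1,2)] by blast
  have gen: "Poly_Mapping.map_key ?q (gen j) = gen (k j)" for j
  proof (rule poly_mapping_eqI)
    fix y
    show "Poly_Mapping.lookup (Poly_Mapping.map_key ?q (gen j)) y = Poly_Mapping.lookup (gen (k j)) y"
    proof (cases y rule: Xvar_cases)
      case (vtx i)
      then show ?thesis
        using v[of i j] by (simp add: lookup_map_key[OF inj] lookup_gen perm_vtx assms)
    next
      case (edg i)
      then show ?thesis
        using e[of i j] by (auto simp: lookup_map_key[OF inj] lookup_gen perm_edg assms)
    next
      case other
      then show ?thesis
        by (auto simp: lookup_map_key[OF inj] lookup_gen perm_other)
    qed
  qed
  then show "Poly_Mapping.map_key ?q (gen j) = gen (k j)" .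
  show gen0: "Poly_Mapping.map_key ?q gen0 = gen0"
    by (rule poly_mapping_eqI) (simp add: lookup_map_key[OF inj] lookup_gen0 hub vars)
  show "symmetry (vars p) gens ?q"
    using assms(3) vimage_perm_vars[OF assms(1,2)] gen gen0 by (auto simp: symmetry_def)
qed

text \<open>Multiplication by \<open>n - 1\<close> serves as negation modulo \<open>n\<close>.\<close>

lemma neg_add: "i + (n - 1) * i = n * i"
proof -
  obtain l where "n = Suc l" using n_pos by (cases n) simp_all
  then show ?thesis by simp
qed

lemma neg_mod_eq_iff: "((n - 1) * i + c) mod n = d mod n \<longleftrightarrow> c mod n = (d + i) mod n"
proof -
  have "(n - 1) * i + c + i = c + n * i"
    using neg_add[of i] by simp
  then have "((n - 1) * i + c + i) mod n = c mod n" by (simp only: mod_mult_self2)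
  moreover have "((n - 1) * i + c) mod n = d mod n \<longleftrightarrow> ((n - 1) * i + c + i) mod n = (d + i) mod n"
    by (rule mod_add_cancel_right[symmetric])
  ultimately show ?thesis by simp
qed

lemma respects_mod_rot: "respects_mod (\<lambda>i. i + c)"
  unfolding respects_mod_def by (metis mod_add_left_eq)

lemma respects_mod_refl: "respects_mod (\<lambda>i. (n - 1) * i + c)"
  unfolding respects_mod_def by (metis mod_add_left_eq mod_mult_right_eq)

definition rot :: "nat \<Rightarrow> Xvar \<Rightarrow> Xvar" where
  "rot c = perm (\<lambda>i. i + c) (\<lambda>i. i + c)"

text \<open>The reflection sends vertex \<open>i\<close> to \<open>- i\<close>. As
  \<open>edg i\<close> joins the vertices \<open>i - 1\<close> and \<open>i\<close>, it must go to
  \<open>edg (1 - i)\<close>. The summand \<open>0\<close> gives both index maps the same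
  shape.\<close>

definition flip :: "Xvar \<Rightarrow> Xvar" where
  "flip = perm (\<lambda>i. (n - 1) * i + 0) (\<lambda>i. (n - 1) * i + 1)"

lemma rot_simps: "rot c (vtx i) = vtx (i + c)" "rot c (edg i) = edg (i + c)"
  "y \<notin> range vtx \<Longrightarrow> y \<notin> range edg \<Longrightarrow> rot c y = y"
  by (simp_all add: rot_def perm_vtx perm_edg perm_other respects_mod_rot)

lemma flip_simps: "flip (vtx i) = vtx ((n - 1) * i + 0)" "flip (edg i) = edg ((n - 1) * i + 1)"
  "y \<notin> range vtx \<Longrightarrow> y \<notin> range edg \<Longrightarrow> flip y = y"
  unfolding flip_def by (simp_all only: perm_vtx perm_edg perm_other respects_mod_refl not_False_eq_True)

lemma rot_rot: "rot c \<circ> rot d = rot (d + c)"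
proof
  fix y show "(rot c \<circ> rot d) y = rot (d + c) y"
    by (cases y rule: Xvar_cases) (simp_all add: rot_simps add.assoc)
qed

lemma rot_multiple: "n dvd c \<Longrightarrow> rot c = (\<lambda>y. y)"
proof
  fix y assume "n dvd c"
  then have "(i + c) mod n = i mod n" for i by (auto simp: dvd_def)
  then show "rot c y = y"
    by (cases y rule: Xvar_cases) (simp_all add: rot_simps)
qed

lemma bij_rot: "bij (rot c)"
proof (rule o_bij)
  have "(n - 1) * c + c = n * c" using neg_add[of c] by simp
  then have *: "n dvd (n - 1) * c + c" "n dvd c + (n - 1) * c" by (simp_all add: add.commute)
  show "rot ((n - 1) * c) \<circ> rot c = id" "rot c \<circ> rot ((n - 1) * c) = id"
    using * by (simp_all add: rot_rot rot_multiple id_def)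
qed

lemma bij_flip: "bij flip"
proof -
  have "((n - 1) * ((n - 1) * i + c) + c) mod n = i mod n" for i c
  proof -
    have "c mod n = (i + ((n - 1) * i + c)) mod n \<longleftrightarrow> True"
    proof -
      have "i + ((n - 1) * i + c) = c + n * i" using neg_add[of i] by simp
      then show ?thesis by (simp only: mod_mult_self2 simp_thms)
    qed
    then show ?thesis using neg_mod_eq_iff by blast
  qed
  from this[of _ 0] this[of _ 1] have "flip (flip y) = y" for y
    by (cases y rule: Xvar_cases) (simp_all add: flip_simps)
  then show ?thesis by (auto intro!: o_bij[of flip flip])
qed

lemma symmetry_rot: "symmetry (vars p) gens (rot c)"
  and map_key_rot_gen: "Poly_Mapping.map_key (rot ((n - 1) * c)) (gen j) = gen (j + c)"
  and map_key_rot_gen0: "Poly_Mapping.map_key (rot c) gen0 = gen0"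
proof -
  have 1: "i + (n - 1) * c = (n - 1) * c + i" for i c :: nat by simp
  have m: "(i + (n - 1) * c) mod n = j mod n \<longleftrightarrow> i mod n = (j + c) mod n" for i j c
    unfolding 1 by (rule neg_mod_eq_iff)
  note * = symmetry_permI[of "\<lambda>i. i + (n - 1) * c" "\<lambda>i. i + (n - 1) * c" "\<lambda>j. j + c" for c,
      OF respects_mod_rot respects_mod_rot bij_rot[unfolded rot_def], folded rot_def]
  have e: "(i + (n - 1) * c) mod n = j mod n \<or> (i + (n - 1) * c) mod n = (j + 1) mod n \<longleftrightarrow>
    i mod n = (j + c) mod n \<or> i mod n = (j + c + 1) mod n" for i j c
    unfolding m by (simp add: add_ac)
  show "Poly_Mapping.map_key (rot ((n - 1) * c)) (gen j) = gen (j + c)"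
    by (rule *(2)) (rule m, rule e)
  \<comment> \<open>Negating twice modulo \<open>n\<close> writes an arbitrary rotation in the form
    covered so far.\<close>
  have "rot c = rot ((n - 1) * ((n - 1) * c))"
  proof -
    have "((n - 1) * ((n - 1) * c) + 0) mod n = c mod n \<longleftrightarrow> 0 mod n = (c + (n - 1) * c) mod n"
      by (rule neg_mod_eq_iff)
    moreover have "c + (n - 1) * c = n * c" by (rule neg_add)
    ultimately have "((n - 1) * ((n - 1) * c)) mod n = c mod n" by simp
    then have "(i + (n - 1) * ((n - 1) * c)) mod n = (i + c) mod n" for i by (metis mod_add_right_eq)
    then show ?thesis
      by (intro ext, rename_tac y, case_tac y rule: Xvar_cases) (simp_all add: rot_simps)
  qed
  then show "symmetry (vars p) gens (rot c)" "Poly_Mapping.map_key (rot c) gen0 = gen0"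
    using *(1)[OF m e] *(3)[OF m e] by metis+
qed

lemma symmetry_flip: "symmetry (vars p) gens flip"
  unfolding flip_def
proof (rule symmetry_permI(1)[where k = "\<lambda>j. (n - 1) * j + 0"])
  fix i j
  have s: "a mod n = ((n - 1) * b + c) mod n \<longleftrightarrow> c mod n = (a + b) mod n" for a b c
    using neg_mod_eq_iff[of b c a] by metis
  have c: "(1 + a) mod n = (1 + b) mod n \<longleftrightarrow> a mod n = b mod n" for a b
    unfolding add.commute[of 1] by (rule mod_add_cancel_right)
  show "((n - 1) * i + 0) mod n = j mod n \<longleftrightarrow> i mod n = ((n - 1) * j + 0) mod n"
    unfolding neg_mod_eq_iff s by (simp add: add.commute)
  show "((n - 1) * i + 1) mod n = j mod n \<or> ((n - 1) * i + 1) mod n = (j + 1) mod n \<longleftrightarrow>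
      i mod n = ((n - 1) * j + 0) mod n \<or> i mod n = ((n - 1) * j + 0 + 1) mod n"
  proof -
    have "((n - 1) * i + 1) mod n = (j + 1) mod n \<longleftrightarrow> i mod n = ((n - 1) * j + 0) mod n"
      unfolding neg_mod_eq_iff s using c[of 0 "i + j"] by (simp add: add_ac)
    moreover have "((n - 1) * i + 1) mod n = j mod n \<longleftrightarrow> i mod n = ((n - 1) * j + 0 + 1) mod n"
    proof -
      have 0: "(n - 1) * j + 0 + 1 = (n - 1) * j + 1" by simp
      show ?thesis unfolding neg_mod_eq_iff 0 s by (simp add: add.commute)
    qed
    ultimately show ?thesis by blast
  qed
qed (rule respects_mod_refl bij_flip[unfolded flip_def])+

text \<open>The dihedral relation \<open>r s = \<tau> s r\<close>, written without inverses and with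
  the order of composition reversed: both sides send vertex \<open>i\<close> to
  \<open>1 - i\<close>.\<close>

lemma flip_rot:
  "flip \<circ> rot (n - 1) = rot (n - 1) \<circ> flip \<circ> rot ((n - 1) * 2)"
proof
  fix y
  have *: "((n - 1) * (i + (n - 1)) + c) mod n = ((n - 1) * (i + (n - 1) * 2) + c + (n - 1)) mod n" for i c
  proof -
    have "(n - 1) * (i + (n - 1) * 2) + c + (n - 1) = (n - 1) * (i + (n - 1)) + c + ((n - 1) * (n - 1) + (n - 1) * 1)"
      by (simp only: distrib_left mult_2_right mult_1_right add_ac)
    also have "(n - 1) * (n - 1) + (n - 1) * 1 = (n - 1) * n"
      unfolding distrib_left[symmetric] using n_pos by simp
    finally have E: "(n - 1) * (i + (n - 1) * 2) + c + (n - 1) = (n - 1) * (i + (n - 1)) + c + (n - 1) * n" .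
    show ?thesis unfolding E by (rule mod_mult_self1[symmetric])
  qed
  show "(flip \<circ> rot (n - 1)) y = (rot (n - 1) \<circ> flip \<circ> rot ((n - 1) * 2)) y"
    by (cases y rule: Xvar_cases)
      (simp_all only: comp_apply rot_simps flip_simps vtx_eq_iff edg_eq_iff * not_False_eq_True)
qed

text \<open>\<open>map_key\<close> precomposes, so rotating monomials forward by two needs the inverse rotation of indices.\<close>

definition unrot :: nat where "unrot = (n - 1) * 2"

abbreviation (input) "tau \<equiv> induced_aut (vars p) (rot unrot)"

abbreviation (input) "G \<equiv> ideal_automorphisms (monomial_monoid (vars p)) (ideal_of_prime p)"

lemma induced_aut_in_G: "symmetry (vars p) gens q \<Longrightarrow> induced_aut (vars p) q \<in> carrier G"
  unfolding ideal_of_prime_eq by (rule induced_aut_in_ideal_automorphisms[OF _ finite_gens gens_carrier])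

lemma induced_aut_mult_G:
  "symmetry (vars p) gens q \<Longrightarrow> symmetry (vars p) gens q' \<Longrightarrow>
   induced_aut (vars p) q \<otimes>\<^bsub>G\<^esub> induced_aut (vars p) q' = induced_aut (vars p) (q' \<circ> q)"
  by (rule induced_aut_mult[OF _ _ finite_gens gens_carrier])

lemma tau_in_G: "tau \<in> carrier G"
  by (rule induced_aut_in_G[OF symmetry_rot])

text \<open>The rotation by two is the commutator of a one-step rotation and the reflection, and its
  image is a commutator in a commutative group.\<close>

lemma action_of_tau_trivial:
  fixes act :: "(Xvar monom \<Rightarrow> Xvar monom) \<Rightarrow> 'k::field \<Rightarrow> 'k"
  assumes alg: "\<forall>x::'k. algebraic_over_prime_field x" and char: "CHAR('k) = p"
    and act: "act \<in> hom G field_automorphisms"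
  shows "act tau = id"
proof -
  let ?r = "induced_aut (vars p) (rot (n - 1))" and ?s = "induced_aut (vars p) flip"
  have G: "?r \<in> carrier G" "?s \<in> carrier G"
    by (intro induced_aut_in_G symmetry_rot symmetry_flip)+
  have hom: "act (x \<otimes>\<^bsub>G\<^esub> y) = act x \<circ> act y" if "x \<in> carrier G" "y \<in> carrier G" for x y
    using hom_mult[OF act that] by (simp add: field_automorphisms_def)
  have sr: "?s \<otimes>\<^bsub>G\<^esub> ?r = induced_aut (vars p) (rot (n - 1) \<circ> flip)"
    by (intro induced_aut_mult_G symmetry_rot symmetry_flip)
  have srG: "?s \<otimes>\<^bsub>G\<^esub> ?r \<in> carrier G"
    unfolding sr by (intro induced_aut_in_G symmetry_comp symmetry_rot symmetry_flip)
  have "?r \<otimes>\<^bsub>G\<^esub> ?s = tau \<otimes>\<^bsub>G\<^esub> (?s \<otimes>\<^bsub>G\<^esub> ?r)"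
    unfolding sr
    by (subst (1 2) induced_aut_mult_G) (simp_all only: symmetry_comp symmetry_rot symmetry_flip flip_rot unrot_def)
  then have "act ?r \<circ> act ?s = act tau \<circ> (act ?s \<circ> act ?r)"
    using hom[OF G] hom[OF tau_in_G srG] hom[OF G(2,1)] by simp
  then show ?thesis
    using field_automorphism_commutator_trivial[OF alg] prime_p char act G
    by (metis hom_in_carrier)
qed

end

section \<open>Coordinates and quotients\<close>

lemma poly_ring_simps [simp]:
  "mult (poly_ring X) = (*)" "one (poly_ring X) = 1" "zero (poly_ring X) = 0" "add (poly_ring X) = (+)"
  by (simp_all add: poly_ring_def)

text \<open>The coordinate map is the inverse of \<open>D\<close>, which forms linear combinations
  of the basis; additivity and linearity are checked for \<open>D\<close>.\<close>

lemma finite_free_coordinates: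
  fixes M :: "(('x, 'k::field) mpol, 'm) module"
  assumes M: "module (poly_ring X) M" and free: "finite_free (poly_ring X) M"
  shows "\<exists>(B :: 'm set) C. finite B \<and> bij_betw C (carrier M) (vecs X B) \<and>
    (\<forall>x\<in>carrier M. \<forall>y\<in>carrier M. C (x \<oplus>\<^bsub>M\<^esub> y) = C x + C y) \<and>
    (\<forall>r\<in>polys X. \<forall>x\<in>carrier M. C (r \<odot>\<^bsub>M\<^esub> x) = r *s C x)"
proof -
  interpret module "poly_ring X" M by (rule M)
  obtain B where B: "finite B" "B \<subseteq> carrier M" and
    unique: "\<forall>x\<in>carrier M. \<exists>!c. c \<in> B \<rightarrow>\<^sub>E polys X \<and> x = (\<Oplus>\<^bsub>M\<^esub>b\<in>B. c b \<odot>\<^bsub>M\<^esub> b)"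
    using free unfolding finite_free_def by (elim exE conjE) (rule that)
  note uniq = bspec[OF unique]
  define D where "D v = (\<Oplus>\<^bsub>M\<^esub>b\<in>B. v b \<odot>\<^bsub>M\<^esub> b)" for v
  have in_M: "(\<lambda>b. v b \<odot>\<^bsub>M\<^esub> b) \<in> B \<rightarrow> carrier M" if "v \<in> vecs X B" for v
    using vecs_apply[OF that] B by auto
  have D_M: "D v \<in> carrier M" if "v \<in> vecs X B" for v
    unfolding D_def by (rule M.finsum_closed[OF in_M[OF that]])
  have D_add: "D (v + v') = D v \<oplus>\<^bsub>M\<^esub> D v'" if "v \<in> vecs X B" "v' \<in> vecs X B" for v v'
  proof -
    have "D (v + v') = (\<Oplus>\<^bsub>M\<^esub>b\<in>B. v b \<odot>\<^bsub>M\<^esub> b \<oplus>\<^bsub>M\<^esub> v' b \<odot>\<^bsub>M\<^esub> b)"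
      unfolding D_def
    proof (rule M.finsum_cong'[OF refl])
      show "(\<lambda>b. v b \<odot>\<^bsub>M\<^esub> b \<oplus>\<^bsub>M\<^esub> v' b \<odot>\<^bsub>M\<^esub> b) \<in> B \<rightarrow> carrier M"
        using in_M that by blast
      fix b assume "b \<in> B"
      then show "(v + v') b \<odot>\<^bsub>M\<^esub> b = v b \<odot>\<^bsub>M\<^esub> b \<oplus>\<^bsub>M\<^esub> v' b \<odot>\<^bsub>M\<^esub> b"
        using smult_l_distr[of "v b" "v' b" b] vecs_apply[OF that(1)] vecs_apply[OF that(2)] B by auto
    qed
    also have "\<dots> = D v \<oplus>\<^bsub>M\<^esub> D v'"
      unfolding D_def by (rule M.finsum_addf) (use in_M that in auto)
    finally show ?thesis .
  qed
  have D_scl: "D (r *s v) = r \<odot>\<^bsub>M\<^esub> D v" if r: "r \<in> polys X" and v: "v \<in> vecs X B" for r v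
  proof -
    have "r \<odot>\<^bsub>M\<^esub> D v = (\<Oplus>\<^bsub>M\<^esub>b\<in>B. r \<odot>\<^bsub>M\<^esub> (v b \<odot>\<^bsub>M\<^esub> b))"
      unfolding D_def by (rule finsum_smult_ldistr[OF B(1) r in_M[OF v]])
    also have "\<dots> = D (r *s v)"
      unfolding D_def
    proof (rule M.finsum_cong'[OF refl])
      show "(\<lambda>b. (r *s v) b \<odot>\<^bsub>M\<^esub> b) \<in> B \<rightarrow> carrier M"
        by (rule in_M[of "r *s v"]) (simp add: r v)
      fix b assume "b \<in> B"
      then show "r \<odot>\<^bsub>M\<^esub> (v b \<odot>\<^bsub>M\<^esub> b) = (r *s v) b \<odot>\<^bsub>M\<^esub> b"
        using smult_assoc1[OF r vecs_apply[OF v], of b b] B by auto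
    qed
    finally show ?thesis by simp
  qed
  \<comment> \<open>Freeness speaks of coefficient functions that are undefined off
    \<open>B\<close>, while elements of \<open>vecs X B\<close> vanish there; restriction
    mediates.\<close>
  have restrict: "D v = (\<Oplus>\<^bsub>M\<^esub>b\<in>B. restrict v B b \<odot>\<^bsub>M\<^esub> b)" if "v \<in> vecs X B" for v
    unfolding D_def by (rule M.finsum_cong') (use in_M[OF that] in auto)
  have bij: "bij_betw D (vecs X B) (carrier M)"
  proof (rule bij_betw_imageI)
    show "inj_on D (vecs X B)"
    proof (rule inj_onI)
      fix v v' assume v: "v \<in> vecs X B" "v' \<in> vecs X B" and eq: "D v = D v'"
      have "restrict v B \<in> B \<rightarrow>\<^sub>E polys X" "restrict v' B \<in> B \<rightarrow>\<^sub>E polys X"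
        using vecs_apply[OF v(1)] vecs_apply[OF v(2)] by auto
      note c = this
      have r: "restrict v B = restrict v' B"
      proof (rule ex1E[OF uniq[OF D_M[OF v(1)]]])
        fix c0 assume all: "\<forall>c. c \<in> B \<rightarrow>\<^sub>E polys X \<and> D v = (\<Oplus>\<^bsub>M\<^esub>b\<in>B. c b \<odot>\<^bsub>M\<^esub> b) \<longrightarrow> c = c0"
        have "restrict v B = c0" by (rule all[rule_format]) (intro conjI c restrict v)
        moreover have "restrict v' B = c0"
          by (rule all[rule_format]) (simp only: eq c simp_thms, rule restrict[OF v(2)])
        ultimately show ?thesis by simp
      qed
      show "v = v'"
      proof
        fix b show "v b = v' b"
          using fun_cong[OF r, of b] v by (cases "b \<in> B") (auto simp: vecs_def)
      qed
    qed
    show "D ` vecs X B = carrier M"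
    proof
      show "D ` vecs X B \<subseteq> carrier M" using D_M by blast
      show "carrier M \<subseteq> D ` vecs X B"
      proof
        fix x assume "x \<in> carrier M"
        from uniq[OF this] obtain c where c: "c \<in> B \<rightarrow>\<^sub>E polys X" "x = (\<Oplus>\<^bsub>M\<^esub>b\<in>B. c b \<odot>\<^bsub>M\<^esub> b)" by blast
        define v where "v b = (if b \<in> B then c b else 0)" for b
        have v: "v \<in> vecs X B" using c(1) by (auto simp: vecs_def v_def)
        have "x = D v"
          unfolding c(2) D_def by (rule M.finsum_cong') (use in_M[OF v] in \<open>auto simp: v_def\<close>)
        with v show "x \<in> D ` vecs X B" by blast
      qed
    qed
  qed
  define C where "C = inv_into (vecs X B) D"
  have C: "C x \<in> vecs X B" "D (C x) = x" if "x \<in> carrier M" for x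
    using bij that unfolding C_def by (auto simp: bij_betw_def inv_into_into f_inv_into_f)
  have CD: "C (D v) = v" if "v \<in> vecs X B" for v
    using bij that unfolding C_def by (simp add: bij_betw_def)
  have "C (x \<oplus>\<^bsub>M\<^esub> y) = C x + C y" if "x \<in> carrier M" "y \<in> carrier M" for x y
    using CD[of "C x + C y"] D_add[of "C x" "C y"] C that by simp
  moreover have "C (r \<odot>\<^bsub>M\<^esub> x) = r *s C x" if "r \<in> polys X" "x \<in> carrier M" for r x
    using CD[of "r *s C x"] D_scl[of r "C x"] C that by simp
  moreover have "bij_betw C (carrier M) (vecs X B)"
    unfolding C_def by (rule bij_betw_inv_into[OF bij])
  ultimately show ?thesis using B by blast
qed

text \<open>\<open>sc\<close> is left open because the target is a free module in one use and the
  polynomial ring in the other.\<close>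

lemma linear_expand:
  fixes L :: "('b \<Rightarrow> ('x, 'k::field) mpol) \<Rightarrow> 'g::ab_group_add"
  assumes B: "finite B" and x: "x \<in> vecs X B"
    and add: "\<And>x y. x \<in> vecs X B \<Longrightarrow> y \<in> vecs X B \<Longrightarrow> L (x + y) = L x + L y"
    and scl: "\<And>r x. r \<in> polys X \<Longrightarrow> x \<in> vecs X B \<Longrightarrow> L (r *s x) = sc r (L x)"
  shows "L x = (\<Sum>c\<in>B. sc (x c) (L (unit_vec c)))"
proof -
  have L0: "L 0 = 0" using add[of 0 0] by simp
  have "L (\<Sum>c\<in>A. x c *s unit_vec c) = (\<Sum>c\<in>A. sc (x c) (L (unit_vec c)))" if "A \<subseteq> B" for A
    using finite_subset[OF that B] that
  proof (induction A)
    case (insert c A)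
    let ?S = "\<Sum>c\<in>A. x c *s unit_vec c"
    have c: "unit_vec c \<in> vecs X B" using insert.prems by simp
    have "?S \<in> vecs X B"
      using insert.prems vecs_apply[OF x] by (intro vecs_sum vecs_closed unit_vec_vecs) blast+
    then have "L (x c *s unit_vec c + ?S) = L (x c *s unit_vec c) + L ?S"
      by (intro add vecs_closed(4) vecs_apply[OF x] c)
    moreover have "L ?S = (\<Sum>c\<in>A. sc (x c) (L (unit_vec c)))" using insert by blast
    ultimately show ?case
      by (simp only: sum.insert[OF insert.hyps] scl[OF vecs_apply[OF x] c])
  qed (simp add: L0)
  from this[of B] vec_expand[OF x B] show ?thesis by simp
qed

text \<open>Scalar multiplication on the quotient and the induced map on homology are both unions of
  cosets over representatives. The third claim shows for any suitable \<open>f\<close> that this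
  union is a single coset; the fourth is an instance.\<close>

lemma quotient_facts:
  assumes M: "module R M" and N: "subgroup N (add_monoid M)"
    and sm: "\<forall>r\<in>carrier R. \<forall>x\<in>N. r \<odot>\<^bsub>M\<^esub> x \<in> N"
  shows "x \<in> carrier M \<Longrightarrow> y \<in> carrier M \<Longrightarrow>
      (N +>\<^bsub>M\<^esub> x) <+>\<^bsub>M\<^esub> (N +>\<^bsub>M\<^esub> y) = N +>\<^bsub>M\<^esub> (x \<oplus>\<^bsub>M\<^esub> y)"
    and "x \<in> carrier M \<Longrightarrow> N +>\<^bsub>M\<^esub> x = N \<longleftrightarrow> x \<in> N"
    and "x \<in> carrier M \<Longrightarrow> (\<And>y. y \<in> N \<Longrightarrow> f (y \<oplus>\<^bsub>M\<^esub> x) = f y \<oplus>\<^bsub>M\<^esub> f x) \<Longrightarrow> (\<And>y. y \<in> N \<Longrightarrow> f y \<in> N) \<Longrightarrow>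
      f x \<in> carrier M \<Longrightarrow> (\<Union>z\<in>N +>\<^bsub>M\<^esub> x. N +>\<^bsub>M\<^esub> f z) = N +>\<^bsub>M\<^esub> f x"
    and "r \<in> carrier R \<Longrightarrow> x \<in> carrier M \<Longrightarrow> (\<Union>z\<in>N +>\<^bsub>M\<^esub> x. N +>\<^bsub>M\<^esub> (r \<odot>\<^bsub>M\<^esub> z)) = N +>\<^bsub>M\<^esub> (r \<odot>\<^bsub>M\<^esub> x)"
proof -
  interpret module R M by (rule M)
  interpret N: abelian_subgroup N M
    by (rule abelian_subgroupI3) (simp_all add: additive_subgroup_def N M.abelian_group_axioms)
  show "x \<in> carrier M \<Longrightarrow> y \<in> carrier M \<Longrightarrow>
      (N +>\<^bsub>M\<^esub> x) <+>\<^bsub>M\<^esub> (N +>\<^bsub>M\<^esub> y) = N +>\<^bsub>M\<^esub> (x \<oplus>\<^bsub>M\<^esub> y)"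
    by (rule N.a_rcos_sum)
  show "x \<in> carrier M \<Longrightarrow> N +>\<^bsub>M\<^esub> x = N \<longleftrightarrow> x \<in> N"
    using N.a_rcos_const N.a_rcos_self[of x] by blast
  show union: "(\<Union>z\<in>N +>\<^bsub>M\<^esub> x. N +>\<^bsub>M\<^esub> f z) = N +>\<^bsub>M\<^esub> f x"
    if x: "x \<in> carrier M" and f: "\<And>y. y \<in> N \<Longrightarrow> f (y \<oplus>\<^bsub>M\<^esub> x) = f y \<oplus>\<^bsub>M\<^esub> f x" "\<And>y. y \<in> N \<Longrightarrow> f y \<in> N"
      and fx: "f x \<in> carrier M" for f x
  proof -
    have "N +>\<^bsub>M\<^esub> f z = N +>\<^bsub>M\<^esub> f x" if z: "z \<in> N +>\<^bsub>M\<^esub> x" for z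
    proof -
      obtain y where "y \<in> N" "z = y \<oplus>\<^bsub>M\<^esub> x" using z by (auto simp: a_r_coset_def')
      then have "f z \<in> N +>\<^bsub>M\<^esub> f x" using f by (auto simp: a_r_coset_def')
      then show ?thesis using M.a_repr_independence[OF _ fx N] by simp
    qed
    moreover have "x \<in> N +>\<^bsub>M\<^esub> x" using x by (rule N.a_rcos_self)
    ultimately show ?thesis by blast
  qed
  show "r \<in> carrier R \<Longrightarrow> x \<in> carrier M \<Longrightarrow> (\<Union>z\<in>N +>\<^bsub>M\<^esub> x. N +>\<^bsub>M\<^esub> (r \<odot>\<^bsub>M\<^esub> z)) = N +>\<^bsub>M\<^esub> (r \<odot>\<^bsub>M\<^esub> x)"
    by (rule union) (simp_all add: smult_r_distr N.a_subset[THEN subsetD] sm)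
qed

text \<open>The elements of \<open>k'[X]\<close> without constant term already form an ideal
  containing the variables.\<close>

lemma variable_ideal_deg_ge: "variable_ideal X \<subseteq> (deg_ge 1 :: ('x, 'k::field) mpol set)"
proof -
  let ?R = "poly_ring X :: ('x, 'k) mpol ring"
  interpret cring ?R by (rule cring_poly_ring)
  have "ideal (polys X \<inter> deg_ge 1) ?R"
  proof (rule idealI)
    show "ring ?R" ..
    show "subgroup (polys X \<inter> deg_ge 1) (add_monoid ?R)"
    proof (rule group.subgroupI)
      show "Group.group (add_monoid ?R)" by (rule add.is_group)
      fix f assume f: "f \<in> polys X \<inter> (deg_ge 1 :: ('x, 'k) mpol set)"
      have "inv\<^bsub>add_monoid ?R\<^esub> f = - f"
        by (rule group.inv_equality[OF add.is_group]) (use f in auto)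
      then show "inv\<^bsub>add_monoid ?R\<^esub> f \<in> polys X \<inter> deg_ge 1" using f by simp
    next
      show "polys X \<inter> (deg_ge 1 :: ('x, 'k) mpol set) \<noteq> {}" using polys_closed(1) zero_deg_ge by blast
    qed (auto simp: deg_ge_add)
  qed (auto simp: deg_ge_mult_left deg_ge_mult_right)
  then have "Idl\<^bsub>?R\<^esub> ((\<lambda>y. monomial (Poly_Mapping.single y 1)) ` X) \<subseteq> polys X \<inter> deg_ge 1"
    by (rule genideal_minimal, intro image_subsetI) (simp add: indet_def[symmetric] del: One_nat_def)
  then show ?thesis by (auto simp: variable_ideal_def)
qed

lemma monomial_degree_map_key:
  assumes "bij q"
  shows "monomial_degree (Poly_Mapping.map_key q a) = monomial_degree a"
proof -
  have inj: "inj q" using assms by (rule bij_is_inj)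
  have "bij_betw q (q -` Poly_Mapping.keys a) (Poly_Mapping.keys a)"
    using assms by (auto simp: bij_betw_def bij_is_surj surj_image_vimage_eq intro: inj_on_subset)
  from sum.reindex_bij_betw[OF this, of "Poly_Mapping.lookup a"] show ?thesis
    by (simp add: monomial_degree_def keys_map_key[OF inj] lookup_map_key[OF inj])
qed

section \<open>The ideal in the polynomial ring, and the ring automorphism induced by the
  rotation\<close>

context prime_ideal_data
begin

text \<open>The right-hand side is an ideal of the polynomial ring and contains every monomial of
  \<open>I\<close>, a multiple of some generator.\<close>

lemma monomial_ideal_subset:
  "carrier (monomial_ideal_module (vars p) (ideal_of_prime p) :: ((Xvar, 'k::field) mpol, (Xvar, 'k) mpol) module)
   \<subseteq> {q0 * monomial gen0 + (\<Sum>i<n. q i * monomial (gen i)) |q0 q. q0 \<in> polys (vars p) \<and> (\<forall>i. q i \<in> polys (vars p))}"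
  (is "_ \<subseteq> ?J")
proof -
  let ?R = "poly_ring (vars p) :: (Xvar, 'k) mpol ring"
  interpret cring ?R by (rule cring_poly_ring)
  have gens_R: "monomial gen0 \<in> polys (vars p)" "monomial (gen i) \<in> polys (vars p)" for i
    using gens_carrier by (auto simp: monomial_polys monomial_monoid_def)
  have JI: "f \<in> ?J" if "f = q0 * monomial gen0 + (\<Sum>i<n. q i * monomial (gen i))"
    "q0 \<in> polys (vars p)" "\<And>i. q i \<in> polys (vars p)" for f q0 q
    using that by blast
  have J_R: "?J \<subseteq> polys (vars p)" using gens_R by (auto intro!: polys_closed polys_sum)
  have J_mult: "r * f \<in> ?J" if f: "f \<in> ?J" and r: "r \<in> polys (vars p)" for r f
  proof -
    obtain q0 q where q: "f = q0 * monomial gen0 + (\<Sum>i<n. q i * monomial (gen i))"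
      "q0 \<in> polys (vars p)" "\<And>i. q i \<in> polys (vars p)" using f by blast
    show ?thesis
      by (rule JI[of _ "r * q0" "\<lambda>i. r * q i"])
        (simp_all add: q r distrib_left sum_distrib_left mult.assoc)
  qed
  have "ideal ?J ?R"
  proof (rule idealI)
    show "ring ?R" ..
    show "subgroup ?J (add_monoid ?R)"
    proof (rule group.subgroupI)
      show "Group.group (add_monoid ?R)" by (rule add.is_group)
      show "?J \<subseteq> carrier (add_monoid ?R)" using J_R by simp
      show "?J \<noteq> {}" using JI[OF refl, of 0 "\<lambda>i. 0"] by auto
      fix f assume f: "f \<in> ?J"
      have "f \<in> polys (vars p)" using f J_R by blast
      then have "inv\<^bsub>add_monoid ?R\<^esub> f = (- 1) * f"
        by (intro group.inv_equality[OF add.is_group]) simp_all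
      then show "inv\<^bsub>add_monoid ?R\<^esub> f \<in> ?J" using J_mult[OF f, of "- 1"] by simp
      fix f' assume f': "f' \<in> ?J"
      obtain q0 q where q: "f = q0 * monomial gen0 + (\<Sum>i<n. q i * monomial (gen i))"
        "q0 \<in> polys (vars p)" "\<And>i. q i \<in> polys (vars p)" using f by blast
      obtain q0' q' where q': "f' = q0' * monomial gen0 + (\<Sum>i<n. q' i * monomial (gen i))"
        "q0' \<in> polys (vars p)" "\<And>i. q' i \<in> polys (vars p)" using f' by blast
      have "f + f' \<in> ?J"
        by (rule JI[of _ "q0 + q0'" "\<lambda>i. q i + q' i"]) (simp_all add: q q' distrib_right sum.distrib)
      then show "f \<otimes>\<^bsub>add_monoid ?R\<^esub> f' \<in> ?J" by simp
    qed
  qed (use J_mult in \<open>simp_all add: mult.commute\<close>)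
  moreover have "monomial ` ideal_of_prime p \<subseteq> ?J"
  proof
    fix f :: "(Xvar, 'k) mpol" assume "f \<in> monomial ` ideal_of_prime p"
    then obtain a b where ab: "f = monomial b * monomial a" "a \<in> gens" "b \<in> carrier (monomial_monoid (vars p))"
      unfolding ideal_of_prime_eq monoid_ideal_hull_eq[OF gens_carrier] by (auto simp: monomial_add)
    have b: "monomial b \<in> (polys (vars p) :: (Xvar, 'k) mpol set)" using ab(3) by (simp add: monomial_polys monomial_monoid_def)
    show "f \<in> ?J"
    proof (cases "a = gen0")
      case True
      then show ?thesis using b by (intro JI[of _ "monomial b" "\<lambda>i. 0"]) (simp_all add: ab)
    next
      case False
      then obtain j where j: "a = gen j" using ab(2) by blast
      have "(\<Sum>i<n. (if i = j mod n then monomial b else 0) * monomial (gen i)) =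
          (\<Sum>i<n. if i = j mod n then monomial b * monomial (gen j) else (0 :: (Xvar, 'k) mpol))"
        by (rule sum.cong) (auto simp: gen_def)
      then show ?thesis
        using b by (intro JI[of _ 0 "\<lambda>i. if i = j mod n then monomial b else 0"]) (simp_all add: ab j)
    qed
  qed
  ultimately have "Idl\<^bsub>?R\<^esub> (monomial ` ideal_of_prime p) \<subseteq> ?J" by (rule genideal_minimal)
  then show ?thesis by (simp add: monomial_ideal_module_def)
qed

lemma monomial_in_monomial_ideal:
  assumes "a \<in> gens"
  shows "monomial a \<in> carrier (monomial_ideal_module (vars p) (ideal_of_prime p) :: ((Xvar, 'k::field) mpol, (Xvar, 'k) mpol) module)"
proof -
  let ?R = "poly_ring (vars p) :: (Xvar, 'k) mpol ring"
  interpret cring ?R by (rule cring_poly_ring)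
  have "ideal_of_prime p \<subseteq> carrier (monomial_monoid (vars p))"
    unfolding ideal_of_prime_eq monoid_ideal_hull_eq[OF gens_carrier]
    using gens_carrier by (fastforce simp: monomial_monoid_def keys_add_nat)
  then have "monomial ` ideal_of_prime p \<subseteq> carrier ?R"
    by (auto simp: monomial_polys monomial_monoid_def)
  from genideal_self[OF this] show ?thesis
    using assms hull_subset[of gens "monoid_ideal (monomial_monoid (vars p))"]
    unfolding ideal_of_prime_eq by (auto simp: monomial_ideal_module_def)
qed

lemma tau_apply:
  assumes "a \<in> carrier (monomial_monoid (vars p))"
  shows "tau a = Poly_Mapping.map_key (rot unrot) a" "tau a \<in> carrier (monomial_monoid (vars p))"
  using assms map_key_carrier[OF symmetry_rot assms] by (simp_all add: induced_aut_def)

lemma map_key_rot_single: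
  "Poly_Mapping.map_key (rot c) (Poly_Mapping.single (rot c y) k) = Poly_Mapping.single y k"
  using bij_is_inj[OF bij_rot] by (rule map_key_single)

lemma rot_back: "rot unrot (vtx (i + 2)) = vtx i" "rot unrot (edg (i + 2)) = edg i"
proof -
  have E: "i + 2 + unrot = i + n * 2" using neg_add[of 2] by (simp add: unrot_def)
  have "(i + 2 + unrot) mod n = i mod n" unfolding E by (rule mod_mult_self2)
  then show "rot unrot (vtx (i + 2)) = vtx i" "rot unrot (edg (i + 2)) = edg i"
    by (simp_all only: rot_simps vtx_eq_iff edg_eq_iff)
qed

lemma rot_hub: "rot c hub = hub"
  by (rule rot_simps) auto

lemma tau_single:
  "Poly_Mapping.map_key (rot unrot) (Poly_Mapping.single (vtx i) k) = Poly_Mapping.single (vtx (i + 2)) k"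
  "Poly_Mapping.map_key (rot unrot) (Poly_Mapping.single (edg i) k) = Poly_Mapping.single (edg (i + 2)) k"
  "Poly_Mapping.map_key (rot unrot) (Poly_Mapping.single hub k) = Poly_Mapping.single hub k"
  using map_key_rot_single[of unrot "vtx (i + 2)" k] map_key_rot_single[of unrot "edg (i + 2)" k]
    map_key_rot_single[of unrot hub k]
  by (simp_all only: rot_back rot_hub)

context
  fixes act :: "(Xvar monom \<Rightarrow> Xvar monom) \<Rightarrow> 'k::field \<Rightarrow> 'k"
  assumes act: "act tau = id"
begin

abbreviation (input) "\<theta> \<equiv> poly_aut act tau"

text \<open>Here the triviality of the coefficient action enters. For \<open>c = 0\<close> the
  defining sum is empty, hence the separate case.\<close>

lemma theta_single: "\<theta> (Poly_Mapping.single a c) = Poly_Mapping.single (tau a) c"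
  by (cases "c = 0") (simp_all add: poly_aut_def act)

lemma theta_monomial: "\<theta> (monomial a) = monomial (tau a)"
  by (simp add: monomial_def theta_single)

lemma theta_polys:
  assumes "r \<in> polys (vars p)"
  shows "\<theta> r \<in> polys (vars p)"
  unfolding poly_aut_def
proof (rule polys_sum)
  fix a assume "a \<in> Poly_Mapping.keys r"
  then have "a \<in> carrier (monomial_monoid (vars p))" using assms by (auto simp: poly_ring_def)
  then have "tau a \<in> carrier (monomial_monoid (vars p))" by (rule tau_apply)
  then show "Poly_Mapping.single (tau a) (act tau (Poly_Mapping.lookup r a)) \<in> polys (vars p)"
    by (simp add: poly_ring_def)
qed

lemma theta_deg_ge:
  assumes "r \<in> polys (vars p)" "r \<in> deg_ge k"
  shows "\<theta> r \<in> deg_ge k"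
  unfolding poly_aut_def
proof (rule deg_ge_sum)
  fix a assume a: "a \<in> Poly_Mapping.keys r"
  then have "a \<in> carrier (monomial_monoid (vars p))" using assms(1) by (auto simp: poly_ring_def)
  then have "monomial_degree (tau a) = monomial_degree a"
    by (simp only: tau_apply monomial_degree_map_key[OF bij_rot])
  then show "Poly_Mapping.single (tau a) (act tau (Poly_Mapping.lookup r a)) \<in> deg_ge k"
    using assms(2) a by (auto simp: deg_ge_def split: if_splits)
qed

lemma theta_indets:
  "\<theta> (const_poly c) = const_poly c"
  "\<theta> (indet (edg i)) = indet (edg (i + 2))"
  "\<theta> (indet hub * indet hub) = indet hub * indet hub"
  "\<theta> (indet (edg i) * indet (vtx i)) = indet (edg (i + 2)) * indet (vtx (i + 2))"
  "\<theta> (indet (vtx i) * indet (edg (i + 1))) = indet (vtx (i + 2)) * indet (edg (i + 3))"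
  "\<theta> (indet (edg 0) * indet (vtx 0) * indet (edg 1)) = indet (edg 2) * indet (vtx 2) * indet (edg 3)"
proof -
  note plus = map_key_plus[OF bij_is_inj[OF bij_rot]]
  have c: "a \<in> carrier (monomial_monoid (vars p)) \<longleftrightarrow> Poly_Mapping.keys a \<subseteq> vars p" for a
    by (simp add: monomial_monoid_def)
  have "Poly_Mapping.map_key (rot unrot) (0 :: Xvar monom) = 0"
    by (rule map_key_zero[OF bij_is_inj[OF bij_rot]])
  then have "tau 0 = 0" by (simp add: tau_apply c)
  then show "\<theta> (const_poly c) = const_poly c" by (simp add: const_poly_def theta_single)
  show "\<theta> (indet (edg i)) = indet (edg (i + 2))"
    "\<theta> (indet hub * indet hub) = indet hub * indet hub"
    "\<theta> (indet (edg i) * indet (vtx i)) = indet (edg (i + 2)) * indet (vtx (i + 2))"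
    "\<theta> (indet (vtx i) * indet (edg (i + 1))) = indet (vtx (i + 2)) * indet (edg (i + 3))"
    unfolding indet_def monomial_add[symmetric] theta_monomial
    by (simp_all add: tau_apply c keys_add_nat plus tau_single numeral_3_eq_3)
  show "\<theta> (indet (edg 0) * indet (vtx 0) * indet (edg 1)) = indet (edg 2) * indet (vtx 2) * indet (edg 3)"
    unfolding indet_def monomial_add[symmetric] theta_monomial
    by (simp add: tau_apply c keys_add_nat plus tau_single numeral_3_eq_3 numeral_2_eq_2)
qed

lemma theta_gens: "\<theta> (monomial gen0) = monomial gen0" "\<theta> (monomial (gen i)) = monomial (gen (i + 2))"
proof -
  have "gen0 \<in> carrier (monomial_monoid (vars p))" "gen i \<in> carrier (monomial_monoid (vars p))"
    using gens_carrier by auto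
  then show "\<theta> (monomial gen0) = monomial gen0" "\<theta> (monomial (gen i)) = monomial (gen (i + 2))"
    by (simp_all only: theta_monomial tau_apply map_key_rot_gen0 map_key_rot_gen[of 2, folded unrot_def])
qed

end

end

lemma coordinates_inverse:
  fixes M :: "(('x, 'k::field) mpol, 'm) module"
  assumes M: "module (poly_ring X) M" and C: "bij_betw C (carrier M) (vecs X B)"
    and add: "\<forall>x\<in>carrier M. \<forall>y\<in>carrier M. C (x \<oplus>\<^bsub>M\<^esub> y) = C x + C y"
    and scl: "\<forall>r\<in>polys X. \<forall>x\<in>carrier M. C (r \<odot>\<^bsub>M\<^esub> x) = r *s C x"
  defines "D \<equiv> inv_into (carrier M) C"
  shows "x \<in> carrier M \<Longrightarrow> D (C x) = x" "x \<in> carrier M \<Longrightarrow> C x \<in> vecs X B"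
    "u \<in> vecs X B \<Longrightarrow> C (D u) = u" "u \<in> vecs X B \<Longrightarrow> D u \<in> carrier M"
    "u \<in> vecs X B \<Longrightarrow> u' \<in> vecs X B \<Longrightarrow> D (u + u') = D u \<oplus>\<^bsub>M\<^esub> D u'"
    "r \<in> polys X \<Longrightarrow> u \<in> vecs X B \<Longrightarrow> D (r *s u) = r \<odot>\<^bsub>M\<^esub> D u"
    "C \<zero>\<^bsub>M\<^esub> = 0"
proof -
  interpret module "poly_ring X" M by (rule M)
  show DC: "D (C x) = x" if "x \<in> carrier M" for x
    using C that by (simp add: D_def bij_betw_def)
  show "C x \<in> vecs X B" if "x \<in> carrier M" for x
    using C that by (auto simp: bij_betw_def)
  show CD: "C (D u) = u" and D: "D u \<in> carrier M" if "u \<in> vecs X B" for u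
    using C that by (auto simp: D_def bij_betw_def f_inv_into_f inv_into_into)
  show "D (u + u') = D u \<oplus>\<^bsub>M\<^esub> D u'" if "u \<in> vecs X B" "u' \<in> vecs X B"
    using DC[of "D u \<oplus>\<^bsub>M\<^esub> D u'"] add D that by (simp add: CD)
  show "D (r *s u) = r \<odot>\<^bsub>M\<^esub> D u" if "r \<in> polys X" "u \<in> vecs X B"
    using DC[of "r \<odot>\<^bsub>M\<^esub> D u"] scl D that by (simp add: CD)
  have "C (\<zero>\<^bsub>M\<^esub> \<oplus>\<^bsub>M\<^esub> \<zero>\<^bsub>M\<^esub>) = C \<zero>\<^bsub>M\<^esub> + C \<zero>\<^bsub>M\<^esub>"
    using add M.zero_closed by blast
  then show "C \<zero>\<^bsub>M\<^esub> = 0" by simp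
qed

text \<open>Order is preserved by sums and negatives, so it is enough to look at the products that
  generate the submodule.\<close>

lemma ideal_times_module_ord_ge:
  fixes M :: "(('x, 'k::field) mpol, 'm) module"
  assumes M: "module (poly_ring X) M" and C: "bij_betw C (carrier M) (vecs X B)"
    and add: "\<forall>x\<in>carrier M. \<forall>y\<in>carrier M. C (x \<oplus>\<^bsub>M\<^esub> y) = C x + C y"
    and scl: "\<forall>r\<in>polys X. \<forall>x\<in>carrier M. C (r \<odot>\<^bsub>M\<^esub> x) = r *s C x"
    and J: "J \<subseteq> polys X \<inter> deg_ge 1" and x: "x \<in> ideal_times_module J M"
  shows "C x \<in> ord_ge 1"
proof -
  interpret module "poly_ring X" M by (rule M)
  note zero = coordinates_inverse(7)[OF M C add scl]
  have gen: "r \<odot>\<^bsub>M\<^esub> y \<in> carrier M \<and> C (r \<odot>\<^bsub>M\<^esub> y) \<in> ord_ge 1" if "r \<in> J" "y \<in> carrier M" for r y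
  proof -
    have r: "r \<in> polys X" "r \<in> deg_ge 1" using J that by blast+
    then show ?thesis using scl that(2) ord_ge_scl_deg[OF r(2)] by simp
  qed
  have "x \<in> carrier M \<and> C x \<in> ord_ge 1"
    using x unfolding ideal_times_module_def
  proof (induction rule: generate.induct)
    case one
    show ?case using zero by (simp add: ord_ge_def)
  next
    case (incl y)
    then show ?case using gen by auto
  next
    case (inv y)
    then have y: "y \<in> carrier M" "C y \<in> ord_ge 1" using gen by auto
    have "C (\<ominus>\<^bsub>M\<^esub> y \<oplus>\<^bsub>M\<^esub> y) = C (\<ominus>\<^bsub>M\<^esub> y) + C y" using add y M.a_inv_closed by blast
    then have "C (\<ominus>\<^bsub>M\<^esub> y) = 0 - C y" using y zero by (simp add: M.l_neg eq_neg_iff_add_eq_0)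
    moreover have "0 - C y \<in> ord_ge 1" by (rule ord_ge_diff[OF _ y(2)]) (simp add: ord_ge_def)
    ultimately have "C (\<ominus>\<^bsub>M\<^esub> y) \<in> ord_ge 1" by (simp only:)
    with M.a_inv_closed[OF y(1)] show ?case unfolding a_inv_def by blast
  next
    case (eng y z)
    then have "C (y \<oplus>\<^bsub>M\<^esub> z) = C y + C z" "C y + C z \<in> ord_ge 1" using add ord_ge_add by blast+
    then have "C (y \<oplus>\<^bsub>M\<^esub> z) \<in> ord_ge 1" by (simp only:)
    with eng show ?case by simp
  qed
  then show ?thesis ..
qed

lemma variable_ideal_polys: "variable_ideal X \<subseteq> (polys X :: ('x, 'k::field) mpol set)"
proof -
  interpret cring "poly_ring X :: ('x, 'k) mpol ring" by (rule cring_poly_ring)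
  have "(\<lambda>y. monomial (Poly_Mapping.single y 1)) ` X \<subseteq> (polys X :: ('x, 'k) mpol set)"
    by (intro image_subsetI) (simp add: indet_def[symmetric] del: One_nat_def)
  from genideal_ideal[OF this] show ?thesis
    unfolding variable_ideal_def by (rule ideal.Icarr[THEN subsetI])
qed

section \<open>From an equivariant resolution to a symmetric presentation\<close>

context prime_ideal_data
begin

lemma no_equivariant_resolution:
  fixes act :: "(Xvar monom \<Rightarrow> Xvar monom) \<Rightarrow> 'k::field \<Rightarrow> 'k"
    and M :: "nat \<Rightarrow> ((Xvar, 'k) mpol, 'm) module"
    and \<mu> :: "nat \<Rightarrow> 'm \<Rightarrow> 'm"
    and \<Phi> :: "(Xvar monom \<Rightarrow> Xvar monom) \<Rightarrow> nat \<Rightarrow> 'm \<Rightarrow> 'm"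
  assumes char: "CHAR('k) = p" and alg: "\<forall>x::'k. algebraic_over_prime_field x"
    and act: "act \<in> hom G field_automorphisms"
    and complex: "chain_complex (poly_ring (vars p)) M \<mu>"
    and free: "\<forall>i. finite_free (poly_ring (vars p)) (M i)"
    and acyclic: "acyclic_in_positive_degrees M \<mu>"
    and minimal: "\<forall>i\<ge>1. \<mu> i ` carrier (M i) \<subseteq> ideal_times_module (variable_ideal (vars p)) (M (i - 1))"
    and \<Phi>: "\<Phi> \<in> hom G (complex_automorphisms M \<mu>)"
    and \<delta>: "\<delta> \<in> module_iso (poly_ring (vars p)) (homology M \<mu> 0)
      (monomial_ideal_module (vars p) (ideal_of_prime p))"
    and equivariant: "\<forall>\<sigma>\<in>carrier G.
      chain_map (poly_ring (vars p)) M \<mu> (\<lambda>i. twisted_module (poly_aut act \<sigma>) (M i)) \<mu> (\<Phi> \<sigma>) \<and>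
      (\<forall>z\<in>carrier (homology M \<mu> 0). poly_aut act \<sigma> (\<delta> z) = \<delta> (homology_map M \<mu> (\<Phi> \<sigma>) 0 z))"
  shows False
proof -
  let ?X = "vars p"
  let ?R = "poly_ring ?X :: (Xvar, 'k) mpol ring"
  let ?IR = "monomial_ideal_module ?X (ideal_of_prime p) :: ((Xvar, 'k) mpol, (Xvar, 'k) mpol) module"
  let ?\<theta> = "poly_aut act tau"
  have M: "module ?R (M i)" for i using complex by (simp add: chain_complex_def)
  have ab: "abelian_group (M i)" for i using M[of i] by (rule module.axioms)
  have mu_hom: "\<mu> (Suc i) \<in> module_hom ?R (M (Suc i)) (M i)" for i
    using complex by (simp add: chain_complex_def)
  have mu: "x \<in> carrier (M (Suc i)) \<Longrightarrow> \<mu> (Suc i) x \<in> carrier (M i)"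
    "x \<in> carrier (M (Suc i)) \<Longrightarrow> y \<in> carrier (M (Suc i)) \<Longrightarrow>
      \<mu> (Suc i) (x \<oplus>\<^bsub>M (Suc i)\<^esub> y) = \<mu> (Suc i) x \<oplus>\<^bsub>M i\<^esub> \<mu> (Suc i) y"
    "r \<in> carrier ?R \<Longrightarrow> x \<in> carrier (M (Suc i)) \<Longrightarrow>
      \<mu> (Suc i) (r \<odot>\<^bsub>M (Suc i)\<^esub> x) = r \<odot>\<^bsub>M i\<^esub> \<mu> (Suc i) x" for i x y r
    using mu_hom[of i] by (auto simp: module_hom_def hom_def)
  have sub: "subgroup (\<mu> (Suc i) ` carrier (M (Suc i))) (add_monoid (M i))" for i
  proof -
    have "group_hom (add_monoid (M (Suc i))) (add_monoid (M i)) (\<mu> (Suc i))"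
      using mu_hom[of i] abelian_group.a_group[OF ab]
      by (auto intro!: group_hom.intro group_hom_axioms.intro simp: module_hom_def)
    from group_hom.img_is_subgroup[OF this] show ?thesis by simp
  qed

  obtain B0 :: "'m set" and C0 where B0: "finite B0" and C0: "bij_betw C0 (carrier (M 0)) (vecs ?X B0)"
      "\<forall>x\<in>carrier (M 0). \<forall>y\<in>carrier (M 0). C0 (x \<oplus>\<^bsub>M 0\<^esub> y) = C0 x + C0 y"
      "\<forall>r\<in>polys ?X. \<forall>x\<in>carrier (M 0). C0 (r \<odot>\<^bsub>M 0\<^esub> x) = r *s C0 x"
    using finite_free_coordinates[OF M[of 0] free[rule_format]] by (elim exE conjE) (rule that; assumption)
  obtain B1 :: "'m set" and C1 where B1: "finite B1" and C1: "bij_betw C1 (carrier (M (Suc 0))) (vecs ?X B1)"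
      "\<forall>x\<in>carrier (M (Suc 0)). \<forall>y\<in>carrier (M (Suc 0)). C1 (x \<oplus>\<^bsub>M (Suc 0)\<^esub> y) = C1 x + C1 y"
      "\<forall>r\<in>polys ?X. \<forall>x\<in>carrier (M (Suc 0)). C1 (r \<odot>\<^bsub>M (Suc 0)\<^esub> x) = r *s C1 x"
    using finite_free_coordinates[OF M[of "Suc 0"] free[rule_format]] by (elim exE conjE) (rule that; assumption)
  define D0 where "D0 = inv_into (carrier (M 0)) C0"
  define D1 where "D1 = inv_into (carrier (M (Suc 0))) C1"
  note D0 = coordinates_inverse[OF M C0, folded D0_def]
  note D1 = coordinates_inverse[OF M C1, folded D1_def]

  define N where "N = boundaries M \<mu> 0"
  have N_eq: "N = \<mu> (Suc 0) ` carrier (M (Suc 0))" by (simp add: N_def boundaries_def)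
  have N_sub: "subgroup N (add_monoid (M 0))" unfolding N_eq by (rule sub)
  have N_carrier: "x \<in> carrier (M 0)" if "x \<in> N" for x using that mu(1) by (auto simp: N_eq)
  have N_smult: "\<forall>r\<in>carrier ?R. \<forall>x\<in>N. r \<odot>\<^bsub>M 0\<^esub> x \<in> N"
  proof (intro ballI)
    fix r x assume that: "r \<in> carrier ?R" "x \<in> N"
    from that(2) obtain y where y: "y \<in> carrier (M (Suc 0))" "x = \<mu> (Suc 0) y" by (auto simp: N_eq)
    then have "r \<odot>\<^bsub>M 0\<^esub> x = \<mu> (Suc 0) (r \<odot>\<^bsub>M (Suc 0)\<^esub> y)" using mu(3) that(1) by simp
    moreover have "r \<odot>\<^bsub>M (Suc 0)\<^esub> y \<in> carrier (M (Suc 0))"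
      using module.smult_closed[OF M that(1) y(1)] .
    ultimately show "r \<odot>\<^bsub>M 0\<^esub> x \<in> N" unfolding N_eq by blast
  qed
  note quot = quotient_facts[OF M N_sub N_smult]
  have H0: "homology M \<mu> 0 = quotient_module (M 0) N"
  proof -
    have "(M 0)\<lparr>carrier := carrier (M 0)\<rparr> = M 0" by simp
    then show ?thesis by (simp add: homology_def cycles_def N_def)
  qed
  have coset: "N +>\<^bsub>M 0\<^esub> x \<in> carrier (homology M \<mu> 0)" if "x \<in> carrier (M 0)" for x
    using that by (auto simp: H0 quotient_module_def A_RCOSETS_def')
  have \<delta>_bij: "bij_betw \<delta> (carrier (homology M \<mu> 0)) (carrier ?IR)"
    and \<delta>_add: "A \<in> carrier (homology M \<mu> 0) \<Longrightarrow> A' \<in> carrier (homology M \<mu> 0) \<Longrightarrow>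
      \<delta> (A <+>\<^bsub>M 0\<^esub> A') = \<delta> A + \<delta> A'"
    and \<delta>_smult: "r \<in> carrier ?R \<Longrightarrow> A \<in> carrier (homology M \<mu> 0) \<Longrightarrow>
      \<delta> (\<Union>x\<in>A. N +>\<^bsub>M 0\<^esub> (r \<odot>\<^bsub>M 0\<^esub> x)) = r * \<delta> A" for A A' r
    using \<delta> by (auto simp: module_iso_def module_hom_def hom_def H0 quotient_module_def monomial_ideal_module_def)

  \<comment> \<open>The composite of the projection from \<open>M 0\<close> to \<open>H_0\<close>
    with \<open>\<delta>\<close>. Injectivity of \<open>\<delta>\<close> makes its kernel the
    boundaries, and equivariance of \<open>\<delta>\<close> makes it compatible with the group
    action.\<close>
  define pi0 where "pi0 x = \<delta> (N +>\<^bsub>M 0\<^esub> x)" for x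
  have pi0_add: "pi0 (x \<oplus>\<^bsub>M 0\<^esub> y) = pi0 x + pi0 y" if "x \<in> carrier (M 0)" "y \<in> carrier (M 0)" for x y
    unfolding pi0_def quot(1)[OF that, symmetric] by (rule \<delta>_add) (simp_all add: coset that)
  have pi0_smult: "pi0 (r \<odot>\<^bsub>M 0\<^esub> x) = r * pi0 x" if "r \<in> carrier ?R" "x \<in> carrier (M 0)" for r x
    unfolding pi0_def quot(4)[OF that, symmetric] by (rule \<delta>_smult) (simp_all add: coset that)
  have zero_closed: "\<zero>\<^bsub>M i\<^esub> \<in> carrier (M i)" for i
    using abelian_monoid.zero_closed[OF abelian_group.axioms(1)[OF ab]] .
  have zero_add: "\<zero>\<^bsub>M i\<^esub> \<oplus>\<^bsub>M i\<^esub> x = x" if "x \<in> carrier (M i)" for x i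
    using abelian_monoid.l_zero[OF abelian_group.axioms(1)[OF ab]] that .
  have pi0_zero: "pi0 \<zero>\<^bsub>M 0\<^esub> = 0"
    using pi0_add[OF zero_closed zero_closed] zero_add[OF zero_closed] by simp
  have zero_N: "\<zero>\<^bsub>M 0\<^esub> \<in> N" using subgroup.one_closed[OF N_sub] by simp
  have pi0_eq_0: "pi0 x = 0 \<longleftrightarrow> x \<in> N" if x: "x \<in> carrier (M 0)" for x
  proof -
    have "pi0 x = 0 \<longleftrightarrow> pi0 x = pi0 \<zero>\<^bsub>M 0\<^esub>" by (simp add: pi0_zero)
    also have "\<dots> \<longleftrightarrow> N +>\<^bsub>M 0\<^esub> x = N +>\<^bsub>M 0\<^esub> \<zero>\<^bsub>M 0\<^esub>"
      unfolding pi0_def using bij_betw_imp_inj_on[OF \<delta>_bij] coset[OF x] coset[OF zero_closed]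
      by (rule inj_on_eq_iff)
    also have "N +>\<^bsub>M 0\<^esub> \<zero>\<^bsub>M 0\<^esub> = N" using quot(2)[OF zero_closed] zero_N by simp
    finally show ?thesis using quot(2)[OF x] by simp
  qed
  have pi0_closed: "pi0 x \<in> carrier ?IR" if "x \<in> carrier (M 0)" for x
    using bij_betw_apply[OF \<delta>_bij coset[OF that]] by (simp add: pi0_def)
  have pi0_surj: "\<exists>x\<in>carrier (M 0). pi0 x = f" if f: "f \<in> carrier ?IR" for f
  proof -
    have "f \<in> \<delta> ` carrier (homology M \<mu> 0)" using f bij_betw_imp_surj_on[OF \<delta>_bij] by (simp only:)
    then obtain A where A: "A \<in> carrier (homology M \<mu> 0)" "\<delta> A = f" by blast
    then obtain x where "x \<in> carrier (M 0)" "A = N +>\<^bsub>M 0\<^esub> x"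
      by (auto simp: H0 quotient_module_def A_RCOSETS_def')
    then show ?thesis using A by (auto simp: pi0_def)
  qed

  have Phi_carrier: "\<Phi> \<sigma> \<in> carrier (complex_automorphisms M \<mu>)" if "\<sigma> \<in> carrier G" for \<sigma>
    using \<Phi> that by (rule hom_in_carrier)
  have Phi: "\<Phi> \<sigma> i \<in> Bij (carrier (M i))"
    "x \<in> carrier (M i) \<Longrightarrow> \<Phi> \<sigma> i x \<in> carrier (M i)"
    "x \<in> carrier (M i) \<Longrightarrow> y \<in> carrier (M i) \<Longrightarrow> \<Phi> \<sigma> i (x \<oplus>\<^bsub>M i\<^esub> y) = \<Phi> \<sigma> i x \<oplus>\<^bsub>M i\<^esub> \<Phi> \<sigma> i y"
    "x \<in> carrier (M (Suc i)) \<Longrightarrow> \<Phi> \<sigma> i (\<mu> (Suc i) x) = \<mu> (Suc i) (\<Phi> \<sigma> (Suc i) x)"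
    if "\<sigma> \<in> carrier G" for \<sigma> i x y
    using Phi_carrier[OF that] by (auto simp: complex_automorphisms_def hom_def)
  have Phi_smult: "\<Phi> \<sigma> i (r \<odot>\<^bsub>M i\<^esub> x) = poly_aut act \<sigma> r \<odot>\<^bsub>M i\<^esub> \<Phi> \<sigma> i x"
    if "\<sigma> \<in> carrier G" "r \<in> carrier ?R" "x \<in> carrier (M i)" for \<sigma> i r x
  proof -
    have "\<Phi> \<sigma> i \<in> module_hom ?R (M i) (twisted_module (poly_aut act \<sigma>) (M i))"
      using equivariant that(1) by (simp add: chain_map_def)
    then show ?thesis using that by (simp add: module_hom_def twisted_module_def)
  qed
  have pi0_Phi: "pi0 (\<Phi> \<sigma> 0 x) = poly_aut act \<sigma> (pi0 x)" if \<sigma>: "\<sigma> \<in> carrier G" and x: "x \<in> carrier (M 0)" for \<sigma> x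
  proof -
    have "homology_map M \<mu> (\<Phi> \<sigma>) 0 (N +>\<^bsub>M 0\<^esub> x) = N +>\<^bsub>M 0\<^esub> \<Phi> \<sigma> 0 x"
      unfolding homology_map_def N_def[symmetric]
    proof (rule quot(3)[OF x])
      show "\<Phi> \<sigma> 0 (y \<oplus>\<^bsub>M 0\<^esub> x) = \<Phi> \<sigma> 0 y \<oplus>\<^bsub>M 0\<^esub> \<Phi> \<sigma> 0 x" if "y \<in> N" for y
        using Phi(3)[OF \<sigma> N_carrier[OF that] x] .
      show "\<Phi> \<sigma> 0 y \<in> N" if "y \<in> N" for y
        using that Phi(4)[OF \<sigma>] Phi(2)[OF \<sigma>] by (auto simp: N_eq)
      show "\<Phi> \<sigma> 0 x \<in> carrier (M 0)" by (rule Phi(2)[OF \<sigma> x])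
    qed
    then show ?thesis using equivariant \<sigma> coset[OF x] by (simp add: pi0_def)
  qed

  \<comment> \<open>Acyclicity in degree 1 makes the cycle a boundary from \<open>M 2\<close>, and
    those lie in \<open>m M_1\<close>.\<close>
  have minimal1: "C1 x \<in> ord_ge 1" if x: "x \<in> carrier (M (Suc 0))" "\<mu> (Suc 0) x = \<zero>\<^bsub>M 0\<^esub>" for x
  proof -
    let ?Z = "cycles M \<mu> (Suc 0)" and ?N = "boundaries M \<mu> (Suc 0)"
    have "x \<in> ?Z" using x by (simp add: cycles_def a_kernel_def')
    then have "?N +>\<^bsub>M (Suc 0)\<^esub> x \<in> carrier (homology M \<mu> (Suc 0))"
      by (auto simp: homology_def quotient_module_def A_RCOSETS_def' a_r_coset_def')
    then have "?N +>\<^bsub>M (Suc 0)\<^esub> x = ?N"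
      using acyclic by (simp add: acyclic_in_positive_degrees_def homology_def quotient_module_def)
    moreover have "\<zero>\<^bsub>M (Suc 0)\<^esub> \<in> ?N"
      using subgroup.one_closed[OF sub[of "Suc 0"]] by (simp add: boundaries_def)
    then have "x \<in> ?N +>\<^bsub>M (Suc 0)\<^esub> x"
      using zero_add[OF x(1)] by (force simp: a_r_coset_def')
    ultimately have "x \<in> \<mu> (Suc (Suc 0)) ` carrier (M (Suc (Suc 0)))" by (simp add: boundaries_def)
    then have "x \<in> ideal_times_module (variable_ideal ?X) (M (Suc 0))"
      using minimal[rule_format, of "Suc (Suc 0)"] by auto
    from ideal_times_module_ord_ge[OF M C1 _ this] show ?thesis
      by (simp only: Int_subset_iff variable_ideal_polys variable_ideal_deg_ge simp_thms)
  qed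

  have act_tau: "act tau = id" by (rule action_of_tau_trivial[OF alg char act])
  note theta = theta_indets[where act = act, OF act_tau] theta_gens[where act = act, OF act_tau]
    theta_deg_ge[where act = act, OF act_tau]
  define T0 where "T0 x = C0 (\<Phi> tau 0 (D0 x))" for x
  define T1 where "T1 x = C1 (\<Phi> tau (Suc 0) (D1 x))" for x
  \<comment> \<open>Given by values on basis vectors, \<open>mu'\<close> and \<open>pi'\<close> are
    linear on all functions, whereas the transported maps make sense only on \<open>vecs\<close>;
    there the two agree.\<close>
  define mu' where "mu' y = (\<Sum>c\<in>B1. y c *s C0 (\<mu> (Suc 0) (D1 (unit_vec c))))" for y
  define pi' where "pi' x = (\<Sum>c\<in>B0. x c * pi0 (D0 (unit_vec c)))" for x
  have mu'_eq: "mu' y = C0 (\<mu> (Suc 0) (D1 y))" if "y \<in> vecs ?X B1" for y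
    unfolding mu'_def
    by (rule linear_expand[symmetric, OF B1 that, of "\<lambda>y. C0 (\<mu> (Suc 0) (D1 y))" scl])
      (simp_all add: D1 mu C0)
  have pi'_eq: "pi' x = pi0 (D0 x)" if "x \<in> vecs ?X B0" for x
    unfolding pi'_def
    by (rule linear_expand[symmetric, OF B0 that, of "\<lambda>x. pi0 (D0 x)" "(*)"])
      (simp_all add: D0 pi0_add pi0_smult)
  have D0_mu': "D0 (mu' y) = \<mu> (Suc 0) (D1 y)" if "y \<in> vecs ?X B1" for y
    using that by (simp add: mu'_eq D0 D1 mu)

  have T1_pow: "(T1 ^^ j) x = C1 (\<Phi> (induced_aut ?X (rot (j * unrot))) (Suc 0) (D1 x))"
    if x: "x \<in> vecs ?X B1" for j x
  proof (induction j)
    case 0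
    let ?u = "induced_aut ?X (rot 0)"
    have u: "?u \<in> carrier G" by (intro induced_aut_in_G symmetry_rot)
    \<comment> \<open>\<open>rot 0\<close> is idempotent, hence so is its image under
      \<open>\<Phi>\<close>; an injective idempotent map is the identity.\<close>
    have "?u \<otimes>\<^bsub>G\<^esub> ?u = ?u"
      by (subst induced_aut_mult_G) (simp_all add: symmetry_rot rot_rot)
    then have "\<Phi> ?u \<otimes>\<^bsub>complex_automorphisms M \<mu>\<^esub> \<Phi> ?u = \<Phi> ?u"
      using hom_mult[OF \<Phi> u u] by simp
    from fun_cong[OF this, of "Suc 0"]
    have "compose (carrier (M (Suc 0))) (\<Phi> ?u (Suc 0)) (\<Phi> ?u (Suc 0)) = \<Phi> ?u (Suc 0)"
      by (simp add: complex_automorphisms_def)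
    from fun_cong[OF this, of "D1 x"]
    have "\<Phi> ?u (Suc 0) (\<Phi> ?u (Suc 0) (D1 x)) = \<Phi> ?u (Suc 0) (D1 x)"
      using D1(4)[OF x] by (simp add: compose_def)
    moreover have "inj_on (\<Phi> ?u (Suc 0)) (carrier (M (Suc 0)))"
      using Phi(1)[OF u, of "Suc 0"] by (simp add: Bij_def bij_betw_def)
    ultimately have "\<Phi> ?u (Suc 0) (D1 x) = D1 x"
      using D1(4)[OF x] Phi(2)[OF u D1(4)[OF x]] by (simp add: inj_on_eq_iff)
    then show ?case using x by (simp add: D1)
  next
    case (Suc j)
    let ?s = "induced_aut ?X (rot (j * unrot))"
    have s: "?s \<in> carrier G" by (intro induced_aut_in_G symmetry_rot)
    have "tau \<otimes>\<^bsub>G\<^esub> ?s = induced_aut ?X (rot (Suc j * unrot))"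
      by (subst induced_aut_mult_G) (simp_all add: symmetry_rot rot_rot)
    then have "\<Phi> (induced_aut ?X (rot (Suc j * unrot))) = \<Phi> tau \<otimes>\<^bsub>complex_automorphisms M \<mu>\<^esub> \<Phi> ?s"
      using hom_mult[OF \<Phi> tau_in_G s] by simp
    then have "\<Phi> (induced_aut ?X (rot (Suc j * unrot))) (Suc 0) (D1 x) = \<Phi> tau (Suc 0) (\<Phi> ?s (Suc 0) (D1 x))"
      using D1(4)[OF x] by (simp add: complex_automorphisms_def compose_def)
    moreover have "(T1 ^^ Suc j) x = C1 (\<Phi> tau (Suc 0) (\<Phi> ?s (Suc 0) (D1 x)))"
    proof -
      have "(T1 ^^ Suc j) x = T1 (C1 (\<Phi> ?s (Suc 0) (D1 x)))" by (simp add: Suc)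
      also have "\<dots> = C1 (\<Phi> tau (Suc 0) (\<Phi> ?s (Suc 0) (D1 x)))"
        unfolding T1_def D1(1)[OF Phi(2)[OF s D1(4)[OF x]]] ..
      finally show ?thesis .
    qed
    ultimately show ?case by simp
  qed

  have "symmetric_presentation p B0 B1 mu' pi' T0 T1 ?\<theta>"
  proof (intro symmetric_presentation.intro symmetric_presentation_axioms.intro)
    show "prime_ideal_data p" ..
    show "finite B0" "finite B1" "CHAR('k) = p" by fact+
    show "mu' (x + y) = mu' x + mu' y" for x y
      by (simp add: mu'_def scl_simps sum.distrib)
    show "mu' (r *s x) = r *s mu' x" for r x
      by (simp add: mu'_def scl_sum scl_simps)
    show "mu' x \<in> vecs ?X B0" if "x \<in> vecs ?X B1" for x
      using that by (simp add: mu'_eq D0 D1 mu)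
    show "pi' (x + y) = pi' x + pi' y" for x y
      by (simp add: pi'_def distrib_right sum.distrib)
    show "pi' (r *s x) = r * pi' x" for r x
      by (simp add: pi'_def sum_distrib_left mult.assoc)
    show "\<exists>q0 q. q0 \<in> polys ?X \<and> (\<forall>i. q i \<in> polys ?X) \<and>
        pi' x = q0 * monomial gen0 + (\<Sum>i<n. q i * monomial (gen i))" if "x \<in> vecs ?X B0" for x
      using subsetD[OF monomial_ideal_subset pi0_closed[OF D0(4)[OF that]]] unfolding pi'_eq[OF that] by blast
    show "\<exists>y\<in>vecs ?X B1. mu' y = x" if x: "x \<in> vecs ?X B0" "pi' x = 0" for x
    proof -
      have "D0 x \<in> N" using x pi0_eq_0[OF D0(4)[OF x(1)]] pi'_eq by simp
      then obtain y where y: "y \<in> carrier (M (Suc 0))" "D0 x = \<mu> (Suc 0) y" by (auto simp: N_eq)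
      then have "mu' (C1 y) = x" using D0(3)[OF x(1)] by (simp add: mu'_eq D1)
      then show ?thesis using D1(2)[OF y(1)] by blast
    qed
    show "pi' (mu' x) = 0" if x: "x \<in> vecs ?X B1" for x
    proof -
      have "D0 (mu' x) \<in> N" using D1(4)[OF x] by (simp add: D0_mu'[OF x] N_eq)
      moreover have "mu' x \<in> vecs ?X B0" using x by (simp add: mu'_eq D0 D1 mu)
      ultimately show ?thesis using pi'_eq pi0_eq_0 D0(4) by simp
    qed
    show "x \<in> ord_ge 1" if x: "x \<in> vecs ?X B1" "mu' x = 0" for x
    proof -
      have "\<mu> (Suc 0) (D1 x) = \<zero>\<^bsub>M 0\<^esub>"
        using D0_mu'[OF x(1)] D0(1)[OF zero_closed] unfolding D0(7) x(2) by (simp only:)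
      then show ?thesis using minimal1[OF D1(4)[OF x(1)]] D1(3)[OF x(1)] by simp
    qed
    have lift: "\<exists>x\<in>vecs ?X B0. pi' x = monomial a" if a: "a \<in> gens" for a
    proof -
      obtain y where y: "y \<in> carrier (M 0)" "pi0 y = monomial a"
        using pi0_surj[OF monomial_in_monomial_ideal[OF a]] by blast
      then have "pi' (C0 y) = monomial a" by (simp add: pi'_eq D0)
      then show ?thesis using D0(2)[OF y(1)] by blast
    qed
    show "\<exists>x\<in>vecs ?X B0. pi' x = monomial gen0" "\<exists>x\<in>vecs ?X B0. pi' x = monomial (gen i)" for i
      by (rule lift, simp)+
    note Phi_tau = Phi[OF tau_in_G] Phi_smult[OF tau_in_G]
    show "T0 (x + y) = T0 x + T0 y" if "x \<in> vecs ?X B0" "y \<in> vecs ?X B0" for x y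
      using that by (simp add: T0_def D0 Phi_tau C0)
    show "T1 (x + y) = T1 x + T1 y" if "x \<in> vecs ?X B1" "y \<in> vecs ?X B1" for x y
      using that by (simp add: T1_def D1 Phi_tau C1)
    note theta_polys = theta_polys[where act = act, OF act_tau]
    show "T0 (r *s x) = ?\<theta> r *s T0 x" if "r \<in> polys ?X" "x \<in> vecs ?X B0" for r x
      using that by (simp add: T0_def D0 Phi_tau C0 theta_polys)
    show "T1 (r *s x) = ?\<theta> r *s T1 x" if "r \<in> polys ?X" "x \<in> vecs ?X B1" for r x
      using that by (simp add: T1_def D1 Phi_tau C1 theta_polys)
    show T0_vecs: "T0 x \<in> vecs ?X B0" if "x \<in> vecs ?X B0" for x
      using that by (simp add: T0_def D0 Phi_tau)
    show "T1 x \<in> vecs ?X B1" if "x \<in> vecs ?X B1" for x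
      using that by (simp add: T1_def D1 Phi_tau)
    show "T0 (mu' x) = mu' (T1 x)" if "x \<in> vecs ?X B1" for x
      using that by (simp add: T0_def T1_def mu'_eq D0 D1 mu Phi_tau)
    have pi'_T0: "pi' (T0 x) = ?\<theta> (pi' x)" if x: "x \<in> vecs ?X B0" for x
      using x T0_vecs[OF x] pi0_Phi[OF tau_in_G D0(4)[OF x]] by (simp add: pi'_eq) (simp add: T0_def D0 Phi_tau)
    show "pi' (T0 x) = monomial gen0" if "x \<in> vecs ?X B0" "pi' x = monomial gen0" for x
      using that by (simp only: pi'_T0 theta)
    show "pi' (T0 x) = monomial (gen (i + 2))" if "x \<in> vecs ?X B0" "pi' x = monomial (gen i)" for x i
      using that by (simp only: pi'_T0 theta)
    show "(T1 ^^ p) x = x" if x: "x \<in> vecs ?X B1" for x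
    proof -
      \<comment> \<open>The \<open>p\<close>-th power of the rotation by two is trivial:
        \<open>p * unrot\<close> is \<open>12\<close> with \<open>n = 4\<close> for
        \<open>p = 2\<close>, and a multiple of \<open>n = p\<close> otherwise.\<close>
      have "n dvd p * unrot"
      proof (cases "p = 2")
        case True
        then have n4: "n = 4" unfolding n_def by (simp add: cycle_length_def)
        then have "unrot = 6" unfolding unrot_def by simp
        then have "p * unrot = 12" using True by (simp only:)
        then show ?thesis unfolding n4 by simp
      next
        case False
        then have "n = p" unfolding n_def by (simp add: cycle_length_def)
        then show ?thesis by simp
      qed
      then have "rot (p * unrot) = rot (0 * unrot)" by (simp only: rot_multiple mult_0 dvd_0_right)
      then have "(T1 ^^ p) x = (T1 ^^ 0) x" using T1_pow[OF x, of p] T1_pow[OF x, of 0] by simp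
      then show ?thesis by simp
    qed
    show "?\<theta> r \<in> deg_ge k" if "r \<in> polys ?X" "r \<in> deg_ge k" for r k
      using that by (rule theta)
  qed (rule theta)+
  then show False by (rule symmetric_presentation.contradiction)
qed

end

theorem theorem7p2:
  fixes p :: nat
    and X :: "Xvar set"
    and I :: "Xvar monom set"
    and G :: "(Xvar monom \<Rightarrow> Xvar monom) monoid"
    and R :: "(Xvar, 'k::field) mpol ring"
    and IR :: "((Xvar, 'k) mpol, (Xvar, 'k) mpol) module"
  assumes "prime p"
    and "CHAR('k) = p"
    and "\<forall>x::'k. algebraic_over_prime_field x"
    and "X = vars p"
    and "I = ideal_of_prime p"
    and "G = ideal_automorphisms (monomial_monoid X) I"
    and "R = poly_ring X"
    and "IR = monomial_ideal_module X I"
  shows "\<not> (\<exists>(act :: (Xvar monom \<Rightarrow> Xvar monom) \<Rightarrow> 'k \<Rightarrow> 'k)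
              (M :: nat \<Rightarrow> ((Xvar, 'k) mpol, 'm) module)
              (\<mu> :: nat \<Rightarrow> 'm \<Rightarrow> 'm)
              (\<Phi> :: (Xvar monom \<Rightarrow> Xvar monom) \<Rightarrow> nat \<Rightarrow> 'm \<Rightarrow> 'm).
      act \<in> hom G field_automorphisms \<and>
      chain_complex R M \<mu> \<and>
      (\<forall>n. finite_free R (M n)) \<and>
      acyclic_in_positive_degrees M \<mu> \<and>
      (\<forall>n\<ge>1. \<mu> n ` carrier (M n) \<subseteq> ideal_times_module (variable_ideal X) (M (n - 1))) \<and>
      \<Phi> \<in> hom G (complex_automorphisms M \<mu>) \<and>
      (\<exists>\<epsilon> \<beta> \<theta>.
        \<epsilon> \<in> module_iso R (homology M \<mu> 0) IR \<and>
        (\<forall>n. \<theta> n \<in> module_iso R (M n) (graded_free_module X (\<beta> n))) \<and>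
        (\<forall>n\<ge>1. (\<lambda>y. \<theta> (n - 1) (\<mu> n (inv_into (carrier (M n)) (\<theta> n) y)))
          \<in> graded_module_hom R
              (graded_free_module X (\<beta> n)) (graded_free_grade X (\<beta> n))
              (graded_free_module X (\<beta> (n - 1))) (graded_free_grade X (\<beta> (n - 1)))) \<and>
        \<epsilon> \<in> graded_module_hom R
              (homology M \<mu> 0) (induced_H0_grade X M \<mu> (\<beta> 0) (\<theta> 0))
              IR (monomial_ideal_grade X I)) \<and>
      (\<exists>\<delta>\<in>module_iso R (homology M \<mu> 0) IR.
        \<forall>\<sigma>\<in>carrier G.
          chain_map R M \<mu> (\<lambda>n. twisted_module (poly_aut act \<sigma>) (M n)) \<mu> (\<Phi> \<sigma>) \<and>
          (\<forall>z\<in>carrier (homology M \<mu> 0).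
            poly_aut act \<sigma> (\<delta> z) = \<delta> (homology_map M \<mu> (\<Phi> \<sigma>) 0 z))))"
proof -
  interpret prime_ideal_data p by unfold_locales fact
  show ?thesis
    unfolding assms(4-8) using assms(2,3)
    by (intro notI, elim exE conjE bexE) (rule no_equivariant_resolution)
qed

end
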